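(* Let $X$ be an affine variety over $\mathbb{C}$ with degree of $\mathbb{C}$-uniruledness at most $d_1$, and let $f:X\to\mathbb{C}^m$ be a generically finite polynomial map of degree $d_2$. Then the set $S_f$ of points of $\mathbb{C}^m$ at which $f$ is not proper has degree of $\mathbb{C}$-uniruledness at most $d_1d_2$.
   Context: Affine varieties are considered embedded in an affine space. The degree of a polynomial map $f=(f_1,\dots,f_m)$ is $\max_i\deg f_i$. The map $f:X\to Y$ between complex affine varieties is generically finite if its general fibers (over its image) are finite, so that infinite fibers cover only a nowhere dense subset of the source. A polynomial map $f:X\to Y$ between complex affine varieties is proper at $y\in Y$ if there is an open neighborhood $U$ of $y$ such that $f|_{f^{-1}(U)}:f^{-1}(U)\to U$ is proper; $S_f$ is the set of points of $Y$ at which $f$ is not proper (here $Y=\mathbb{C}^m$). An irreducible affine curve $\Gamma\subset\mathbb{C}^m$ is a polynomially parametric curve of degree at most $d$ if there is a non-constant polynomial map $\mathbb{C}\to\Gamma$ of degree at most $d$. An affine variety $X$ has degree of $\mathbb{C}$-uniruledness at most $d$ if for every irreducible component $X'$ of $X$ and every $x\in X'$ there is a polynomially parametric curve $l_x\subset X'$ of degree at most $d$ passing through $x$. (Equivalently, for each irreducible component $X'$ there are an affine variety $W$ with $\dim W=\dim X'-1$ and a dominant polynomial map $\phi:\mathbb{C}\times W\to X'$, $(t,w)\mapsto\phi(t,w)$, with $\deg_t\phi\le d$.) By convention the empty set has degree of uniruledness zero. *)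

theory Defs
  imports
    "HOL-Analysis.Analysis"
    "HOL-Library.Poly_Mapping"
    "HOL-Library.Extended_Nat"
    "HOL-Computational_Algebra.Polynomial"
begin

section \<open>Polynomials on complex affine space\<close>

text \<open>Polynomials over the complex numbers in variables indexed by \<open>'n\<close>, as finitely supported
  maps from exponent vectors to coefficients.\<close>

type_synonym 'n cpoly = "('n \<Rightarrow>\<^sub>0 nat) \<Rightarrow>\<^sub>0 complex"

definition monom_eval :: "('n::finite \<Rightarrow>\<^sub>0 nat) \<Rightarrow> complex ^ 'n \<Rightarrow> complex" where
  "monom_eval e x = (\<Prod>i\<in>UNIV. (x $ i) ^ Poly_Mapping.lookup e i)"

definition cpoly_eval :: "'n::finite cpoly \<Rightarrow> complex ^ 'n \<Rightarrow> complex" where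
  "cpoly_eval p x = (\<Sum>e\<in>Poly_Mapping.keys p. Poly_Mapping.lookup p e * monom_eval e x)"

text \<open>The zero polynomial gets total degree 0.\<close>

definition total_degree :: "'n::finite cpoly \<Rightarrow> nat" where
  "total_degree p =
     Max (insert 0 ((\<lambda>e. \<Sum>i\<in>UNIV. Poly_Mapping.lookup e i) ` Poly_Mapping.keys p))"

definition polymap :: "('m::finite \<Rightarrow> 'n::finite cpoly) \<Rightarrow> complex ^ 'n \<Rightarrow> complex ^ 'm" where
  "polymap F x = (\<chi> i. cpoly_eval (F i) x)"

definition polymap_degree :: "('m::finite \<Rightarrow> 'n::finite cpoly) \<Rightarrow> nat" where
  "polymap_degree F = Max (range (\<lambda>i. total_degree (F i)))"


section \<open>Affine varieties and the Zariski topology\<close>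

text \<open>Affine varieties need not be irreducible, and may be empty.\<close>

definition affine_variety :: "(complex ^ 'n::finite) set \<Rightarrow> bool" where
  "affine_variety X \<longleftrightarrow> (\<exists>P :: 'n cpoly set. X = {x. \<forall>p\<in>P. cpoly_eval p x = 0})"

definition zariski :: "(complex ^ 'n::finite) topology" where
  "zariski = topology (\<lambda>U. affine_variety (- U))"

lemma cpoly_eval_0 [simp]: "cpoly_eval 0 x = 0"
  by (simp add: cpoly_eval_def)

lemma cpoly_eval_single [simp]: "cpoly_eval (Poly_Mapping.single e c) x = c * monom_eval e x"
  by (simp add: cpoly_eval_def)

lemma cpoly_eval_add [simp]: "cpoly_eval (p + q) x = cpoly_eval p x + cpoly_eval q x"
  unfolding cpoly_eval_def
  by (rule setsum_keys_plus_distrib) (simp_all add: distrib_right)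

lemma cpoly_eval_sum: "cpoly_eval (\<Sum>a\<in>A. p a) x = (\<Sum>a\<in>A. cpoly_eval (p a) x)"
  by (induction A rule: infinite_finite_induct) simp_all

lemma monom_eval_add: "monom_eval (e + e') x = monom_eval e x * monom_eval e' x"
  by (simp add: monom_eval_def lookup_add power_add prod.distrib)

lemma cpoly_eval_mult [simp]: "cpoly_eval (p * q) x = cpoly_eval p x * cpoly_eval q x"
proof -
  have expand: "r = (\<Sum>e\<in>Poly_Mapping.keys r. Poly_Mapping.single e (Poly_Mapping.lookup r e))"
    for r :: "'a cpoly"
    by (rule poly_mapping_eqI)
       (auto simp: lookup_sum lookup_single when_def in_keys_iff)
  have "p * q = (\<Sum>e\<in>Poly_Mapping.keys p. Poly_Mapping.single e (Poly_Mapping.lookup p e)) *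
      (\<Sum>e\<in>Poly_Mapping.keys q. Poly_Mapping.single e (Poly_Mapping.lookup q e))"
    by (rule arg_cong2[of _ _ _ _ "(*)", OF expand expand])
  also have "\<dots> = (\<Sum>e\<in>Poly_Mapping.keys p. \<Sum>e'\<in>Poly_Mapping.keys q.
      Poly_Mapping.single (e + e') (Poly_Mapping.lookup p e * Poly_Mapping.lookup q e'))"
    by (simp only: sum_product mult_single)
  finally have "cpoly_eval (p * q) x = (\<Sum>e\<in>Poly_Mapping.keys p. \<Sum>e'\<in>Poly_Mapping.keys q.
      (Poly_Mapping.lookup p e * Poly_Mapping.lookup q e') * monom_eval (e + e') x)"
    by (simp only: cpoly_eval_sum cpoly_eval_single)
  then show ?thesis
    by (simp only: cpoly_eval_def sum_product monom_eval_add mult_ac)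
qed

lemma affine_variety_Un:
  assumes "affine_variety X" "affine_variety Y"
  shows "affine_variety (X \<union> Y)"
proof -
  obtain P Q where "X = {x. \<forall>p\<in>P. cpoly_eval p x = 0}" "Y = {x. \<forall>p\<in>Q. cpoly_eval p x = 0}"
    using assms unfolding affine_variety_def by blast
  then have "X \<union> Y = {x. \<forall>r\<in>(\<lambda>(p, q). p * q) ` (P \<times> Q). cpoly_eval r x = 0}"
    by auto
  then show ?thesis
    unfolding affine_variety_def by blast
qed

lemma affine_variety_Inter:
  assumes "\<And>X. X \<in> \<X> \<Longrightarrow> affine_variety X"
  shows "affine_variety (\<Inter>\<X>)"
proof -
  obtain P where P: "\<forall>X\<in>\<X>. X = {x. \<forall>p\<in>P X. cpoly_eval p x = 0}"
    using bchoice[of \<X> "\<lambda>X P. X = {x. \<forall>p\<in>P. cpoly_eval p x = 0}"] assms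
    unfolding affine_variety_def by blast
  have "x \<in> X \<longleftrightarrow> (\<forall>p\<in>P X. cpoly_eval p x = 0)" if "X \<in> \<X>" for x X
    by (subst bspec[OF P that]) simp
  then have "\<Inter>\<X> = {x. \<forall>p\<in>(\<Union>X\<in>\<X>. P X). cpoly_eval p x = 0}"
    by auto
  then show ?thesis
    unfolding affine_variety_def by blast
qed

lemma openin_zariski: "openin zariski U \<longleftrightarrow> affine_variety (- U)"
proof -
  have "istopology (\<lambda>U :: (complex ^ 'a) set. affine_variety (- U))"
    unfolding istopology_def
  proof (intro conjI allI impI)
    fix S T :: "(complex ^ 'a) set"
    assume "affine_variety (- S)" "affine_variety (- T)"
    then show "affine_variety (- (S \<inter> T))"
      by (simp add: Compl_Int affine_variety_Un)
  next
    fix \<K> :: "(complex ^ 'a) set set"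
    assume "\<forall>K\<in>\<K>. affine_variety (- K)"
    then have "affine_variety (\<Inter>(uminus ` \<K>))"
      by (intro affine_variety_Inter) blast
    then show "affine_variety (- \<Union>\<K>)"
      by (simp add: uminus_Sup)
  qed
  then show ?thesis
    by (simp add: zariski_def topology_inverse')
qed

lemma topspace_zariski [simp]: "topspace zariski = UNIV"
proof -
  have "openin zariski (UNIV :: (complex ^ 'a) set)"
    unfolding openin_zariski affine_variety_def
    by (rule exI[of _ "{Poly_Mapping.single 0 1}"]) (auto simp: monom_eval_def simp del: single_one)
  then show ?thesis
    using openin_subset by blast
qed

lemma closedin_zariski: "closedin zariski X \<longleftrightarrow> affine_variety X"
  by (simp add: closedin_def openin_zariski flip: Compl_eq_Diff_UNIV)


section \<open>Irreducibility and dimension\<close>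

definition irreducible_in :: "'a topology \<Rightarrow> 'a set \<Rightarrow> bool" where
  "irreducible_in T S \<longleftrightarrow> S \<subseteq> topspace T \<and> S \<noteq> {} \<and>
     (\<forall>A B. closedin T A \<and> closedin T B \<and> S \<subseteq> A \<union> B \<longrightarrow> S \<subseteq> A \<or> S \<subseteq> B)"

definition irreducible_component :: "'a topology \<Rightarrow> 'a set \<Rightarrow> bool" where
  "irreducible_component T S \<longleftrightarrow> irreducible_in T S \<and>
     (\<forall>S'. irreducible_in T S' \<and> S \<subseteq> S' \<longrightarrow> S' = S)"

text \<open>Supremum of the lengths \<open>n\<close> of chains \<open>Z 0 \<subset> \<dots> \<subset> Z n\<close> of irreducible closed sets. The empty
  space gets dimension 0 here.\<close>

definition krull_dim :: "'a topology \<Rightarrow> enat" where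
  "krull_dim T = Sup {enat n | n. \<exists>Z :: nat \<Rightarrow> 'a set.
     (\<forall>i\<le>n. closedin T (Z i) \<and> irreducible_in T (Z i)) \<and> (\<forall>i<n. Z i \<subset> Z (Suc i))}"

definition irreducible_affine_curve :: "(complex ^ 'n::finite) set \<Rightarrow> bool" where
  "irreducible_affine_curve \<Gamma> \<longleftrightarrow>
     affine_variety \<Gamma> \<and> irreducible_in zariski \<Gamma> \<and> krull_dim (subtopology zariski \<Gamma>) = 1"


section \<open>Degree of uniruledness\<close>

definition param_map :: "('n::finite \<Rightarrow> complex poly) \<Rightarrow> complex \<Rightarrow> complex ^ 'n" where
  "param_map \<gamma> t = (\<chi> i. poly (\<gamma> i) t)"

definition param_degree :: "('n::finite \<Rightarrow> complex poly) \<Rightarrow> nat" where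
  "param_degree \<gamma> = Max (range (\<lambda>i. Polynomial.degree (\<gamma> i)))"

definition polynomially_parametric_curve :: "nat \<Rightarrow> (complex ^ 'n::finite) set \<Rightarrow> bool" where
  "polynomially_parametric_curve d \<Gamma> \<longleftrightarrow> irreducible_affine_curve \<Gamma> \<and>
     (\<exists>\<gamma>. param_degree \<gamma> \<le> d \<and> range (param_map \<gamma>) \<subseteq> \<Gamma> \<and> \<not> param_map \<gamma> constant_on UNIV)"

text \<open>The empty set has no irreducible components, so it satisfies this for every \<open>d\<close>, in
  particular for \<open>d = 0\<close>; no nonempty set satisfies it for \<open>d = 0\<close>.\<close>

definition uniruledness_degree_le :: "(complex ^ 'n::finite) set \<Rightarrow> nat \<Rightarrow> bool" where
  "uniruledness_degree_le X d \<longleftrightarrow> affine_variety X \<and>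
     (\<forall>X'. irreducible_component (subtopology zariski X) X' \<longrightarrow>
       (\<forall>x\<in>X'. \<exists>\<Gamma>. polynomially_parametric_curve d \<Gamma> \<and> \<Gamma> \<subseteq> X' \<and> x \<in> \<Gamma>))"


section \<open>Generic finiteness and the non-properness set\<close>

text \<open>The points of \<open>X\<close> lying on an infinite fibre form a nowhere dense subset of \<open>X\<close>. This refers
  to the Zariski topology; since that set of points is constructible for a polynomial map, the
  Euclidean topology would give the same notion.\<close>

definition generically_finite_on ::
    "(complex ^ 'n::finite) set \<Rightarrow> (complex ^ 'n \<Rightarrow> 'b) \<Rightarrow> bool" where
  "generically_finite_on X f \<longleftrightarrow>
     (subtopology zariski X) interior_of ((subtopology zariski X) closure_of
        {x \<in> X. infinite {x' \<in> X. f x' = f x}}) = {}"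

text \<open>Properness, in contrast, is with respect to the Euclidean topology.\<close>

definition proper_at ::
    "'a::topological_space set \<Rightarrow> ('a \<Rightarrow> 'b::topological_space) \<Rightarrow> 'b \<Rightarrow> bool" where
  "proper_at X f y \<longleftrightarrow> (\<exists>U. open U \<and> y \<in> U \<and>
     proper_map (top_of_set (X \<inter> f -` U)) (top_of_set U) f)"

definition nonproper_set ::
    "'a::topological_space set \<Rightarrow> ('a \<Rightarrow> 'b::topological_space) \<Rightarrow> 'b set" where
  "nonproper_set X f = {y. \<not> proper_at X f y}"

end

theory Submission
  imports Defs "HOL-Computational_Algebra.Fundamental_Theorem_Algebra"
begin

text \<open>A point \<open>y\<close> is in the non-properness set \<open>S\<close> iff there are \<open>x\<^sub>k \<in> X\<close> with \<open>x\<^sub>k \<rightarrow> \<infinity>\<close> and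
  \<open>f x\<^sub>k \<rightarrow> y\<close>; the \<open>x\<^sub>k\<close> may be taken on finite fibres. Choose polynomial curves \<open>\<gamma>\<^sub>k\<close> of degree at most
  \<open>d1\<close> in \<open>X\<close> with \<open>\<gamma>\<^sub>k(0) = x\<^sub>k\<close>. The curves \<open>f \<circ> \<gamma>\<^sub>k\<close> are not constant and have degree at most
  \<open>d1 * d2\<close>, so that after rescaling the parameter a subsequence converges to a non-constant curve
  \<open>\<beta>\<close> with \<open>\<beta>(0) = y\<close>. If \<open>\<beta>(t) \<notin> S\<close>, then the rescaled \<open>\<gamma>\<^sub>k(t)\<close> stay bounded; by interpolation this
  happens for at most \<open>d1\<close> values of \<open>t\<close>, since \<open>\<gamma>\<^sub>k(0) \<rightarrow> \<infinity>\<close>. As \<open>S\<close> is closed, \<open>\<beta>\<close> lies in \<open>S\<close>. A second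
  limit of this kind, along points of a component \<open>S'\<close> of \<open>S\<close> on no other component, gives
  curves inside \<open>S'\<close> through all of its points.

  Zariski closedness of \<open>S\<close> and of polynomial curves and the density of generic points follow from
  one fact: the Zariski closure of the image of a variety under a
  polynomial map is contained in the Euclidean closure. It is reduced to an irreducible variety by
  elimination, and to a hypersurface by projections along lines through the given point which do
  not meet the variety again; on a hypersurface the roots of the minimal polynomial are followed.\<close>

section \<open>Polynomial functions\<close>

text \<open>Properness is Euclidean, whereas components, dimension and generic finiteness are
  Zariski notions. The closure fact is the bridge; it is reached by prime ideals and elimination,
  with induction on the number of variables, and needs no dimension theory or normalization. Generic
  finiteness has one purpose: a curve through a point with finite fibre cannot be contracted by
  \<open>f\<close>. The factor \<open>d1\<close> comes from the curves in \<open>X\<close>, the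
  factor \<open>d2\<close> from composing with \<open>f\<close>; rescaling and limits of
  coefficients never raise a degree. Interpolation helps because a value at 0 is a combination of
  \<open>d1 + 1\<close> other values with weights that do not depend on the curve. Curves must be
  closed, irreducible and of Krull dimension one. So the range of a non-constant parametrization has
  to be shown to be such a curve, and a given curve has to be recognised as the full range of its
  parametrization before one of its points can be moved to parameter 0. The second limit is needed
  because a curve in \<open>S\<close> found through a point of several components may lie in the
  wrong one.\<close>

text \<open>Points have infinitely many coordinates, of which a polynomial in \<open>n\<close> variables uses the first
  \<open>n\<close>; in this way the number of variables can vary within a statement.\<close>

type_synonym point = "nat \<Rightarrow> complex"
type_synonym pfun = "point \<Rightarrow> complex"

text \<open>Polynomials are functions here, not formal expressions: over an infinite field nothing
  is lost, ideals become sets of functions, and substitution is composition. Degrees are not visible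
  in this form; they enter through explicit bounds on families of univariate polynomials.\<close>

inductive_set mpol :: "nat \<Rightarrow> pfun set" for n where
  mpol_const: "(\<lambda>x. c) \<in> mpol n"
| mpol_var: "i < n \<Longrightarrow> (\<lambda>x. x i) \<in> mpol n"
| mpol_add: "f \<in> mpol n \<Longrightarrow> g \<in> mpol n \<Longrightarrow> (\<lambda>x. f x + g x) \<in> mpol n"
| mpol_mult: "f \<in> mpol n \<Longrightarrow> g \<in> mpol n \<Longrightarrow> (\<lambda>x. f x * g x) \<in> mpol n"

lemma mpol_cmult: "f \<in> mpol n \<Longrightarrow> (\<lambda>x. c * f x) \<in> mpol n"
  by (rule mpol_mult[OF mpol_const])

lemma mpol_uminus: "f \<in> mpol n \<Longrightarrow> (\<lambda>x. - f x) \<in> mpol n"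
  using mpol_cmult[of f n "-1"] by simp

lemma mpol_diff: "f \<in> mpol n \<Longrightarrow> g \<in> mpol n \<Longrightarrow> (\<lambda>x. f x - g x) \<in> mpol n"
  using mpol_add[OF _ mpol_uminus, of f n g] by simp

lemma mpol_power: "f \<in> mpol n \<Longrightarrow> (\<lambda>x. f x ^ k) \<in> mpol n"
  by (induction k) (auto intro: mpol_const mpol_mult)

lemma mpol_sum: "(\<And>a. a \<in> A \<Longrightarrow> f a \<in> mpol n) \<Longrightarrow> (\<lambda>x. \<Sum>a\<in>A. f a x) \<in> mpol n"
  by (induction A rule: infinite_finite_induct) (auto intro: mpol_const mpol_add)

lemma mpol_subst:
  assumes "f \<in> mpol n" "\<And>i. i < n \<Longrightarrow> (\<lambda>x. \<phi> x i) \<in> mpol m"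
  shows "(\<lambda>x. f (\<phi> x)) \<in> mpol m"
  using assms(1) by induction (auto intro: mpol.intros assms(2))

lemma mpol_mono: "f \<in> mpol n \<Longrightarrow> n \<le> m \<Longrightarrow> f \<in> mpol m"
  by (rule mpol_subst[of f n "\<lambda>x. x" m]) (auto intro: mpol_var)

lemma mpol_mono': "n \<le> m \<Longrightarrow> mpol n \<subseteq> mpol m"
  using mpol_mono by blast

lemma mpol_cong: "f \<in> mpol n \<Longrightarrow> (\<And>i. i < n \<Longrightarrow> x i = y i) \<Longrightarrow> f x = f y"
  by (induction rule: mpol.induct) auto

lemma mpol_tendsto:
  "f \<in> mpol n \<Longrightarrow> (\<And>i. i < n \<Longrightarrow> ((\<lambda>k. u k i) \<longlongrightarrow> a i) \<F>) \<Longrightarrow> ((\<lambda>k. f (u k)) \<longlongrightarrow> f a) \<F>"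
  by (induction rule: mpol.induct) (auto intro: tendsto_intros)

lemma mpol_line:
  assumes "f \<in> mpol n"
  shows "\<exists>q. \<forall>t. f (\<lambda>i. a i + t * v i) = poly q t"
  using assms
proof induction
  case (mpol_const c)
  show ?case by (rule exI[of _ "[:c:]"]) simp
next
  case (mpol_var i)
  show ?case by (rule exI[of _ "[:a i, v i:]"]) simp
next
  case (mpol_add f g)
  then obtain q r where "\<forall>t. f (\<lambda>i. a i + t * v i) = poly q t" "\<forall>t. g (\<lambda>i. a i + t * v i) = poly r t"
    by blast
  then show ?case by (intro exI[of _ "q + r"]) simp
next
  case (mpol_mult f g)
  then obtain q r where "\<forall>t. f (\<lambda>i. a i + t * v i) = poly q t" "\<forall>t. g (\<lambda>i. a i + t * v i) = poly r t"
    by blast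
  then show ?case by (intro exI[of _ "q * r"]) simp
qed

lemma poly_eventually_nonzero:
  assumes "q \<noteq> (0 :: complex poly)"
  shows "eventually (\<lambda>t. poly q t \<noteq> 0) (at a)"
proof -
  have "\<not> a islimpt {t. poly q t = 0}"
    by (rule islimpt_finite[OF poly_roots_finite[OF assms]])
  then show ?thesis by (simp add: islimpt_iff_eventually)
qed

text \<open>On the line from \<open>y0\<close> towards \<open>a\<close> the function is a univariate
  polynomial, nonzero because of its value at parameter 1, so it has no zeros at small nonzero
  parameters.\<close>

lemma mpol_nonzero_near:
  assumes "f \<in> mpol n" "f a \<noteq> 0" "\<epsilon> > 0"
  shows "\<exists>y. f y \<noteq> 0 \<and> (\<forall>i<n. cmod (y i - y0 i) < \<epsilon>)"
proof -
  obtain q where q: "\<And>t. f (\<lambda>i. y0 i + t * (a i - y0 i)) = poly q t"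
    using mpol_line[OF assms(1), of y0 "\<lambda>i. a i - y0 i"] by auto
  have "poly q 1 \<noteq> 0" using q[of 1] assms(2) by simp
  then have "q \<noteq> 0" by auto
  then have ev1: "eventually (\<lambda>t. poly q t \<noteq> 0) (at 0)" by (rule poly_eventually_nonzero)
  have ev2: "eventually (\<lambda>t. \<forall>i<n. cmod ((y0 i + t * (a i - y0 i)) - y0 i) < \<epsilon>) (at 0)"
  proof -
    have "eventually (\<lambda>t. \<forall>i\<in>{..<n}. cmod (t * (a i - y0 i)) < \<epsilon>) (at (0::complex))"
    proof (rule eventually_ball_finite, simp, rule ballI)
      fix i
      have "((\<lambda>t. cmod (t * (a i - y0 i))) \<longlongrightarrow> cmod (0 * (a i - y0 i))) (at (0::complex))"
        by (intro tendsto_intros)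
      then show "eventually (\<lambda>t. cmod (t * (a i - y0 i)) < \<epsilon>) (at 0)"
        using assms(3) by (auto dest: order_tendstoD)
    qed
    then show ?thesis by (simp add: Ball_def)
  qed
  have "eventually (\<lambda>t. poly q t \<noteq> 0 \<and> (\<forall>i<n. cmod ((y0 i + t * (a i - y0 i)) - y0 i) < \<epsilon>)) (at 0)"
    using ev1 ev2 by (rule eventually_conj)
  then obtain t where "poly q t \<noteq> 0" "\<forall>i<n. cmod ((y0 i + t * (a i - y0 i)) - y0 i) < \<epsilon>"
    using eventually_happens'[OF at_neq_bot] by blast
  then show ?thesis
    by (intro exI[of _ "\<lambda>i. y0 i + t * (a i - y0 i)"]) (simp add: q)
qed

text \<open>The restrictions to the line through \<open>a\<close> and \<open>b\<close> are two
  nonzero univariate polynomials, so their product has a non-root.\<close>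

lemma mpol_domain:
  assumes "f \<in> mpol n" "g \<in> mpol n" "f a \<noteq> 0" "g b \<noteq> 0"
  obtains c where "f c \<noteq> 0" "g c \<noteq> 0"
proof -
  obtain q where q: "\<And>t. f (\<lambda>i. a i + t * (b i - a i)) = poly q t"
    using mpol_line[OF assms(1), of a "\<lambda>i. b i - a i"] by auto
  obtain r where r: "\<And>t. g (\<lambda>i. a i + t * (b i - a i)) = poly r t"
    using mpol_line[OF assms(2), of a "\<lambda>i. b i - a i"] by auto
  have "q \<noteq> 0" "r \<noteq> 0" using q[of 0] r[of 1] assms(3,4) by auto
  then have "q * r \<noteq> 0" by simp
  then obtain t where "poly (q * r) t \<noteq> 0"
    using poly_all_0_iff_0 by blast
  then show ?thesis
    by (intro that[of "\<lambda>i. a i + t * (b i - a i)"]) (simp_all add: q r)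
qed

text \<open>Polynomials in one more variable are handled as families of univariate polynomials; the
  bound \<open>D\<close> is strict, so that \<open>pfam n 0\<close> contains only the zero family.\<close>

definition pfam :: "nat \<Rightarrow> nat \<Rightarrow> (point \<Rightarrow> complex poly) set" where
  "pfam n D = {p. (\<forall>k. (\<lambda>x. coeff (p x) k) \<in> mpol n) \<and> (\<forall>x k. D \<le> k \<longrightarrow> coeff (p x) k = 0)}"

definition pev :: "nat \<Rightarrow> (point \<Rightarrow> complex poly) \<Rightarrow> point \<Rightarrow> complex" where
  "pev n p = (\<lambda>x. poly (p x) (x n))"

lemma pfam_coeff: "p \<in> pfam n D \<Longrightarrow> (\<lambda>x. coeff (p x) k) \<in> mpol n"
  by (simp add: pfam_def)

lemma pfam_high: "p \<in> pfam n D \<Longrightarrow> D \<le> k \<Longrightarrow> coeff (p x) k = 0"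
  by (simp add: pfam_def)

lemma pfam_mono: "p \<in> pfam n D \<Longrightarrow> D \<le> E \<Longrightarrow> p \<in> pfam n E"
  by (auto simp: pfam_def)

lemma pfam_cong: "p \<in> pfam n D \<Longrightarrow> (\<And>i. i < n \<Longrightarrow> x i = y i) \<Longrightarrow> p x = p y"
  by (rule poly_eqI) (rule mpol_cong[OF pfam_coeff])

lemma pfam_upd [simp]: "p \<in> pfam n D \<Longrightarrow> p (x(n := t)) = p x"
  by (rule pfam_cong) auto

lemma pfam_0: "(\<lambda>x. 0) \<in> pfam n D"
  by (auto simp: pfam_def intro: mpol_const)

lemma pfam_add: "p \<in> pfam n D \<Longrightarrow> q \<in> pfam n D \<Longrightarrow> (\<lambda>x. p x + q x) \<in> pfam n D"
  by (auto simp: pfam_def intro: mpol_add)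

lemma pfam_diff: "p \<in> pfam n D \<Longrightarrow> q \<in> pfam n D \<Longrightarrow> (\<lambda>x. p x - q x) \<in> pfam n D"
  by (auto simp: pfam_def intro: mpol_diff)

lemma pfam_smult: "f \<in> mpol n \<Longrightarrow> p \<in> pfam n D \<Longrightarrow> (\<lambda>x. smult (f x) (p x)) \<in> pfam n D"
  by (auto simp: pfam_def intro: mpol_mult)

lemma pfam_mult:
  assumes "p \<in> pfam n D" "q \<in> pfam n E"
  shows "(\<lambda>x. p x * q x) \<in> pfam n (D + E)"
  unfolding pfam_def
proof (intro CollectI conjI allI impI)
  fix k
  show "(\<lambda>x. coeff (p x * q x) k) \<in> mpol n"
    unfolding coeff_mult using assms by (intro mpol_sum mpol_mult pfam_coeff)
next
  fix x k assume k: "D + E \<le> k"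
  show "coeff (p x * q x) k = 0"
    unfolding coeff_mult
  proof (rule sum.neutral, rule ballI)
    fix i assume "i \<in> {..k}"
    then have "D \<le> i \<or> E \<le> k - i" using k by auto
    then show "coeff (p x) i * coeff (q x) (k - i) = 0"
      using assms pfam_high by auto
  qed
qed

lemma pfam_monom: "f \<in> mpol n \<Longrightarrow> k < D \<Longrightarrow> (\<lambda>x. monom (f x) k) \<in> pfam n D"
  unfolding pfam_def
proof (intro CollectI conjI allI impI)
  fix j assume "f \<in> mpol n"
  then show "(\<lambda>x. coeff (monom (f x) k) j) \<in> mpol n"
    by (cases "j = k") (auto simp: coeff_monom intro: mpol_const)
qed (auto simp: coeff_monom)

lemma pfam_pev_sum: "p \<in> pfam n D \<Longrightarrow> pev n p = (\<lambda>x. \<Sum>k<D. coeff (p x) k * x n ^ k)"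
proof (rule ext)
  fix x assume p: "p \<in> pfam n D"
  have "poly (p x) (x n) = (\<Sum>k\<le>degree (p x). coeff (p x) k * x n ^ k)"
    by (rule poly_altdef)
  also have "\<dots> = (\<Sum>k\<in>{..degree (p x)} \<union> {..<D}. coeff (p x) k * x n ^ k)"
    by (rule sum.mono_neutral_left) (auto simp: coeff_eq_0)
  also have "\<dots> = (\<Sum>k<D. coeff (p x) k * x n ^ k)"
    by (rule sum.mono_neutral_right) (auto simp: pfam_high[OF p])
  finally show "pev n p x = (\<Sum>k<D. coeff (p x) k * x n ^ k)" by (simp add: pev_def)
qed

lemma pev_mpol: "p \<in> pfam n D \<Longrightarrow> pev n p \<in> mpol (Suc n)"
  unfolding pfam_pev_sum
  by (intro mpol_sum mpol_mult mpol_power mpol_var) (auto intro: mpol_mono[OF pfam_coeff])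

text \<open>Serves three substitutions: replacing the last variable by a parameter, moving along a
  fixed direction, and scaling.\<close>

lemma mpol_subst_family:
  assumes "f \<in> mpol n" "\<And>i. i < n \<Longrightarrow> \<exists>D p. p \<in> pfam m D \<and> (\<forall>x t. \<phi> x t i = poly (p x) t)"
  shows "\<exists>D p. p \<in> pfam m D \<and> (\<forall>x t. f (\<phi> x t) = poly (p x) t)"
  using assms(1)
proof induction
  case (mpol_const c)
  have "(\<lambda>x. monom c 0) \<in> pfam m 1" by (rule pfam_monom) (auto intro: mpol.intros)
  then show ?case by (intro exI conjI, assumption) (simp add: poly_monom)
next
  case (mpol_var i)
  then show ?case by (rule assms(2))
next
  case (mpol_add f g)
  then obtain D p E q where pq: "p \<in> pfam m D" "q \<in> pfam m E"
    "\<forall>x t. f (\<phi> x t) = poly (p x) t" "\<forall>x t. g (\<phi> x t) = poly (q x) t" by auto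
  have "(\<lambda>x. p x + q x) \<in> pfam m (max D E)"
    by (intro pfam_add pfam_mono[OF pq(1)] pfam_mono[OF pq(2)]) auto
  then show ?case by (intro exI conjI, assumption) (simp add: pq)
next
  case (mpol_mult f g)
  then obtain D p E q where pq: "p \<in> pfam m D" "q \<in> pfam m E"
    "\<forall>x t. f (\<phi> x t) = poly (p x) t" "\<forall>x t. g (\<phi> x t) = poly (q x) t" by auto
  have "(\<lambda>x. p x * q x) \<in> pfam m (D + E)"
    by (intro pfam_mult pq)
  then show ?case by (intro exI conjI, assumption) (simp add: pq)
qed

lemma mpol_Suc_pfam:
  assumes "f \<in> mpol (Suc n)"
  shows "\<exists>D p. p \<in> pfam n D \<and> f = pev n p"
proof -
  have "\<exists>D p. p \<in> pfam n D \<and> (\<forall>x t. f (x(n := t)) = poly (p x) t)"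
  proof (rule mpol_subst_family[OF assms])
    fix i assume i: "i < Suc n"
    show "\<exists>D p. p \<in> pfam n D \<and> (\<forall>x t. (x(n := t)) i = poly (p x) t)"
    proof (cases "i = n")
      case True
      have "(\<lambda>x. monom 1 1) \<in> pfam n 2" by (rule pfam_monom) (auto intro: mpol.intros)
      then show ?thesis by (intro exI conjI, assumption) (simp add: poly_monom True)
    next
      case False
      then have "(\<lambda>x. monom (x i) 0) \<in> pfam n 1"
        using i by (intro pfam_monom) (auto intro: mpol.intros)
      then show ?thesis by (intro exI conjI, assumption) (simp add: poly_monom False)
    qed
  qed
  then obtain D p where p: "p \<in> pfam n D" "\<And>x t. f (x(n := t)) = poly (p x) t" by auto
  have "f x = pev n p x" for x using p(2)[of x "x n"] by (simp add: pev_def)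
  then show ?thesis using p(1) by blast
qed

text \<open>The leading coefficient \<open>b\<close> of the divisor is not invertible, so each step
  multiplies the dividend by \<open>b\<close> before its top term is cancelled; \<open>k\<close>
  counts these steps. For \<open>D \<le> d\<close> truncated subtraction turns the bound on the
  quotient into 0, which means the zero family.\<close>

lemma pseudo_division:
  assumes F: "F \<in> pfam n (Suc d)"
  shows "G \<in> pfam n D \<Longrightarrow> \<exists>k Q R. Q \<in> pfam n (D - d) \<and> R \<in> pfam n d \<and>
    (\<forall>x. smult (coeff (F x) d ^ k) (G x) = Q x * F x + R x)"
proof (induction D arbitrary: G)
  case 0
  then show ?case
    by (intro exI[of _ 0] exI[of _ "\<lambda>x. 0"] exI[of _ G] conjI) (auto intro: pfam_0 pfam_mono)
next
  case (Suc D)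
  let ?b = "\<lambda>x. coeff (F x) d"
  show ?case
  proof (cases "Suc D \<le> d")
    case True
    then show ?thesis
      by (intro exI[of _ 0] exI[of _ "\<lambda>x. 0"] exI[of _ G] conjI)
        (use Suc.prems in \<open>auto intro: pfam_0 pfam_mono\<close>)
  next
    case False
    then have dD: "d \<le> D" by simp
    let ?M = "\<lambda>x. monom (coeff (G x) D) (D - d)"
    have M: "?M \<in> pfam n (Suc D - d)"
      using dD by (intro pfam_monom pfam_coeff[OF Suc.prems]) auto
    let ?G' = "\<lambda>x. smult (?b x) (G x) - ?M x * F x"
    have G1: "?G' \<in> pfam n (Suc D - d + Suc d)"
      using pfam_mult[OF M F] pfam_mono[OF pfam_smult[OF pfam_coeff[OF F] Suc.prems]] dD
      by (intro pfam_diff) auto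
    have G0: "coeff (?G' x) k = 0" if "D \<le> k" for x k
    proof (cases "k = D")
      case True
      then show ?thesis using dD by (simp add: coeff_monom_mult)
    next
      case False
      then have "Suc D \<le> k" "Suc d \<le> k - (D - d)" using that dD by auto
      then show ?thesis using pfam_high[OF Suc.prems] pfam_high[OF F]
        by (simp add: coeff_monom_mult)
    qed
    have "?G' \<in> pfam n D"
      using G1 G0 unfolding pfam_def by blast
    from Suc.IH[OF this] obtain k Q R where QR: "Q \<in> pfam n (D - d)" "R \<in> pfam n d"
      "\<And>x. smult (?b x ^ k) (?G' x) = Q x * F x + R x" by blast
    have "smult (?b x ^ Suc k) (G x) = (Q x + smult (?b x ^ k) (?M x)) * F x + R x" for x
    proof -
      have "smult (?b x ^ Suc k) (G x) = smult (?b x ^ k) (?G' x) + smult (?b x ^ k) (?M x) * F x"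
        by (simp add: smult_diff_right mult.commute)
      then show ?thesis unfolding QR(3) by (simp add: algebra_simps)
    qed
    moreover have "(\<lambda>x. Q x + smult (?b x ^ k) (?M x)) \<in> pfam n (Suc D - d)"
      by (intro pfam_add pfam_smult mpol_power M pfam_coeff[OF F] pfam_mono[OF QR(1)]) simp
    ultimately show ?thesis using QR(2)
      by (intro exI[of _ "Suc k"] exI[of _ "\<lambda>x. Q x + smult (?b x ^ k) (?M x)"] exI[of _ R]) blast
  qed
qed

lemma pev_remainder:
  assumes "\<And>x. smult (g x) (H x) = A x * G x + R x"
  shows "(\<lambda>x. g x * pev n H x - pev n A x * pev n G x) = pev n R"
proof
  fix x
  have "poly (smult (g x) (H x)) (x n) = poly (A x * G x + R x) (x n)" by (simp add: assms)
  then show "g x * pev n H x - pev n A x * pev n G x = pev n R x" by (simp add: pev_def)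
qed

section \<open>Prime ideals and elimination\<close>

definition mideal :: "nat \<Rightarrow> pfun set \<Rightarrow> bool" where
  "mideal n I \<longleftrightarrow> I \<subseteq> mpol n \<and> (\<lambda>x. 0) \<in> I \<and> (\<forall>f\<in>I. \<forall>g\<in>I. (\<lambda>x. f x + g x) \<in> I) \<and>
     (\<forall>f\<in>mpol n. \<forall>g\<in>I. (\<lambda>x. f x * g x) \<in> I)"

definition mprime :: "nat \<Rightarrow> pfun set \<Rightarrow> bool" where
  "mprime n P \<longleftrightarrow> mideal n P \<and> (\<lambda>x. 1) \<notin> P \<and>
     (\<forall>f\<in>mpol n. \<forall>g\<in>mpol n. (\<lambda>x. f x * g x) \<in> P \<longrightarrow> f \<in> P \<or> g \<in> P)"

definition mzeros :: "pfun set \<Rightarrow> point set" where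
  "mzeros P = {a. \<forall>f\<in>P. f a = 0}"

lemma mzerosD: "a \<in> mzeros P \<Longrightarrow> f \<in> P \<Longrightarrow> f a = 0"
  by (simp add: mzeros_def)

lemma mideal_sub: "mideal n I \<Longrightarrow> f \<in> I \<Longrightarrow> f \<in> mpol n"
  by (auto simp: mideal_def)

lemma mideal_0: "mideal n I \<Longrightarrow> (\<lambda>x. 0) \<in> I"
  by (auto simp: mideal_def)

lemma mideal_add: "mideal n I \<Longrightarrow> f \<in> I \<Longrightarrow> g \<in> I \<Longrightarrow> (\<lambda>x. f x + g x) \<in> I"
  by (auto simp: mideal_def)

lemma mideal_mult: "mideal n I \<Longrightarrow> f \<in> mpol n \<Longrightarrow> g \<in> I \<Longrightarrow> (\<lambda>x. f x * g x) \<in> I"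
  by (auto simp: mideal_def)

lemma mideal_mult': "mideal n I \<Longrightarrow> f \<in> I \<Longrightarrow> g \<in> mpol n \<Longrightarrow> (\<lambda>x. f x * g x) \<in> I"
  using mideal_mult[of n I g f] by (simp add: mult.commute)

lemma mideal_uminus: "mideal n I \<Longrightarrow> f \<in> I \<Longrightarrow> (\<lambda>x. - f x) \<in> I"
  using mideal_mult[of n I "\<lambda>x. -1" f] mpol_const[of "-1" n] by simp

lemma mideal_diff: "mideal n I \<Longrightarrow> f \<in> I \<Longrightarrow> g \<in> I \<Longrightarrow> (\<lambda>x. f x - g x) \<in> I"
  using mideal_add[of n I f "\<lambda>x. - g x"] mideal_uminus[of n I g] by simp

lemma mideal_sum: "mideal n I \<Longrightarrow> (\<And>a. a \<in> A \<Longrightarrow> f a \<in> I) \<Longrightarrow> (\<lambda>x. \<Sum>a\<in>A. f a x) \<in> I"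
  by (induction A rule: infinite_finite_induct) (auto intro: mideal_0 mideal_add)

lemma mprime_ideal: "mprime n P \<Longrightarrow> mideal n P"
  by (simp add: mprime_def)

lemma mprime_1: "mprime n P \<Longrightarrow> (\<lambda>x. 1) \<notin> P"
  by (simp add: mprime_def)

lemma mprime_mult: "mprime n P \<Longrightarrow> f \<in> mpol n \<Longrightarrow> g \<in> mpol n \<Longrightarrow> (\<lambda>x. f x * g x) \<in> P \<Longrightarrow> f \<in> P \<or> g \<in> P"
  by (simp add: mprime_def)

lemma mprime_power: "mprime n P \<Longrightarrow> f \<in> mpol n \<Longrightarrow> f \<notin> P \<Longrightarrow> (\<lambda>x. f x ^ k) \<notin> P"
proof (induction k)
  case 0
  then show ?case by (simp add: mprime_1)
next
  case (Suc k)
  then show ?case using mprime_mult[of n P f "\<lambda>x. f x ^ k"] mpol_power[of f n k] by auto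
qed

lemma mideal_restrict: "mideal m I \<Longrightarrow> n \<le> m \<Longrightarrow> mideal n (I \<inter> mpol n)"
  unfolding mideal_def using mpol_mono[of _ n m] by (auto intro: mpol.intros)

lemma mprime_restrict: "mprime m P \<Longrightarrow> n \<le> m \<Longrightarrow> mprime n (P \<inter> mpol n)"
  using mideal_restrict[of m P n] mpol_mono[of _ n m] unfolding mprime_def by blast

lemma pev_ideal:
  assumes "mideal (Suc n) I" "p \<in> pfam n D" "\<And>k. (\<lambda>x. coeff (p x) k) \<in> I"
  shows "pev n p \<in> I"
  unfolding pfam_pev_sum[OF assms(2)]
  by (rule mideal_sum mideal_mult' assms(1,3) mpol_power mpol_var)+ simp

text \<open>Leading terms with coefficient in \<open>P\<close> are removed one after another. These
  terms also lie in \<open>Q\<close>, so membership in \<open>Q\<close> is kept; the coefficient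
  with index \<open>k\<close> lies outside \<open>P\<close> and is never removed, so the process
  stops.\<close>

lemma pfam_drop:
  assumes "mideal (Suc n) P" "mideal (Suc n) Q" "P \<subseteq> Q"
  shows "G \<in> pfam n E \<Longrightarrow> pev n G \<in> Q \<Longrightarrow> (\<lambda>x. coeff (G x) k) \<notin> P \<Longrightarrow>
    \<exists>e<E. \<exists>G'\<in>pfam n (Suc e). pev n G' \<in> Q \<and> (\<lambda>x. coeff (G' x) e) \<notin> P"
proof (induction E arbitrary: G)
  case 0
  then have "(\<lambda>x. coeff (G x) k) = (\<lambda>x. 0)" by (simp add: pfam_def)
  then show ?case using 0 mideal_0[OF assms(1)] by simp
next
  case (Suc E)
  show ?case
  proof (cases "(\<lambda>x. coeff (G x) E) \<in> P")
    case False
    then show ?thesis using Suc.prems by blast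
  next
    case True
    let ?G' = "\<lambda>x. G x - monom (coeff (G x) E) E"
    have M: "(\<lambda>x. monom (coeff (G x) E) E) \<in> pfam n (Suc E)"
      by (intro pfam_monom pfam_coeff[OF Suc.prems(1)]) simp
    have "?G' \<in> pfam n (Suc E)" by (intro pfam_diff Suc.prems(1) M)
    moreover have "coeff (?G' x) j = 0" if "E \<le> j" for x j
      using that pfam_high[OF Suc.prems(1), of j] by (cases "j = E") auto
    ultimately have G': "?G' \<in> pfam n E" unfolding pfam_def by blast
    have "(\<lambda>x. pev n G x - coeff (G x) E * x n ^ E) \<in> Q"
      using True assms Suc.prems
      by (intro mideal_diff[OF assms(2)] mideal_mult'[OF assms(2)] mpol_power mpol_var) auto
    then have "pev n ?G' \<in> Q" by (simp add: pev_def poly_monom)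
    moreover have "(\<lambda>x. coeff (?G' x) k) \<notin> P"
    proof (cases "k = E")
      case True
      then show ?thesis using \<open>(\<lambda>x. coeff (G x) E) \<in> P\<close> Suc.prems(3) by simp
    next
      case False
      then show ?thesis using Suc.prems(3) by simp
    qed
    ultimately show ?thesis using Suc.IH[OF G'] less_SucI by blast
  qed
qed

text \<open>For \<open>P = Q\<close> prime this is the minimal polynomial of the last coordinate
  over the fraction field of the first \<open>n\<close> coordinates modulo \<open>P\<close>, with
  denominators cleared. For a larger \<open>Q\<close> it generates \<open>Q\<close> over that field,
  so it acts as a gcd.\<close>

lemma pfam_minimal:
  assumes "mideal (Suc n) P" "mideal (Suc n) Q" "P \<subseteq> Q"
    and "G \<in> pfam n E" "pev n G \<in> Q" "(\<lambda>x. coeff (G x) k) \<notin> P"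
  obtains e F where "F \<in> pfam n (Suc e)" "pev n F \<in> Q" "(\<lambda>x. coeff (F x) e) \<notin> P" "e < E"
    "\<And>G k. G \<in> pfam n e \<Longrightarrow> pev n G \<in> Q \<Longrightarrow> (\<lambda>x. coeff (G x) k) \<in> P"
proof -
  define A where "A e \<longleftrightarrow> (\<exists>G'\<in>pfam n (Suc e). pev n G' \<in> Q \<and> (\<lambda>x. coeff (G' x) e) \<notin> P)" for e
  have ex: "\<exists>e<E. A e" using pfam_drop[OF assms] unfolding A_def .
  define e where "e = (LEAST e. A e)"
  have "A e" unfolding e_def using ex by (metis LeastI)
  moreover have "e < E" unfolding e_def using ex by (metis Least_le le_less_trans)
  moreover have "(\<lambda>x. coeff (G x) k) \<in> P" if "G \<in> pfam n e" "pev n G \<in> Q" for G k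
  proof (rule ccontr)
    assume "(\<lambda>x. coeff (G x) k) \<notin> P"
    then have "\<exists>e'<e. A e'" using pfam_drop[OF assms(1-3) that] unfolding A_def by blast
    then show False unfolding e_def using not_less_Least by blast
  qed
  ultimately show ?thesis using that unfolding A_def by blast
qed

lemma mideal_extend:
  assumes I: "mideal n I" and f: "f \<in> mpol n"
  shows "mideal n {\<lambda>x. \<pi> x + f x * s x | \<pi> s. \<pi> \<in> I \<and> s \<in> mpol n}" (is "mideal n ?Q")
    and "I \<subseteq> {\<lambda>x. \<pi> x + f x * s x | \<pi> s. \<pi> \<in> I \<and> s \<in> mpol n}"
    and "f \<in> {\<lambda>x. \<pi> x + f x * s x | \<pi> s. \<pi> \<in> I \<and> s \<in> mpol n}"
proof -
  show "mideal n ?Q"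
    unfolding mideal_def
  proof (intro conjI ballI subsetI)
    fix g assume "g \<in> ?Q" then show "g \<in> mpol n"
      using mideal_sub[OF I] f by (auto intro: mpol.intros)
  next
    show "(\<lambda>x. 0) \<in> ?Q" using mideal_0[OF I]
      by (intro CollectI exI[of _ "\<lambda>x. 0"] conjI) (auto intro: mpol.intros)
  next
    fix g h assume "g \<in> ?Q" "h \<in> ?Q"
    then obtain \<pi> s \<pi>' s' where *: "\<pi> \<in> I" "s \<in> mpol n" "g = (\<lambda>x. \<pi> x + f x * s x)"
      "\<pi>' \<in> I" "s' \<in> mpol n" "h = (\<lambda>x. \<pi>' x + f x * s' x)" by blast
    show "(\<lambda>x. g x + h x) \<in> ?Q"
      by (intro CollectI, rule exI[where x = "\<lambda>x. \<pi> x + \<pi>' x"], rule exI[where x = "\<lambda>x. s x + s' x"],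
          intro conjI mpol_add mideal_add[OF I] *) (simp add: * algebra_simps)
  next
    fix g h assume g: "g \<in> mpol n" and "h \<in> ?Q"
    then obtain \<pi> s where *: "\<pi> \<in> I" "s \<in> mpol n" "h = (\<lambda>x. \<pi> x + f x * s x)" by blast
    show "(\<lambda>x. g x * h x) \<in> ?Q"
      by (intro CollectI, rule exI[where x = "\<lambda>x. g x * \<pi> x"], rule exI[where x = "\<lambda>x. g x * s x"],
          intro conjI mpol_mult mideal_mult[OF I] * g) (simp add: * algebra_simps)
  qed
  show "I \<subseteq> ?Q"
  proof
    fix g assume "g \<in> I"
    show "g \<in> ?Q"
      by (intro CollectI, rule exI[where x = g], rule exI[where x = "\<lambda>x. 0"])
        (use \<open>g \<in> I\<close> in \<open>auto intro: mpol_const\<close>)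
  qed
  show "f \<in> ?Q"
    by (intro CollectI, rule exI[where x = "\<lambda>x. 0"], rule exI[where x = "\<lambda>x. 1"])
      (auto intro: mpol_const mideal_0[OF I])
qed

text \<open>The case where the last coordinate is algebraic over the others modulo \<open>P\<close>,
  with minimal polynomial \<open>F\<close>. Over the fraction field \<open>c\<close> is then
  invertible modulo \<open>P\<close>, so the ideal generated by \<open>P\<close> and
  \<open>c\<close> contains some \<open>g\<close> outside \<open>P\<close> that does not involve the
  last variable; \<open>c'\<close> is \<open>g\<close> times the leading coefficient of
  \<open>F\<close>.\<close>

lemma elim_algebraic:
  assumes P: "mprime (Suc n) P"
    and F: "F \<in> pfam n (Suc d)" "pev n F \<in> P" "(\<lambda>x. coeff (F x) d) \<notin> P"
    and min: "\<And>G k. G \<in> pfam n d \<Longrightarrow> pev n G \<in> P \<Longrightarrow> (\<lambda>x. coeff (G x) k) \<in> P"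
    and c: "c \<in> mpol (Suc n)" "c \<notin> P"
  obtains c' where "c' \<in> mpol n" "c' \<notin> P"
    "\<And>a t. a \<in> mzeros (P \<inter> mpol n) \<Longrightarrow> c' a \<noteq> 0 \<Longrightarrow> poly (F a) t = 0 \<Longrightarrow>
       a(n := t) \<in> mzeros P \<and> c (a(n := t)) \<noteq> 0"
proof -
  note I = mprime_ideal[OF P]
  let ?b = "\<lambda>x. coeff (F x) d"
  have b: "?b \<in> mpol n" by (rule pfam_coeff[OF F(1)])
  have mono: "f \<in> mpol n \<Longrightarrow> f \<in> mpol (Suc n)" for f by (erule mpol_mono) simp
  define Q where "Q = {\<lambda>x. \<pi> x + c x * s x | \<pi> s. \<pi> \<in> P \<and> s \<in> mpol (Suc n)}"
  have Q: "mideal (Suc n) Q" and PQ: "P \<subseteq> Q" and cQ: "c \<in> Q"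
    unfolding Q_def using mideal_extend[OF I c(1)] by this+
  obtain e G where G: "G \<in> pfam n (Suc e)" "pev n G \<in> Q" "(\<lambda>x. coeff (G x) e) \<notin> P" "e < Suc d"
    and minG: "\<And>H k. H \<in> pfam n e \<Longrightarrow> pev n H \<in> Q \<Longrightarrow> (\<lambda>x. coeff (H x) k) \<in> P"
    using pfam_minimal[OF I Q PQ F(1) subsetD[OF PQ F(2)] F(3)] by metis
  let ?g = "\<lambda>x. coeff (G x) e"
  have g: "?g \<in> mpol n" by (rule pfam_coeff[OF G(1)])
  have rem: "\<exists>k A R. A \<in> pfam n (D - e) \<and> R \<in> pfam n e \<and> (\<forall>k. (\<lambda>x. coeff (R x) k) \<in> P) \<and>
      (\<forall>x. smult (?g x ^ k) (H x) = A x * G x + R x)"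
    if H: "H \<in> pfam n D" "pev n H \<in> Q" for H D
  proof -
    obtain k A R where AR: "A \<in> pfam n (D - e)" "R \<in> pfam n e"
      "\<And>x. smult (?g x ^ k) (H x) = A x * G x + R x" using pseudo_division[OF G(1) H(1)] by blast
    have "(\<lambda>x. ?g x ^ k * pev n H x - pev n A x * pev n G x) \<in> Q"
      by (intro mideal_diff[OF Q] mideal_mult[OF Q] H(2) G(2) pev_mpol[OF AR(1)] mono mpol_power g)
    also have "(\<lambda>x. ?g x ^ k * pev n H x - pev n A x * pev n G x) = pev n R"
      by (rule pev_remainder[OF AR(3)])
    finally have "pev n R \<in> Q" .
    then show ?thesis using AR minG[OF AR(2)] by blast
  qed
  \<comment> \<open>\<open>G\<close> is a common divisor of \<open>F\<close> and \<open>c\<close>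
    modulo \<open>P\<close>. Suppose its degree is positive. If \<open>pev n G \<in> P\<close>, a
    power of \<open>g\<close> times \<open>c\<close> lies in \<open>P\<close>. Otherwise the
    cofactor \<open>A\<close> of \<open>F\<close> gives an element of \<open>P\<close> of degree
    below \<open>d\<close>; by minimality its coefficients lie in \<open>P\<close>, and comparing
    coefficients of degree \<open>d\<close> puts the leading coefficient of \<open>F\<close> into
    \<open>P\<close>.\<close>
  have "e = 0"
  proof (rule ccontr)
    assume "e \<noteq> 0"
    obtain k A R where AR: "A \<in> pfam n (Suc d - e)" "R \<in> pfam n e" "\<And>k. (\<lambda>x. coeff (R x) k) \<in> P"
      "\<And>x. smult (?g x ^ k) (F x) = A x * G x + R x" using rem[OF F(1) subsetD[OF PQ F(2)]] by blast
    obtain D C where C: "C \<in> pfam n D" "c = pev n C" using mpol_Suc_pfam[OF c(1)] by blast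
    have "pev n C \<in> Q" using C cQ by simp
    from rem[OF C(1) this] obtain k' A' R' where AR': "A' \<in> pfam n (D - e)" "R' \<in> pfam n e" 
      "\<And>k. (\<lambda>x. coeff (R' x) k) \<in> P" "\<And>x. smult (?g x ^ k') (C x) = A' x * G x + R' x" by blast
    have "pev n G \<notin> P"
    proof
      assume GP: "pev n G \<in> P"
      have "(\<lambda>x. pev n A' x * pev n G x + pev n R' x) \<in> P"
        by (intro mideal_add[OF I] mideal_mult[OF I] pev_ideal[OF I AR'(2,3)] GP pev_mpol[OF AR'(1)])
      also have "(\<lambda>x. pev n A' x * pev n G x + pev n R' x) = (\<lambda>x. ?g x ^ k' * c x)"
        by (simp add: pev_remainder[OF AR'(4), symmetric] C(2))
      finally show False
        using mprime_mult[OF P mono[OF mpol_power[OF g]] c(1)] c(2) mprime_power[OF P mono[OF g] G(3)] by blast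
    qed
    have "(\<lambda>x. ?g x ^ k * pev n F x - pev n R x) \<in> P"
      by (intro mideal_diff[OF I] mideal_mult[OF I] F(2) pev_ideal[OF I AR(2,3)] mono mpol_power g)
    also have "(\<lambda>x. ?g x ^ k * pev n F x - pev n R x) = (\<lambda>x. pev n A x * pev n G x)"
      by (simp add: pev_remainder[OF AR(4), symmetric])
    finally have AP: "pev n A \<in> P"
      using mprime_mult[OF P pev_mpol[OF AR(1)] pev_mpol[OF G(1)]] \<open>pev n G \<notin> P\<close> by blast
    have "A \<in> pfam n d" by (rule pfam_mono[OF AR(1)]) (use \<open>e \<noteq> 0\<close> in simp)
    then have Ac: "(\<lambda>x. coeff (A x) k) \<in> P" for k using min AP by blast
    have "(\<lambda>x. (\<Sum>i\<le>d. coeff (A x) i * coeff (G x) (d - i)) + coeff (R x) d) \<in> P"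
      by (intro mideal_add[OF I] mideal_sum[OF I] mideal_mult'[OF I] Ac AR(3) mono pfam_coeff[OF G(1)])
    also have "(\<lambda>x. (\<Sum>i\<le>d. coeff (A x) i * coeff (G x) (d - i)) + coeff (R x) d) = (\<lambda>x. ?g x ^ k * ?b x)"
    proof
      fix x
      have "coeff (smult (?g x ^ k) (F x)) d = coeff (A x * G x + R x) d" by (simp add: AR(4))
      then show "(\<Sum>i\<le>d. coeff (A x) i * coeff (G x) (d - i)) + coeff (R x) d = ?g x ^ k * ?b x"
        by (simp add: coeff_mult)
    qed
    finally show False
      using mprime_mult[OF P mono[OF mpol_power[OF g]] mono[OF b]] F(3) mprime_power[OF P mono[OF g] G(3)] by blast
  qed
  have G_eq: "pev n G = ?g" by (intro ext) (simp add: pfam_pev_sum[OF G(1)] \<open>e = 0\<close>)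
  obtain \<pi> s where \<pi>: "\<pi> \<in> P" "s \<in> mpol (Suc n)" "pev n G = (\<lambda>x. \<pi> x + c x * s x)"
    using G(2) unfolding Q_def by blast
  have geq: "?g x = \<pi> x + c x * s x" for x
    using fun_cong[OF \<pi>(3), of x] fun_cong[OF G_eq, of x] by simp
  let ?c' = "\<lambda>x. ?g x * ?b x"
  show ?thesis
  proof (rule that[of ?c'])
    show "?c' \<in> mpol n" using b g by (rule mpol_mult[rotated])
    show "?c' \<notin> P" using mprime_mult[OF P mono[OF g] mono[OF b]] F(3) G(3) by blast
    fix a t assume a: "a \<in> mzeros (P \<inter> mpol n)" "?c' a \<noteq> 0" "poly (F a) t = 0"
    let ?a = "a(n := t)"
    \<comment> \<open>Up to a power of \<open>b\<close>, \<open>f\<close> is a multiple of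
      \<open>F\<close> plus a remainder whose coefficients lie in \<open>P\<close> by minimality.
      The remainder vanishes over \<open>a\<close>, and \<open>F a\<close> vanishes at
      \<open>t\<close>.\<close>
    have "f ?a = 0" if f: "f \<in> P" for f
    proof -
      obtain D H where H: "H \<in> pfam n D" "f = pev n H" using mpol_Suc_pfam[OF mideal_sub[OF I f]] by blast
      obtain k A R where AR: "A \<in> pfam n (D - d)" "R \<in> pfam n d"
        "\<And>x. smult (?b x ^ k) (H x) = A x * F x + R x" using pseudo_division[OF F(1) H(1)] by blast
      have "(\<lambda>x. ?b x ^ k * pev n H x - pev n A x * pev n F x) \<in> P"
        by (intro mideal_diff[OF I] mideal_mult[OF I] F(2) pev_mpol[OF AR(1)] mono mpol_power b)
          (use H f in simp)
      also have "(\<lambda>x. ?b x ^ k * pev n H x - pev n A x * pev n F x) = pev n R"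
        by (rule pev_remainder[OF AR(3)])
      finally have "(\<lambda>x. coeff (R x) j) \<in> P \<inter> mpol n" for j
        using min[OF AR(2)] pfam_coeff[OF AR(2)] by (intro IntI)
      then have "coeff (R a) j = 0" for j by (rule mzerosD[OF a(1)])
      then have "R a = 0" by (simp add: poly_eq_iff)
      then have "poly (smult (?b a ^ k) (H a)) t = 0" using AR(3)[of a] a(3) by simp
      then show ?thesis using a(2) H by (simp add: pev_def)
    qed
    then have "?a \<in> mzeros P" by (simp add: mzeros_def)
    moreover have "\<pi> ?a = 0" using \<pi>(1) calculation by (simp add: mzeros_def)
    then have "?g ?a = c ?a * s ?a" using geq[of ?a] by simp
    then have "c ?a \<noteq> 0" using a(2) pfam_upd[OF G(1)] by auto
    ultimately show "?a \<in> mzeros P \<and> c ?a \<noteq> 0" by simp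
  qed
qed

text \<open>Either some member of \<open>P\<close> has a coefficient outside \<open>P\<close>, and
  the last coordinate is algebraic over the others; or all coefficients of members of
  \<open>P\<close> lie in \<open>P\<close>, and the whole line over a zero of
  \<open>P \<inter> mpol n\<close> consists of zeros of \<open>P\<close>.\<close>

lemma elim_step:
  assumes P: "mprime (Suc n) P" and c: "c \<in> mpol (Suc n)" "c \<notin> P"
  obtains c' where "c' \<in> mpol n" "c' \<notin> P"
    "\<And>a. a \<in> mzeros (P \<inter> mpol n) \<Longrightarrow> c' a \<noteq> 0 \<Longrightarrow> \<exists>t. a(n := t) \<in> mzeros P \<and> c (a(n := t)) \<noteq> 0"
proof (cases "\<exists>D G k. G \<in> pfam n D \<and> pev n G \<in> P \<and> (\<lambda>x. coeff (G x) k) \<notin> P")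
  case True
  note I = mprime_ideal[OF P]
  obtain d F where F: "F \<in> pfam n (Suc d)" "pev n F \<in> P" "(\<lambda>x. coeff (F x) d) \<notin> P"
    and min: "\<And>H k. H \<in> pfam n d \<Longrightarrow> pev n H \<in> P \<Longrightarrow> (\<lambda>x. coeff (H x) k) \<in> P"
    using True pfam_minimal[OF I I subset_refl] by metis
  obtain c' where c': "c' \<in> mpol n" "c' \<notin> P"
    "\<And>a t. a \<in> mzeros (P \<inter> mpol n) \<Longrightarrow> c' a \<noteq> 0 \<Longrightarrow> poly (F a) t = 0 \<Longrightarrow>
       a(n := t) \<in> mzeros P \<and> c (a(n := t)) \<noteq> 0"
    using elim_algebraic[OF P F min c] by metis
  let ?b = "\<lambda>x. coeff (F x) d"
  have b: "?b \<in> mpol n" by (rule pfam_coeff[OF F(1)])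
  have "d \<noteq> 0"
  proof
    assume "d = 0"
    then have "pev n F = ?b" by (intro ext) (simp add: pfam_pev_sum[OF F(1)])
    then show False using F by simp
  qed
  show ?thesis
  \<comment> \<open>The extra factor \<open>b\<close> keeps the degree of \<open>F a\<close>
    positive, so that a root exists.\<close>
  proof (rule that[of "\<lambda>x. ?b x * c' x"])
    show "(\<lambda>x. ?b x * c' x) \<in> mpol n" by (rule mpol_mult[OF b c'(1)])
    show "(\<lambda>x. ?b x * c' x) \<notin> P"
      using mprime_mult[OF P mpol_mono[OF b] mpol_mono[OF c'(1)]] F(3) c'(2) by auto
    fix a assume a: "a \<in> mzeros (P \<inter> mpol n)" "?b a * c' a \<noteq> 0"
    then have "d \<le> degree (F a)" by (intro le_degree) simp
    then have "\<not> constant (poly (F a))" using \<open>d \<noteq> 0\<close> by (simp add: constant_degree)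
    then obtain t where "poly (F a) t = 0" using fundamental_theorem_of_algebra by blast
    then show "\<exists>t. a(n := t) \<in> mzeros P \<and> c (a(n := t)) \<noteq> 0" using c'(3) a by auto
  qed
next
  case False
  note I = mprime_ideal[OF P]
  obtain D C where C: "C \<in> pfam n D" "c = pev n C" using mpol_Suc_pfam[OF c(1)] by blast
  obtain k where k: "(\<lambda>x. coeff (C x) k) \<notin> P"
    using pev_ideal[OF I C(1)] c(2) unfolding C(2) by (metis (no_types, lifting))
  show ?thesis
  proof (rule that[OF pfam_coeff[OF C(1)] k])
    fix a assume a: "a \<in> mzeros (P \<inter> mpol n)" "coeff (C a) k \<noteq> 0"
    then have "C a \<noteq> 0" by auto
    then obtain t where t: "poly (C a) t \<noteq> 0" using poly_all_0_iff_0 by blast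
    have "f (a(n := t)) = 0" if f: "f \<in> P" for f
    proof -
      obtain D H where H: "H \<in> pfam n D" "f = pev n H" using mpol_Suc_pfam[OF mideal_sub[OF I f]] by blast
      then have "(\<lambda>x. coeff (H x) j) \<in> P \<inter> mpol n" for j using False f pfam_coeff[OF H(1)] by blast
      then have "coeff (H a) j = 0" for j by (rule mzerosD[OF a(1)])
      then have "H a = 0" by (simp add: poly_eq_iff)
      then show ?thesis using H by (simp add: pev_def)
    qed
    then show "\<exists>t. a(n := t) \<in> mzeros P \<and> c (a(n := t)) \<noteq> 0"
      using t C by (auto simp: mzeros_def pev_def intro!: exI[of _ t])
  qed
qed

text \<open>Variables are removed from the top; the condition found for \<open>n\<close> variables
  becomes the \<open>c\<close> of the next removal.\<close>

lemma elim_iterated: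
  assumes "mprime N P" "c \<in> mpol N" "c \<notin> P" "M \<le> N"
  shows "\<exists>c'\<in>mpol M. c' \<notin> P \<and> (\<forall>a\<in>mzeros (P \<inter> mpol M). c' a \<noteq> 0 \<longrightarrow>
     (\<exists>w\<in>mzeros P. c w \<noteq> 0 \<and> (\<forall>i<M. w i = a i)))"
  using \<open>M \<le> N\<close> assms(1-3)
proof (induction N arbitrary: P c rule: dec_induct)
  case base
  then have "P \<inter> mpol M = P" using mideal_sub[OF mprime_ideal] by blast
  then show ?case using base by auto
next
  case (step n)
  obtain c1 where c1: "c1 \<in> mpol n" "c1 \<notin> P"
    "\<And>a. a \<in> mzeros (P \<inter> mpol n) \<Longrightarrow> c1 a \<noteq> 0 \<Longrightarrow> \<exists>t. a(n := t) \<in> mzeros P \<and> c (a(n := t)) \<noteq> 0"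
    using elim_step[OF step.prems] by metis
  have P1: "mprime n (P \<inter> mpol n)" by (rule mprime_restrict[OF step.prems(1)]) simp
  have "P \<inter> mpol n \<inter> mpol M = P \<inter> mpol M" using mpol_mono'[OF step.hyps(1)] by blast
  with step.IH[OF P1 c1(1)] c1(2) obtain c' where c': "c' \<in> mpol M" "c' \<notin> P \<inter> mpol n"
    "\<forall>a\<in>mzeros (P \<inter> mpol M). c' a \<noteq> 0 \<longrightarrow>
     (\<exists>w\<in>mzeros (P \<inter> mpol n). c1 w \<noteq> 0 \<and> (\<forall>i<M. w i = a i))" by auto
  have "c' \<notin> P" using c' mpol_mono'[OF step.hyps(1)] by blast
  moreover have "\<exists>w\<in>mzeros P. c w \<noteq> 0 \<and> (\<forall>i<M. w i = a i)"
    if "a \<in> mzeros (P \<inter> mpol M)" "c' a \<noteq> 0" for a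
  proof -
    obtain w where w: "w\<in>mzeros (P \<inter> mpol n)" "c1 w \<noteq> 0" "\<forall>i<M. w i = a i"
      using c'(3) \<open>a \<in> mzeros (P \<inter> mpol M)\<close> \<open>c' a \<noteq> 0\<close> by blast
    then obtain t where "w(n := t) \<in> mzeros P \<and> c (w(n := t)) \<noteq> 0" using c1(3) by blast
    then show ?thesis using w(3) step.hyps(1) by (intro bexI[of _ "w(n := t)"]) auto
  qed
  ultimately show ?case using c'(1) by blast
qed


section \<open>Top degree forms and divisibility\<close>

text \<open>As \<open>\<mu>\<close> tends to 0,
  \<open>\<mu> ^ degree q * poly q (inverse \<mu>)\<close> tends to the leading coefficient. A
  finite limit with an exponent \<open>D\<close> below the degree would force that coefficient to be
  0.\<close>

lemma poly_leading_limit: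
  fixes q :: "complex poly"
  assumes "((\<lambda>\<mu>. \<mu> ^ D * poly q (inverse \<mu>)) \<longlongrightarrow> L) (at 0)"
  shows "coeff q D = L" and "\<And>k. D < k \<Longrightarrow> coeff q k = 0"
proof -
  let ?m = "degree q"
  have refl: "((\<lambda>\<mu>. poly (reflect_poly q) \<mu>) \<longlongrightarrow> poly (reflect_poly q) 0) (at 0)"
    by (intro tendsto_intros)
  have 0: "poly (reflect_poly q) 0 = lead_coeff q" by (simp add: reflect_poly_at_0_eq_0_iff poly_0_coeff_0)
  have eq: "poly (reflect_poly q) \<mu> = \<mu> ^ ?m * poly q (inverse \<mu>)" if "\<mu> \<noteq> 0" for \<mu>
    using poly_reflect_poly_nz[OF that, of q] .
  have mD: "?m \<le> D"
  proof (rule ccontr)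
    assume "\<not> ?m \<le> D"
    then have lt: "D < ?m" by simp
    have "((\<lambda>\<mu>. \<mu> ^ (?m - D) * (\<mu> ^ D * poly q (inverse \<mu>))) \<longlongrightarrow> 0 ^ (?m - D) * L) (at 0)"
      by (intro tendsto_intros assms)
    moreover have "\<forall>\<^sub>F \<mu> in at 0. \<mu> ^ (?m - D) * (\<mu> ^ D * poly q (inverse \<mu>)) = poly (reflect_poly q) \<mu>"
      unfolding eventually_at_filter using lt
      by (intro always_eventually) (auto simp: eq mult.assoc[symmetric] power_add[symmetric])
    ultimately have "((\<lambda>\<mu>. poly (reflect_poly q) \<mu>) \<longlongrightarrow> 0 ^ (?m - D) * L) (at 0)"
      by (rule Lim_transform_eventually)
    then have "lead_coeff q = 0 ^ (?m - D) * L"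
      using tendsto_unique[OF at_neq_bot refl] 0 by auto
    then show False using lt by (auto simp: power_0_left)
  qed
  have "((\<lambda>\<mu>. \<mu> ^ (D - ?m) * poly (reflect_poly q) \<mu>) \<longlongrightarrow> 0 ^ (D - ?m) * lead_coeff q) (at 0)"
    using refl unfolding 0 by (intro tendsto_intros)
  moreover have "\<forall>\<^sub>F \<mu> in at 0. \<mu> ^ (D - ?m) * poly (reflect_poly q) \<mu> = \<mu> ^ D * poly q (inverse \<mu>)"
    unfolding eventually_at_filter using mD
    by (intro always_eventually) (auto simp: eq mult.assoc[symmetric] power_add[symmetric])
  ultimately have "((\<lambda>\<mu>. \<mu> ^ D * poly q (inverse \<mu>)) \<longlongrightarrow> 0 ^ (D - ?m) * lead_coeff q) (at 0)"
    by (rule Lim_transform_eventually)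
  then have "L = 0 ^ (D - ?m) * lead_coeff q"
    using tendsto_unique[OF at_neq_bot assms] by auto
  then show "coeff q D = L" using mD by (cases "?m = D") (auto simp: coeff_eq_0)
  show "coeff q k = 0" if "D < k" for k using mD that by (intro coeff_eq_0) simp
qed

lemma mpol_shift_family:
  assumes "f \<in> mpol n"
  shows "\<exists>D p. p \<in> pfam n D \<and> (\<forall>x t. f (\<lambda>i. x i + t * v i) = poly (p x) t)"
proof (rule mpol_subst_family[OF assms])
  fix i assume "i < n"
  then have "(\<lambda>x. monom (x i) 0 + monom (v i) 1) \<in> pfam n 2"
    by (intro pfam_add pfam_monom) (auto intro: mpol.intros mpol_var)
  then show "\<exists>D p. p \<in> pfam n D \<and> (\<forall>x t. x i + t * v i = poly (p x) t)"
    by (intro exI conjI, assumption) (simp add: poly_monom mult.commute)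
qed

lemma mpol_scale_family:
  assumes "f \<in> mpol n"
  shows "\<exists>D p. p \<in> pfam n D \<and> (\<forall>x t. f (\<lambda>i. t * x i) = poly (p x) t)"
proof (rule mpol_subst_family[OF assms])
  fix i assume "i < n"
  then have "(\<lambda>x. monom (x i) 1) \<in> pfam n 2"
    by (intro pfam_monom) (auto intro: mpol.intros mpol_var)
  then show "\<exists>D p. p \<in> pfam n D \<and> (\<forall>x t. t * x i = poly (p x) t)"
    by (intro exI conjI, assumption) (simp add: poly_monom mult.commute)
qed

text \<open>\<open>T\<close> is the homogeneous part of \<open>f\<close> of top degree \<open>D\<close>.\<close>

definition top_form ::
    "nat \<Rightarrow> pfun \<Rightarrow> nat \<Rightarrow> pfun \<Rightarrow> bool" where
  "top_form n f D T \<longleftrightarrow> T \<in> mpol n \<and> (\<forall>v. \<exists>p\<in>pfam n (Suc D). (\<forall>x. coeff (p x) D = T v) \<and>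
     (\<forall>x t. f (\<lambda>i. x i + t * v i) = poly (p x) t))"

lemma top_formD:
  assumes "top_form n f D T"
  shows "T \<in> mpol n" "\<exists>p\<in>pfam n (Suc D). (\<forall>x. coeff (p x) D = T v) \<and>
     (\<forall>x t. f (\<lambda>i. x i + t * v i) = poly (p x) t)"
  using assms unfolding top_form_def by auto

text \<open>\<open>D\<close> is the largest degree in \<open>t\<close> of \<open>f (t * x)\<close>,
  and \<open>T x\<close> is the coefficient of \<open>t ^ D\<close>. The same \<open>T\<close> leads
  along shifted lines because \<open>f (x + v / \<mu>) = f ((\<mu> * x + v) / \<mu>)\<close>, and
  this times \<open>\<mu> ^ D\<close> tends to \<open>T v\<close> as \<open>\<mu>\<close> tends to
  0.\<close>

lemma mpol_top_form:
  assumes f: "f \<in> mpol n" "f a \<noteq> 0"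
  obtains D T b where "top_form n f D T" "T b \<noteq> 0"
proof -
  define A where "A E \<longleftrightarrow> (\<exists>p\<in>pfam n E. \<forall>x t. f (\<lambda>i. t * x i) = poly (p x) t)" for E
  have "\<exists>E. A E" using mpol_scale_family[OF f(1)] unfolding A_def by auto
  define E where "E = (LEAST E. A E)"
  have "A E" unfolding E_def using \<open>\<exists>E. A E\<close> by (metis LeastI)
  then obtain p where p: "p \<in> pfam n E" "\<And>x t. f (\<lambda>i. t * x i) = poly (p x) t" unfolding A_def by auto
  have "E \<noteq> 0"
  proof
    assume "E = 0"
    then have "p a = 0" using pfam_high[OF p(1)] by (simp add: poly_eq_iff)
    then show False using p(2)[of 1 a] f(2) by simp
  qed
  then obtain D where D: "E = Suc D" using not0_implies_Suc by blast
  let ?T = "\<lambda>x. coeff (p x) D"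
  have T: "?T \<in> mpol n" by (rule pfam_coeff[OF p(1)])
  have "\<exists>b. ?T b \<noteq> 0"
  proof (rule ccontr)
    assume "\<nexists>b. ?T b \<noteq> 0"
    then have "coeff (p x) k = 0" if "D \<le> k" for x k
      using that pfam_high[OF p(1)] D by (cases "k = D") auto
    then have "p \<in> pfam n D" using p(1) unfolding pfam_def by simp
    then have "A D" unfolding A_def using p(2) by blast
    then show False using D unfolding E_def using not_less_Least[of D A] by simp
  qed
  then obtain b where b: "?T b \<noteq> 0" by blast
  have "\<exists>p\<in>pfam n (Suc D). (\<forall>x. coeff (p x) D = ?T v) \<and> (\<forall>x t. f (\<lambda>i. x i + t * v i) = poly (p x) t)" for v
  proof -
    obtain M q where q: "q \<in> pfam n M" "\<And>x t. f (\<lambda>i. x i + t * v i) = poly (q x) t"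
      using mpol_shift_family[OF f(1), of v] by blast
    have lim: "((\<lambda>\<mu>. \<mu> ^ D * poly (q x) (inverse \<mu>)) \<longlongrightarrow> ?T v) (at 0)" for x
    proof -
      let ?y = "\<lambda>\<mu> i. \<mu> * x i + v i"
      have "((\<lambda>\<mu>. \<Sum>k\<le>D. coeff (p (?y \<mu>)) k * \<mu> ^ (D - k)) \<longlongrightarrow>
          (\<Sum>k\<le>D. coeff (p v) k * 0 ^ (D - k))) (at 0)"
      proof (intro tendsto_intros mpol_tendsto[OF pfam_coeff[OF p(1)]])
        fix i have "((\<lambda>\<mu>. \<mu> * x i + v i) \<longlongrightarrow> 0 * x i + v i) (at 0)" by (intro tendsto_intros)
        then show "((\<lambda>\<mu>. \<mu> * x i + v i) \<longlongrightarrow> v i) (at 0)" by simp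
      qed
      also have "(\<Sum>k\<le>D. coeff (p v) k * 0 ^ (D - k)) = (\<Sum>k\<in>{D}. coeff (p v) k * 0 ^ (D - k))"
        by (rule sum.mono_neutral_right) (auto simp: power_0_left)
      finally have "((\<lambda>\<mu>. \<Sum>k\<le>D. coeff (p (?y \<mu>)) k * \<mu> ^ (D - k)) \<longlongrightarrow> ?T v) (at 0)" by simp
      moreover have "(\<Sum>k\<le>D. coeff (p (?y \<mu>)) k * \<mu> ^ (D - k)) = \<mu> ^ D * poly (q x) (inverse \<mu>)"
        if "\<mu> \<noteq> 0" for \<mu>
      proof -
        have "poly (q x) (inverse \<mu>) = f (\<lambda>i. x i + inverse \<mu> * v i)" by (simp add: q)
        also have "(\<lambda>i. x i + inverse \<mu> * v i) = (\<lambda>i. inverse \<mu> * ?y \<mu> i)"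
          using that by (auto simp: field_simps)
        also have "f (\<lambda>i. inverse \<mu> * ?y \<mu> i) = poly (p (?y \<mu>)) (inverse \<mu>)" by (rule p(2))
        also have "\<dots> = (\<Sum>k\<le>degree (p (?y \<mu>)). coeff (p (?y \<mu>)) k * inverse \<mu> ^ k)"
          by (rule poly_altdef)
        also have "\<dots> = (\<Sum>k\<le>D. coeff (p (?y \<mu>)) k * inverse \<mu> ^ k)"
          using pfam_high[OF p(1), unfolded D] 
          by (intro sum.mono_neutral_left) (auto simp: coeff_eq_0 not_less_eq_eq[symmetric] degree_le Suc_le_eq
              intro!: degree_le)
        finally show ?thesis
          using that by (auto simp: sum_distrib_left power_diff field_simps intro!: sum.cong)
      qed
      then have "\<forall>\<^sub>F \<mu> in at 0. (\<Sum>k\<le>D. coeff (p (?y \<mu>)) k * \<mu> ^ (D - k)) = \<mu> ^ D * poly (q x) (inverse \<mu>)"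
        unfolding eventually_at_filter by (intro always_eventually) blast
      ultimately show ?thesis by (rule Lim_transform_eventually)
    qed
    have "q \<in> pfam n (Suc D)"
      using q(1) poly_leading_limit(2)[OF lim] unfolding pfam_def by (simp add: Suc_le_eq)
    then show ?thesis using q(2) poly_leading_limit(1)[OF lim] by blast
  qed
  then have "top_form n f D ?T" unfolding top_form_def using T by blast
  then show ?thesis using that[of D ?T b] b by blast
qed

section \<open>Roots, bounds and divisibility of univariate polynomials\<close>

lemma poly_root_factor:
  fixes p :: "complex poly"
  assumes "degree p = Suc d"
  obtains a q where "p = [:- a, 1:] * q" "degree q = d" "lead_coeff q = lead_coeff p" "q \<noteq> 0"
proof -
  have "\<not> constant (poly p)" using assms by (simp add: constant_degree)
  then obtain a where "poly p a = 0" using fundamental_theorem_of_algebra by blast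
  then obtain q where q: "p = [:- a, 1:] * q" using poly_eq_0_iff_dvd by blast
  moreover have "q \<noteq> 0" using q assms by auto
  moreover have "degree q = d" using assms \<open>q \<noteq> 0\<close> unfolding q by (subst (asm) degree_mult_eq) auto
  moreover have "lead_coeff q = lead_coeff p" unfolding q lead_coeff_mult by simp
  ultimately show ?thesis using that by blast
qed

lemma poly_linear_mult: "poly ([:- a, 1:] * q) z = (z - a) * poly q (z :: complex)"
  by (simp add: algebra_simps)

lemma poly_bound_limit:
  fixes q r :: "complex poly"
  assumes "\<forall>\<^sub>F z in at a. cmod (poly r z) \<le> B z * cmod (poly q z)" "isCont B a"
  shows "cmod (poly r a) \<le> B a * cmod (poly q a)"
proof (rule tendsto_le[OF at_neq_bot _ _ assms(1)])
  show "((\<lambda>z. B z * cmod (poly q z)) \<longlongrightarrow> B a * cmod (poly q a)) (at a)"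
    using assms(2) unfolding isCont_def by (intro tendsto_intros)
  show "((\<lambda>z. cmod (poly r z)) \<longlongrightarrow> cmod (poly r a)) (at a)"
    by (intro tendsto_intros)
qed

text \<open>The bound extends to the zeros of \<open>q\<close> by continuity, so a root
  \<open>a\<close> of \<open>q\<close> is a root of \<open>r\<close>. Cancelling
  \<open>z - a\<close> keeps the bound away from \<open>a\<close>, and at \<open>a\<close> by a
  limit; in this way the degree of \<open>q\<close> is lowered to 0.\<close>

lemma poly_dvd_of_bound:
  fixes q r :: "complex poly"
  assumes "q \<noteq> 0" "\<And>z. isCont B z" "\<And>z. poly q z \<noteq> 0 \<Longrightarrow> cmod (poly r z) \<le> B z * cmod (poly q z)"
  shows "q dvd r"
proof -
  have "cmod (poly r a) \<le> B a * cmod (poly q a)" for a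
  proof (rule poly_bound_limit[OF _ assms(2)])
    show "\<forall>\<^sub>F z in at a. cmod (poly r z) \<le> B z * cmod (poly q z)"
      using poly_eventually_nonzero[OF assms(1)] by eventually_elim (rule assms(3))
  qed
  then show ?thesis using \<open>q \<noteq> 0\<close>
  proof (induction "degree q" arbitrary: q r)
    case 0
    then obtain k where "q = [:k:]" "k \<noteq> 0" by (metis degree_eq_zeroE pCons_0_0)
    then show ?case by (simp add: const_poly_dvd_iff dvd_field_iff)
  next
    case (Suc d)
    obtain a q1 where q1: "q = [:- a, 1:] * q1" "degree q1 = d" "q1 \<noteq> 0"
      using poly_root_factor[OF Suc.hyps(2)[symmetric]] by metis
    have "poly r a = 0" using Suc.prems(1)[of a] unfolding q1(1) by simp
    obtain r1 where r1: "r = [:- a, 1:] * r1" using \<open>poly r a = 0\<close> poly_eq_0_iff_dvd by blast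
    have ne: "cmod (poly r1 z) \<le> B z * cmod (poly q1 z)" if "z \<noteq> a" for z
    proof -
      have "cmod (z - a) * cmod (poly r1 z) \<le> cmod (z - a) * (B z * cmod (poly q1 z))"
        using Suc.prems(1)[of z] unfolding q1(1) r1 poly_linear_mult norm_mult by (simp add: mult.left_commute)
      then show ?thesis using that by simp
    qed
    have "cmod (poly r1 z) \<le> B z * cmod (poly q1 z)" for z
    proof (cases "z = a")
      case True
      show ?thesis unfolding True
        by (rule poly_bound_limit[OF _ assms(2)])
          (auto simp: eventually_at_filter ne intro!: always_eventually)
    qed (rule ne)
    then have "q1 dvd r1" using Suc.hyps(1) q1(2,3) by blast
    then show ?case unfolding q1(1) r1 by (rule mult_dvd_mono[OF dvd_refl])
  qed
qed

text \<open>A locally bounded quotient of polynomials is a polynomial; this plays the role of integral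
  closedness of the polynomial ring. Division by \<open>b\<close> is possible because \<open>b\<close> is monic, up to a
  constant, in a suitable direction.\<close>

lemma mpol_dvd_of_bound:
  assumes b: "b \<in> mpol n" "b a \<noteq> 0" and r: "r \<in> mpol n"
    and cont: "\<And>x v t. isCont (\<lambda>t. B (\<lambda>i. x i + t * v i)) t"
    and bound: "\<And>x. b x \<noteq> 0 \<Longrightarrow> cmod (r x) \<le> B x * cmod (b x)"
  obtains s where "s \<in> mpol n" "\<And>x. r x = b x * s x"
proof -
  obtain D T v where T: "top_form n b D T" "T v \<noteq> 0"
    using mpol_top_form[OF b] .
  obtain p where p: "p \<in> pfam n (Suc D)" "\<And>x. coeff (p x) D = T v"
      "\<And>x t. b (\<lambda>i. x i + t * v i) = poly (p x) t"
    using top_formD(2)[OF T(1), of v] by blast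
  obtain M q where q: "q \<in> pfam n M" "\<And>x t. r (\<lambda>i. x i + t * v i) = poly (q x) t"
    using mpol_shift_family[OF r, of v] by blast
  obtain k Q R where QR: "Q \<in> pfam n (M - D)" "R \<in> pfam n D"
    "\<And>x. smult (coeff (p x) D ^ k) (q x) = Q x * p x + R x" using pseudo_division[OF p(1) q(1)] by blast
  \<comment> \<open>On the line through \<open>x\<close> in direction \<open>v\<close> the quotient
    is locally bounded, so \<open>p x\<close> divides \<open>q x\<close> and therefore the
    remainder, whose degree is too small unless it is zero.\<close>
  have R0: "R x = 0" for x
  proof (rule ccontr)
    assume "R x \<noteq> 0"
    have "p x \<noteq> 0" using p(2)[of x] T(2) by auto
    have "p x dvd q x"
    proof (rule poly_dvd_of_bound[OF \<open>p x \<noteq> 0\<close>])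
      show "isCont (\<lambda>t. B (\<lambda>i. x i + t * v i)) z" for z by (rule cont)
      show "cmod (poly (q x) z) \<le> B (\<lambda>i. x i + z * v i) * cmod (poly (p x) z)"
        if "poly (p x) z \<noteq> 0" for z
        using bound[of "\<lambda>i. x i + z * v i"] that p(3)[of x z] q(2)[of x z] by simp
    qed
    then have "p x dvd smult (coeff (p x) D ^ k) (q x)" by (rule dvd_smult)
    then have "p x dvd R x" unfolding QR(3) by (simp add: dvd_add_right_iff)
    then have "degree (p x) \<le> degree (R x)" using \<open>R x \<noteq> 0\<close> by (rule dvd_imp_degree_le)
    moreover have "D \<le> degree (p x)" by (rule le_degree) (simp add: p T)
    ultimately have "coeff (R x) (degree (R x)) = 0" using pfam_high[OF QR(2)] by simp
    then show False using \<open>R x \<noteq> 0\<close> by simp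
  qed
  \<comment> \<open>Parameter 0 on the line through \<open>x\<close> is \<open>x\<close> itself, so
    the constant coefficient of \<open>Q x\<close>, divided by \<open>T v ^ k\<close>, is the value
    of the quotient at \<open>x\<close>.\<close>
  have "r x = b x * (inverse (T v ^ k) * coeff (Q x) 0)" for x
  proof -
    have "poly (smult (T v ^ k) (q x)) 0 = poly (Q x * p x) 0" using QR(3)[of x] p(2) R0 by simp
    then have "T v ^ k * r x = coeff (Q x) 0 * b x"
      using p(3)[of x 0] q(2)[of x 0] by (simp add: poly_0_coeff_0 coeff_mult)
    then show ?thesis using T(2) by (simp add: field_simps)
  qed
  moreover have "(\<lambda>x. inverse (T v ^ k) * coeff (Q x) 0) \<in> mpol n"
    by (rule mpol_cmult[OF pfam_coeff[OF QR(1)]])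
  ultimately show ?thesis using that by blast
qed

text \<open>Cauchy's root bound: for a root of modulus above 1 the leading term is balanced by the
  lower ones, whose powers of \<open>t\<close> have modulus at most that of
  \<open>t ^ (d - 1)\<close>.\<close>

lemma poly_root_bound:
  fixes p :: "complex poly"
  assumes "coeff p d \<noteq> 0" "\<And>k. d < k \<Longrightarrow> coeff p k = 0" "poly p t = 0"
  shows "cmod t \<le> 1 + (\<Sum>j<d. cmod (coeff p j)) / cmod (coeff p d)"
proof (cases "cmod t \<le> 1")
  case True
  then show ?thesis by (simp add: add_increasing2 sum_nonneg)
next
  case False
  have deg: "degree p = d" using assms(1,2) by (metis le_degree le_antisym degree_le)
  have "0 = (\<Sum>j\<le>d. coeff p j * t ^ j)" using assms(3) unfolding poly_altdef deg by simp
  also have "\<dots> = (\<Sum>j<d. coeff p j * t ^ j) + coeff p d * t ^ d"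
    by (simp add: lessThan_Suc_atMost[symmetric])
  finally have eq: "coeff p d * t ^ d = - (\<Sum>j<d. coeff p j * t ^ j)" by (simp add: add_eq_0_iff)
  have "d \<noteq> 0" using eq assms(1) by (intro notI) simp
  then obtain e where e: "d = Suc e" using not0_implies_Suc by blast
  have "cmod (coeff p d) * (cmod t * cmod t ^ e) = cmod (\<Sum>j<d. coeff p j * t ^ j)"
    using arg_cong[OF eq, of cmod] 
    by (simp only: norm_mult norm_power norm_minus_cancel e power_Suc)
  also have "\<dots> \<le> (\<Sum>j<d. cmod (coeff p j * t ^ j))" by (rule norm_sum)
  also have "\<dots> \<le> (\<Sum>j<d. cmod (coeff p j) * cmod t ^ e)"
    using False by (intro sum_mono) (auto simp: norm_mult norm_power e intro!: mult_left_mono power_increasing)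
  also have "\<dots> = (\<Sum>j<d. cmod (coeff p j)) * cmod t ^ e" by (simp add: sum_distrib_right)
  finally have "(cmod (coeff p d) * cmod t) * cmod t ^ e \<le> (\<Sum>j<d. cmod (coeff p j)) * cmod t ^ e"
    by (simp add: mult.assoc)
  moreover have "cmod t ^ e > 0" using False by (intro zero_less_power) linarith
  ultimately have "cmod (coeff p d) * cmod t \<le> (\<Sum>j<d. cmod (coeff p j))"
    by (rule mult_right_le_imp_le)
  then have "cmod t \<le> (\<Sum>j<d. cmod (coeff p j)) / cmod (coeff p d)"
    using assms(1) by (simp add: field_simps)
  then show ?thesis by simp
qed

text \<open>A quantitative form of Vieta's formulas: a factor \<open>z - a\<close> with
  \<open>a\<close> of modulus at most \<open>\<rho>\<close> enlarges a bound on all coefficients by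
  at most \<open>1 + \<rho>\<close> and keeps the leading coefficient.\<close>

lemma poly_coeff_bound_of_roots:
  fixes p :: "complex poly"
  assumes "\<And>t. poly p t = 0 \<Longrightarrow> cmod t \<le> \<rho>" "p \<noteq> 0" "0 \<le> \<rho>"
  shows "cmod (coeff p j) \<le> (1 + \<rho>) ^ degree p * cmod (lead_coeff p)"
  using assms
proof (induction "degree p" arbitrary: p j)
  case 0
  then show ?case by (cases "j = 0") (auto simp: coeff_eq_0)
next
  case (Suc d)
  obtain a q where q: "p = [:- a, 1:] * q" and deg: "degree q = d"
    and lc: "lead_coeff q = lead_coeff p" and "q \<noteq> 0"
    using poly_root_factor[OF Suc.hyps(2)[symmetric]] by metis
  have a: "poly p a = 0" unfolding q by simp
  have IH: "cmod (coeff q j) \<le> (1 + \<rho>) ^ d * cmod (lead_coeff q)" for j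
    using Suc.hyps(1)[OF deg[symmetric] _ \<open>q \<noteq> 0\<close> Suc.prems(3), of j] Suc.prems(1) unfolding q by (auto simp: deg)
  let ?M = "(1 + \<rho>) ^ d * cmod (lead_coeff q)"
  have M0: "0 \<le> ?M" using Suc.prems(3) by simp
  have "coeff p j = (if j = 0 then 0 else coeff q (j - 1)) - a * coeff q j"
    unfolding q by (cases j) (auto simp: coeff_pCons)
  then have "cmod (coeff p j) \<le> cmod (if j = 0 then 0 else coeff q (j - 1)) + cmod a * cmod (coeff q j)"
    by (metis norm_mult norm_triangle_ineq4)
  also have "\<dots> \<le> ?M + \<rho> * ?M"
    using IH[of j] IH[of "j - 1"] M0 Suc.prems(1)[OF a] Suc.prems(3) by (intro add_mono mult_mono) auto
  also have "\<dots> = (1 + \<rho>) ^ Suc d * cmod (lead_coeff q)"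
    by (simp add: algebra_simps)
  also have "\<dots> = (1 + \<rho>) ^ degree p * cmod (lead_coeff p)"
    by (simp only: lc Suc.hyps(2))
  finally show ?case .
qed

text \<open>The value at \<open>y\<close> is the product of the differences between \<open>y\<close>
  and the roots, so the root nearest to \<open>y\<close> satisfies the estimate. This gives
  continuity of roots without a choice of branches.\<close>

lemma monic_poly_near_root:
  fixes p :: "complex poly"
  assumes "degree p = Suc d" "lead_coeff p = 1"
  shows "\<exists>t. poly p t = 0 \<and> cmod (y - t) ^ Suc d \<le> cmod (poly p y)"
  using assms
proof (induction d arbitrary: p)
  case 0
  obtain a q where q: "p = [:- a, 1:] * q" "degree q = 0" "lead_coeff q = 1"
    using poly_root_factor[OF 0(1)] 0(2) by metis
  then obtain k where "q = [:k:]" by (elim degree_eq_zeroE)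
  with q show ?case by (intro exI[of _ a]) (simp add: norm_minus_commute)
next
  case (Suc d)
  obtain a q where q: "p = [:- a, 1:] * q" "degree q = Suc d" "lead_coeff q = 1"
    using poly_root_factor[OF Suc.prems(1)] Suc.prems(2) by metis
  have a: "poly p a = 0" unfolding q(1) by simp
  obtain t where t: "poly q t = 0" "cmod (y - t) ^ Suc d \<le> cmod (poly q y)"
    using Suc.IH[OF q(2,3)] by blast
  have py: "cmod (poly p y) = cmod (y - a) * cmod (poly q y)" unfolding q(1) poly_linear_mult norm_mult ..
  show ?case
  proof (cases "cmod (y - t) \<le> cmod (y - a)")
    case True
    then have "cmod (y - t) ^ Suc (Suc d) \<le> cmod (poly p y)"
      unfolding py power_Suc[of _ "Suc d"] by (intro mult_mono t(2)) auto
    then show ?thesis using t by (intro exI[of _ t]) (simp add: q(1))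
  next
    case False
    then have "cmod (y - a) ^ Suc d \<le> cmod (y - t) ^ Suc d" by (intro power_mono) auto
    then have "cmod (y - a) ^ Suc (Suc d) \<le> cmod (poly p y)"
      unfolding py power_Suc[of _ "Suc d"] using t(2) by (intro mult_left_mono) auto
    then show ?thesis using a by blast
  qed
qed

section \<open>Euclidean density of Zariski open sets\<close>

definition accessible :: "nat \<Rightarrow> point set \<Rightarrow> point \<Rightarrow> bool" where
  "accessible n S y \<longleftrightarrow> (\<exists>u :: nat \<Rightarrow> point. (\<forall>k. u k \<in> S) \<and> (\<forall>i<n. (\<lambda>k. u k i) \<longlonglongrightarrow> y i))"

lemma accessibleI:
  assumes "\<And>\<epsilon>. \<epsilon> > 0 \<Longrightarrow> \<exists>x\<in>S. \<forall>i<n. cmod (x i - y i) < \<epsilon>"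
  shows "accessible n S y"
proof -
  have "\<forall>k. \<exists>x. x \<in> S \<and> (\<forall>i<n. cmod (x i - y i) < 1 / Suc k)"
    using assms by (intro allI) (simp add: Bex_def[symmetric])
  then obtain u where u: "\<And>k. u k \<in> S" "\<And>k i. i < n \<Longrightarrow> cmod (u k i - y i) < 1 / Suc k"
    unfolding choice_iff by blast
  have "(\<lambda>k. u k i) \<longlonglongrightarrow> y i" if "i < n" for i
  proof (rule LIM_zero_cancel, rule Lim_null_comparison[OF always_eventually LIMSEQ_inverse_real_of_nat], rule allI)
    show "cmod (u k i - y i) \<le> inverse (real (Suc k))" for k
      using u(2)[OF that, of k] by (simp add: inverse_eq_divide)
  qed
  then show ?thesis unfolding accessible_def using u(1) by blast
qed

lemma accessibleD:
  assumes "accessible n S y" "\<epsilon> > 0"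
  shows "\<exists>x\<in>S. \<forall>i<n. cmod (x i - y i) < \<epsilon>"
proof -
  obtain u where u: "\<And>k. u k \<in> S" "\<And>i. i < n \<Longrightarrow> (\<lambda>k. u k i) \<longlonglongrightarrow> y i"
    using assms(1) unfolding accessible_def by blast
  have "\<forall>\<^sub>F k in sequentially. \<forall>i\<in>{..<n}. cmod (u k i - y i) < \<epsilon>"
    by (rule eventually_ball_finite) (use u(2) assms(2) in \<open>auto simp: tendsto_iff dist_norm\<close>)
  then obtain k where "\<forall>i\<in>{..<n}. cmod (u k i - y i) < \<epsilon>"
    using eventually_happens'[OF sequentially_bot] by blast
  then show ?thesis using u(1) by blast
qed

abbreviation pullback :: "(point \<Rightarrow> point) \<Rightarrow> pfun set \<Rightarrow> pfun set" where
  "pullback \<phi> P \<equiv> {\<lambda>x. f (\<phi> x) | f. f \<in> P}"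

lemma accessible_transport:
  assumes "accessible n {x \<in> mzeros (pullback \<phi> P). c (\<phi> x) \<noteq> 0} z"
    and "\<And>i. i < n \<Longrightarrow> (\<lambda>x. \<phi> x i) \<in> mpol n"
  shows "accessible n {x \<in> mzeros P. c x \<noteq> 0} (\<phi> z)"
proof -
  obtain u where u: "\<And>k. u k \<in> mzeros (pullback \<phi> P)" "\<And>k. c (\<phi> (u k)) \<noteq> 0"
    "\<And>i. i < n \<Longrightarrow> (\<lambda>k. u k i) \<longlonglongrightarrow> z i"
    using assms(1) unfolding accessible_def by blast
  have "\<phi> (u k) \<in> mzeros P" for k
    using u(1)[of k] unfolding mzeros_def by auto
  moreover have "(\<lambda>k. \<phi> (u k) i) \<longlonglongrightarrow> \<phi> z i" if "i < n" for i
    using mpol_tendsto[OF assms(2)[OF that], of u z sequentially] u(3) by blast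
  ultimately show ?thesis unfolding accessible_def using u(2)
    by (intro exI[of _ "\<lambda>k. \<phi> (u k)"]) auto
qed

lemma mprime_transport:
  assumes P: "mprime n P" and \<phi>: "\<And>i. i < n \<Longrightarrow> (\<lambda>x. \<phi> x i) \<in> mpol n"
    and \<psi>: "\<And>i. i < n \<Longrightarrow> (\<lambda>x. \<psi> x i) \<in> mpol n" and inv: "\<And>x. \<phi> (\<psi> x) = x" "\<And>x. \<psi> (\<phi> x) = x"
  shows "mprime n (pullback \<phi> P)" (is "mprime n ?Q")
    and "c \<notin> P \<Longrightarrow> (\<lambda>x. c (\<phi> x)) \<notin> (pullback \<phi> P)"
proof -
  note I = mprime_ideal[OF P]
  have iff: "f \<in> ?Q \<longleftrightarrow> (\<lambda>x. f (\<psi> x)) \<in> P" for f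
  proof
    assume "f \<in> ?Q"
    then obtain g where "g \<in> P" "f = (\<lambda>x. g (\<phi> x))" by blast
    then show "(\<lambda>x. f (\<psi> x)) \<in> P" by (simp add: inv)
  next
    assume "(\<lambda>x. f (\<psi> x)) \<in> P"
    then show "f \<in> ?Q"
      by (intro CollectI exI[of _ "\<lambda>y. f (\<psi> y)"]) (simp add: inv)
  qed
  have sub: "f \<in> mpol n" if "(\<lambda>x. f (\<psi> x)) \<in> mpol n" for f
    using mpol_subst[OF that, of \<phi>] \<phi> by (simp add: inv)
  have sub': "(\<lambda>x. f (\<psi> x)) \<in> mpol n" if "f \<in> mpol n" for f
    using mpol_subst[OF that \<psi>] .
  have "mideal n ?Q"
    unfolding mideal_def Ball_def subset_iff iff
  proof (intro conjI allI impI)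
    fix f g assume "f \<in> mpol n" "(\<lambda>x. g (\<psi> x)) \<in> P"
    then show "(\<lambda>x. f (\<psi> x) * g (\<psi> x)) \<in> P" by (rule mideal_mult[OF I sub'])
  next
    fix f g assume "(\<lambda>x. f (\<psi> x)) \<in> P" "(\<lambda>x. g (\<psi> x)) \<in> P"
    then show "(\<lambda>x. f (\<psi> x) + g (\<psi> x)) \<in> P" by (rule mideal_add[OF I])
  qed (use mideal_0[OF I] mideal_sub[OF I] sub in auto)
  then show "mprime n ?Q"
    unfolding mprime_def Ball_def iff
  proof (intro conjI allI impI)
    fix f g assume "f \<in> mpol n" "g \<in> mpol n" "(\<lambda>x. f (\<psi> x) * g (\<psi> x)) \<in> P"
    then show "(\<lambda>x. f (\<psi> x)) \<in> P \<or> (\<lambda>x. g (\<psi> x)) \<in> P"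
      using mprime_mult[OF P sub' sub'] by simp
  qed (use mprime_1[OF P] in auto)
  show "(\<lambda>x. c (\<phi> x)) \<notin> ?Q" if "c \<notin> P" using that iff[of "\<lambda>x. c (\<phi> x)"] by (simp add: inv)
qed

text \<open>\<open>shear n y v\<close> maps the origin to \<open>y\<close> and the \<open>n\<close>-th axis to the line through \<open>y\<close> in direction
  \<open>v\<close>.\<close>

definition shear :: "nat \<Rightarrow> point \<Rightarrow> point \<Rightarrow> point \<Rightarrow> point" where
  "shear n y v x = (\<lambda>i. y i + (if i = n then 0 else x i) + v i * x n)"

definition unshear :: "nat \<Rightarrow> point \<Rightarrow> point \<Rightarrow> point \<Rightarrow> point" where
  "unshear n y v x = (\<lambda>i. if i = n then (x n - y n) / v n else x i - y i - v i * ((x n - y n) / v n))"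

lemma shear_inverse:
  assumes "v n \<noteq> 0"
  shows "shear n y v (unshear n y v x) = x" "unshear n y v (shear n y v x) = x"
  using assms by (auto simp: shear_def unshear_def fun_eq_iff)

lemma shear_mpol: "i < Suc n \<Longrightarrow> (\<lambda>x. shear n y v x i) \<in> mpol (Suc n)"
  unfolding shear_def by (cases "i = n") (auto intro!: mpol.intros)

lemma unshear_mpol: "i < Suc n \<Longrightarrow> (\<lambda>x. unshear n y v x i) \<in> mpol (Suc n)"
  unfolding unshear_def divide_inverse by (cases "i = n") (auto intro!: mpol.intros mpol_diff)

lemma shear_0: "shear n y v (\<lambda>i. 0) = y"
  by (simp add: shear_def)

text \<open>Along the new last axis the leading coefficient is \<open>T v\<close> over every base
  point. With \<open>T v \<noteq> 0\<close> this is the monic form, up to a constant, that root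
  bounds require.\<close>

lemma shear_monic:
  assumes "top_form (Suc n) f D T"
  obtains G where "G \<in> pfam n (Suc D)" "\<And>x. coeff (G x) D = T v" "(\<lambda>x. f (shear n y v x)) = pev n G"
proof -
  let ?base = "\<lambda>x i. y i + (if i = n then 0 else x i)"
  obtain p where p: "p \<in> pfam (Suc n) (Suc D)" "\<And>x. coeff (p x) D = T v"
      "\<And>x t. f (\<lambda>i. x i + t * v i) = poly (p x) t"
    using top_formD(2)[OF assms, of v] by blast
  have base: "(\<lambda>x. ?base x i) \<in> mpol n" if "i < Suc n" for i
    using that by (cases "i = n") (auto intro!: mpol.intros)
  have "(\<lambda>x. p (?base x)) \<in> pfam n (Suc D)"
    using mpol_subst[OF pfam_coeff[OF p(1)], of "?base" n] base pfam_high[OF p(1)]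
    unfolding pfam_def by auto
  moreover have "f (shear n y v x) = pev n (\<lambda>x. p (?base x)) x" for x
    unfolding pev_def p(3)[symmetric] shear_def by (simp add: mult.commute)
  ultimately show ?thesis using p(2) by (intro that[of "\<lambda>x. p (?base x)"]) auto
qed


lemma transportI: "f \<in> P \<Longrightarrow> (\<lambda>x. f (\<phi> x)) \<in> (pullback \<phi> P)"
  by blast

lemma mzeros_antimono: "P \<subseteq> Q \<Longrightarrow> a \<in> mzeros Q \<Longrightarrow> a \<in> mzeros P"
  unfolding mzeros_def by blast

text \<open>By \<open>triv\<close> the first \<open>n\<close> coordinates satisfy no equation, so
  base points may be chosen freely near \<open>y\<close>. The minimal polynomial \<open>F\<close> of
  the last coordinate can be made monic: its roots are among those of \<open>G\<close>, hence
  locally bounded, so the ratios of its coefficients to the leading one are locally bounded and thus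
  polynomials. A monic polynomial that is small at \<open>y n\<close> has a root near
  \<open>y n\<close>.\<close>

lemma accessible_hypersurface:
  assumes P: "mprime (Suc n) P" and c: "c \<in> mpol (Suc n)" "c \<notin> P" and y: "y \<in> mzeros P"
    and triv: "\<And>f x. f \<in> P \<Longrightarrow> f \<in> mpol n \<Longrightarrow> f x = 0"
    and G: "G \<in> pfam n (Suc d)" "pev n G \<in> P" "\<And>x. coeff (G x) d = \<kappa>" "\<kappa> \<noteq> 0"
  shows "accessible (Suc n) {x \<in> mzeros P. c x \<noteq> 0} y"
proof -
  note I = mprime_ideal[OF P]
  have mono: "f \<in> mpol n \<Longrightarrow> f \<in> mpol (Suc n)" for f by (erule mpol_mono) simp
  have const: "(\<lambda>x. k) \<notin> P" if "k \<noteq> 0" for k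
    using triv[of "\<lambda>x. k"] that mpol_const by auto
  have "(\<lambda>x. coeff (G x) d) \<notin> P" using const G(3,4) by simp
  from pfam_minimal[OF I I subset_refl G(1,2) this]
  obtain e F where F: "F \<in> pfam n (Suc e)" "pev n F \<in> P" "(\<lambda>x. coeff (F x) e) \<notin> P"
    and min: "\<And>G k. G \<in> pfam n e \<Longrightarrow> pev n G \<in> P \<Longrightarrow> (\<lambda>x. coeff (G x) k) \<in> P"
    by metis
  let ?b = "\<lambda>x. coeff (F x) e"
  have b: "?b \<in> mpol n" by (rule pfam_coeff[OF F(1)])
  obtain x0 where x0: "?b x0 \<noteq> 0"
  proof -
    have "?b \<noteq> (\<lambda>x. 0)" using F(3) mideal_0[OF I] by auto
    then show thesis using that by (auto simp: fun_eq_iff)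
  qed
  obtain k Q R where QR: "Q \<in> pfam n (Suc d - e)" "R \<in> pfam n e"
    "\<And>x. smult (?b x ^ k) (G x) = Q x * F x + R x" using pseudo_division[OF F(1) G(1)] by blast
  have "(\<lambda>x. ?b x ^ k * pev n G x - pev n Q x * pev n F x) \<in> P"
    by (intro mideal_diff[OF I] mideal_mult[OF I] F(2) G(2) pev_mpol[OF QR(1)] mono mpol_power b)
  also have "(\<lambda>x. ?b x ^ k * pev n G x - pev n Q x * pev n F x) = pev n R"
    by (rule pev_remainder[OF QR(3)])
  finally have RP: "pev n R \<in> P" .
  \<comment> \<open>The coefficients of the remainder lie in \<open>P\<close> and do not involve the
    last variable, so they are zero by \<open>triv\<close>. Up to a power of \<open>b\<close>,
    \<open>F\<close> divides \<open>G\<close>.\<close>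
  have R0: "R x = 0" for x
    using triv[OF min[OF QR(2) RP] pfam_coeff[OF QR(2)]] by (simp add: poly_eq_iff)
  define \<rho> where "\<rho> x = 1 + (\<Sum>j<d. cmod (coeff (G x) j)) / cmod \<kappa>" for x
  have \<rho>0: "0 \<le> \<rho> x" for x unfolding \<rho>_def by (simp add: sum_nonneg)
  have roots: "cmod t \<le> \<rho> x" if "?b x \<noteq> 0" "poly (F x) t = 0" for x t
  proof -
    have "poly (smult (?b x ^ k) (G x)) t = 0" using QR(3)[of x] R0[of x] that by simp
    then have "poly (G x) t = 0" using that by simp
    moreover have "coeff (G x) k = 0" if "d < k" for k using that by (intro pfam_high[OF G(1)]) simp
    ultimately have "cmod t \<le> 1 + (\<Sum>j<d. cmod (coeff (G x) j)) / cmod (coeff (G x) d)"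
      using G(4) by (intro poly_root_bound) (simp_all add: G(3))
    then show ?thesis by (simp add: \<rho>_def G(3))
  qed
  have bound: "cmod (coeff (F x) j) \<le> (1 + \<rho> x) ^ e * cmod (?b x)" if "?b x \<noteq> 0" for x j
  proof -
    have "degree (F x) = e"
      using that pfam_high[OF F(1)] by (metis Suc_leI degree_le le_antisym le_degree)
    then show ?thesis
      using poly_coeff_bound_of_roots[of "F x" "\<rho> x" j] roots[OF that] \<rho>0 that by force
  qed
  have cont: "isCont (\<lambda>t. (1 + \<rho> (\<lambda>i. x i + t * v i)) ^ e) t" for x v t
  proof -
    have "isCont (\<lambda>t. coeff (G (\<lambda>i. x i + t * v i)) j) t" for j
      unfolding isCont_def
    proof (rule mpol_tendsto[OF pfam_coeff[OF G(1)]])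
      fix i show "((\<lambda>t. x i + t * v i) \<longlongrightarrow> x i + t * v i) (at t)" by (intro tendsto_intros)
    qed
    then show ?thesis unfolding \<rho>_def by (intro continuous_intros) (use G(4) in auto)
  qed
  have "\<exists>s. s \<in> mpol n \<and> (\<forall>x. coeff (F x) j = ?b x * s x)" for j
    using mpol_dvd_of_bound[OF b x0 pfam_coeff[OF F(1)] cont bound, of j] by metis
  then obtain s where s: "\<And>j. s j \<in> mpol n" "\<And>j x. coeff (F x) j = ?b x * s j x"
    by metis
  define F1 where "F1 x = (\<Sum>j<e. monom (s j x) j) + monom 1 e" for x
  have coeff_F1: "coeff (F1 x) j = (if j < e then s j x else if j = e then 1 else 0)" for x j
    unfolding F1_def by (auto simp: coeff_sum coeff_monom sum.delta')
  have F1: "F1 \<in> pfam n (Suc e)"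
    unfolding pfam_def
  proof (intro CollectI conjI allI impI)
    show "(\<lambda>x. coeff (F1 x) j) \<in> mpol n" for j
      unfolding coeff_F1 using s(1) mpol_const by (cases "j < e"; cases "j = e") simp_all
  qed (simp add: coeff_F1)
  have bF1: "smult (?b x) (F1 x) = F x" for x
  proof (rule poly_eqI)
    fix j
    consider "j < e" | "j = e" | "Suc e \<le> j" by linarith
    then show "coeff (smult (?b x) (F1 x)) j = coeff (F x) j"
    proof cases
      case 1
      then show ?thesis using s(2)[where j = j and x = x] by (simp only: coeff_smult coeff_F1 if_True)
    next
      case 3
      then show ?thesis using pfam_high[OF F(1), of j x] by (simp add: coeff_F1)
    qed (simp add: coeff_F1)
  qed
  have "(\<lambda>x. ?b x * pev n F1 x) \<in> P"
  proof -
    have "?b x * pev n F1 x = pev n F x" for x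
      using arg_cong[OF bF1[of x], of "\<lambda>p. poly p (x n)"] by (simp add: pev_def)
    then show ?thesis using F(2) by simp
  qed
  then have F1P: "pev n F1 \<in> P"
    using mprime_mult[OF P mono[OF b] pev_mpol[OF F1]] F(3) by blast
  have "(\<lambda>x. coeff (F1 x) e) \<notin> P" using const[of 1] by (simp add: coeff_F1)
  from elim_algebraic[OF P F1 F1P this min c] obtain c' where c': "c' \<in> mpol n" "c' \<notin> P"
    "\<And>a t. a \<in> mzeros (P \<inter> mpol n) \<Longrightarrow> c' a \<noteq> 0 \<Longrightarrow> poly (F1 a) t = 0 \<Longrightarrow>
       a(n := t) \<in> mzeros P \<and> c (a(n := t)) \<noteq> 0" by metis
  have all: "a \<in> mzeros (P \<inter> mpol n)" for a using triv unfolding mzeros_def by blast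
  obtain a0 where a0: "c' a0 \<noteq> 0"
  proof -
    have "c' \<noteq> (\<lambda>x. 0)" using c'(2) mideal_0[OF I] by auto
    then show thesis using that by (auto simp: fun_eq_iff)
  qed
  have "e \<noteq> 0"
  proof
    assume "e = 0"
    then have "pev n F1 = (\<lambda>x. 1)" by (intro ext) (simp add: pfam_pev_sum[OF F1] coeff_F1)
    then show False using F1P mprime_1[OF P] by simp
  qed
  then obtain e' where e': "e = Suc e'" using not0_implies_Suc by blast
  \<comment> \<open>Every point is a zero of \<open>P \<inter> mpol n\<close>, so a base point only
    has to avoid the zeros of \<open>c'\<close>.\<close>
  have "accessible n {x. c' x \<noteq> 0} y"
    by (rule accessibleI) (use mpol_nonzero_near[OF c'(1) a0] in blast)
  then obtain u where u: "\<And>k. c' (u k) \<noteq> 0" "\<And>i. i < n \<Longrightarrow> (\<lambda>k. u k i) \<longlonglongrightarrow> y i"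
    unfolding accessible_def by blast
  have "\<exists>t. poly (F1 (u k)) t = 0 \<and> cmod (y n - t) ^ e \<le> cmod (poly (F1 (u k)) (y n))" for k
  proof -
    have deg: "degree (F1 (u k)) = Suc e'"
      using coeff_F1[of "u k"] e' by (intro antisym degree_le le_degree) auto
    show ?thesis unfolding e' by (rule monic_poly_near_root[OF deg]) (simp add: deg coeff_F1 e')
  qed
  then obtain t where t: "\<And>k. poly (F1 (u k)) (t k) = 0"
      "\<And>k. cmod (y n - t k) ^ e \<le> cmod (poly (F1 (u k)) (y n))" by metis
  \<comment> \<open>The base point moves while the last coordinate stays at \<open>y n\<close>. The
    limit is 0 because \<open>y\<close> is a zero of \<open>P\<close>, and this drives the chosen
    roots to \<open>y n\<close>.\<close>
  have "(\<lambda>k. pev n F1 ((u k)(n := y n))) \<longlonglongrightarrow> pev n F1 y"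
  proof (rule mpol_tendsto[OF pev_mpol[OF F1]])
    show "(\<lambda>k. ((u k)(n := y n)) i) \<longlonglongrightarrow> y i" if "i < Suc n" for i
      using u(2)[of i] that by (cases "i = n") auto
  qed
  then have lim0: "(\<lambda>k. poly (F1 (u k)) (y n)) \<longlonglongrightarrow> 0"
    using mzerosD[OF y F1P] by (simp add: pev_def pfam_upd[OF F1])
  have "t \<longlonglongrightarrow> y n"
    unfolding tendsto_iff
  proof (intro allI impI)
    fix \<epsilon> :: real assume "\<epsilon> > 0"
    then have "\<forall>\<^sub>F k in sequentially. dist (poly (F1 (u k)) (y n)) 0 < \<epsilon> ^ e"
      using lim0 unfolding tendsto_iff by simp
    then show "\<forall>\<^sub>F k in sequentially. dist (t k) (y n) < \<epsilon>"
    proof eventually_elim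
      case (elim k)
      then have "cmod (y n - t k) ^ e < \<epsilon> ^ e"
        by (intro le_less_trans[OF t(2)]) (simp only: dist_norm diff_zero)
      then have "cmod (y n - t k) < \<epsilon>"
        by (rule power_less_imp_less_base) (use \<open>\<epsilon> > 0\<close> in simp)
      then show ?case by (simp add: dist_norm norm_minus_commute)
    qed
  qed
  then have "(\<lambda>k. ((u k)(n := t k)) i) \<longlonglongrightarrow> y i" if "i < Suc n" for i
    using u(2)[of i] that by (cases "i = n") auto
  moreover have "(u k)(n := t k) \<in> {x \<in> mzeros P. c x \<noteq> 0}" for k
    using c'(3)[OF all u(1) t(1)] by simp
  ultimately show ?thesis unfolding accessible_def
    by (intro exI[of _ "\<lambda>k. (u k)(n := t k)"] conjI allI impI)
qed

text \<open>The origin is approximated in the projection by \<open>IH\<close>, and the approximating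
  points are lifted by elimination. The lifted last coordinates are roots of a family that is monic
  up to a constant, hence bounded; a limit point lies in the zero set over the origin, and
  \<open>axis\<close> identifies it with the origin.\<close>

lemma accessible_project:
  assumes P: "mprime (Suc n) P" and c: "c \<in> mpol (Suc n)" "c \<notin> P"
    and zero: "(\<lambda>i. 0) \<in> mzeros P"
    and axis: "\<And>a. a \<in> mzeros P \<Longrightarrow> (\<And>i. i < n \<Longrightarrow> a i = 0) \<Longrightarrow> a n = 0"
    and G: "G \<in> pfam n (Suc d)" "pev n G \<in> P" "\<And>x. coeff (G x) d = \<kappa>" "\<kappa> \<noteq> 0"
    and IH: "\<And>c. c \<in> mpol n \<Longrightarrow> c \<notin> P \<Longrightarrow> accessible n {x \<in> mzeros (P \<inter> mpol n). c x \<noteq> 0} (\<lambda>i. 0)"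
  shows "accessible (Suc n) {x \<in> mzeros P. c x \<noteq> 0} (\<lambda>i. 0)"
proof -
  obtain c' where c': "c' \<in> mpol n" "c' \<notin> P"
    "\<And>a. a \<in> mzeros (P \<inter> mpol n) \<Longrightarrow> c' a \<noteq> 0 \<Longrightarrow> \<exists>t. a(n := t) \<in> mzeros P \<and> c (a(n := t)) \<noteq> 0"
    using elim_step[OF P c] by metis
  obtain u where u: "\<And>k. u k \<in> mzeros (P \<inter> mpol n)" "\<And>k. c' (u k) \<noteq> 0"
    "\<And>i. i < n \<Longrightarrow> (\<lambda>k. u k i) \<longlonglongrightarrow> 0"
    using IH[OF c'(1,2)] unfolding accessible_def by blast
  obtain t where t: "\<And>k. (u k)(n := t k) \<in> mzeros P" "\<And>k. c ((u k)(n := t k)) \<noteq> 0"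
    using c'(3)[OF u(1) u(2)] by metis
  have "cmod (t k) \<le> 1 + (\<Sum>j<d. cmod (coeff (G (u k)) j)) / cmod \<kappa>" for k
  proof -
    have "poly (G (u k)) (t k) = 0"
      using mzerosD[OF t(1) G(2), of k] by (simp add: pev_def pfam_upd[OF G(1)])
    then show ?thesis using poly_root_bound[of "G (u k)" d "t k"] G(3,4) pfam_high[OF G(1)] by simp
  qed
  moreover have "Bseq (\<lambda>k. 1 + (\<Sum>j<d. cmod (coeff (G (u k)) j)) / cmod \<kappa>)"
  proof (rule convergent_imp_Bseq, rule convergentI)
    show "(\<lambda>k. 1 + (\<Sum>j<d. cmod (coeff (G (u k)) j)) / cmod \<kappa>) \<longlonglongrightarrow>
        1 + (\<Sum>j<d. cmod (coeff (G (\<lambda>i. 0)) j)) / cmod \<kappa>"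
      by (intro tendsto_intros mpol_tendsto[OF pfam_coeff[OF G(1)]] u(3)) (use G(4) in auto)
  qed
  ultimately have "Bseq t"
    by (elim Bseq_eventually_mono[rotated]) (auto intro!: always_eventually order_trans[OF _ abs_ge_self])
  then have "bounded (range t)" by (simp add: Bseq_eq_bounded)
  then obtain l r where r: "strict_mono r" "(t \<circ> r) \<longlonglongrightarrow> l"
    using bounded_imp_convergent_subsequence by blast
  let ?w = "\<lambda>k. (u (r k))(n := t (r k))"
  let ?a = "(\<lambda>i. 0)(n := l)"
  have w: "(\<lambda>k. ?w k i) \<longlonglongrightarrow> ?a i" if "i < Suc n" for i
    using that LIMSEQ_subseq_LIMSEQ[OF u(3) r(1), of i] r(2) by (auto simp: less_Suc_eq o_def)
  have "?a \<in> mzeros P"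
    unfolding mzeros_def
  proof (intro CollectI ballI)
    fix f assume f: "f \<in> P"
    have "(\<lambda>k. f (?w k)) \<longlonglongrightarrow> f ?a"
      by (rule mpol_tendsto[OF mideal_sub[OF mprime_ideal[OF P] f] w])
    moreover have "f (?w k) = 0" for k by (rule mzerosD[OF t(1) f])
    ultimately show "f ?a = 0" by (simp add: LIMSEQ_const_iff)
  qed
  then have "l = 0" using axis[of ?a] by simp
  then have "?a = (\<lambda>i. 0)" by auto
  then show ?thesis using w t unfolding accessible_def
    by (intro exI[of _ ?w]) simp
qed

lemma finite_roots_vimage:
  assumes "p \<noteq> (0 :: complex poly)" "\<rho> \<noteq> 0"
  shows "finite {s. poly p (\<rho> * s) = 0}"
proof -
  have "{s. poly p (\<rho> * s) = 0} \<subseteq> (\<lambda>t. t / \<rho>) ` {t. poly p t = 0}"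
    using assms(2) by (auto simp: image_iff field_simps intro!: exI[of _ "\<rho> * _"])
  then show ?thesis using poly_roots_finite[OF assms(1)] finite_surj by blast
qed

text \<open>The second shear turns the last axis into a line which meets the variety only in the given
  point, so that solutions found after projecting along it cannot accumulate anywhere else.\<close>

theorem accessible_mprime:
  assumes "mprime n P" "c \<in> mpol n" "c \<notin> P" "y \<in> mzeros P"
  shows "accessible n {x \<in> mzeros P. c x \<noteq> 0} y"
  using assms
proof (induction n arbitrary: P c y)
  case 0
  have const: "f x = f y" if "f \<in> mpol 0" for f x y by (rule mpol_cong[OF that]) simp
  have "c y \<noteq> 0"
  proof
    assume "c y = 0"
    then have "c = (\<lambda>x. 0)" using const[OF "0.prems"(2)] by metis
    then show False using mideal_0[OF mprime_ideal[OF "0.prems"(1)]] "0.prems"(3) by simp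
  qed
  then show ?case using "0.prems"(4) by (auto simp: accessible_def)
next
  case (Suc n)
  note P = Suc.prems(1)
  note I = mprime_ideal[OF P]
  show ?case
  proof (cases "\<forall>f\<in>P. \<forall>x. f x = 0")
    case True
    then have all: "mzeros P = UNIV" by (auto simp: mzeros_def)
    have "c \<noteq> (\<lambda>x. 0)" using Suc.prems(3) mideal_0[OF I] by auto
    then obtain a where "c a \<noteq> 0" by (auto simp: fun_eq_iff)
    then show ?thesis unfolding all
      by (intro accessibleI) (use mpol_nonzero_near[OF Suc.prems(2)] in auto)
  next
    case False
    then obtain F a where F: "F \<in> P" "F a \<noteq> 0" by blast
    obtain D T b where T: "top_form (Suc n) F D T" "T b \<noteq> 0"
      using mpol_top_form[OF mideal_sub[OF I F(1)] F(2)] .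
    \<comment> \<open>\<open>T v \<noteq> 0\<close> makes \<open>F\<close> monic up to a constant
      along \<open>v\<close>, and \<open>v n \<noteq> 0\<close> makes the shear invertible.\<close>
    obtain v where v: "T v \<noteq> 0" "v n \<noteq> 0"
    proof -
      have "(\<lambda>x. x n) \<in> mpol (Suc n)" by (rule mpol_var) simp
      from mpol_domain[OF top_formD(1)[OF T(1)] this T(2), of "\<lambda>i. 1"] show thesis using that by auto
    qed
    obtain G where G: "G \<in> pfam n (Suc D)" "\<And>x. coeff (G x) D = T v"
        "(\<lambda>x. F (shear n y v x)) = pev n G"
      using shear_monic[OF T(1)] by metis
    let ?\<phi> = "shear n y v"
    let ?P1 = "pullback ?\<phi> P"
    let ?c1 = "\<lambda>x. c (?\<phi> x)"
    note tr1 = mprime_transport[of "Suc n" P ?\<phi> "unshear n y v",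
        OF P shear_mpol unshear_mpol shear_inverse(1)[of v n y, OF v(2)] shear_inverse(2)[of v n y, OF v(2)]]
    have P1: "mprime (Suc n) ?P1" by (rule tr1(1))
    note I1 = mprime_ideal[OF P1]
    have c1: "?c1 \<in> mpol (Suc n)" "?c1 \<notin> ?P1"
      using mpol_subst[OF Suc.prems(2) shear_mpol] tr1(2)[OF _ _ Suc.prems(3)] by auto
    have GP: "pev n G \<in> ?P1" unfolding G(3)[symmetric] using F(1) by (rule transportI)
    have zero1: "(\<lambda>i. 0) \<in> mzeros ?P1"
      using Suc.prems(4) by (auto simp: mzeros_def shear_0)
    have "accessible (Suc n) {x \<in> mzeros ?P1. ?c1 x \<noteq> 0} (\<lambda>i. 0)"
    \<comment> \<open>Either the projection satisfies no equation and the variety is a hypersurface,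
      or a nonzero \<open>H\<close> in the ideal does not involve the last variable, which leaves
      room for a line through the origin that does not meet the variety again.\<close>
    proof (cases "\<forall>f\<in>?P1. f \<in> mpol n \<longrightarrow> (\<forall>x. f x = 0)")
      case True
      show ?thesis
        by (rule accessible_hypersurface[OF P1 c1 zero1 _ G(1) GP G(2) v(1)]) (use True in blast)
    next
      case False
      then obtain H h where H: "H \<in> ?P1" "H \<in> mpol n" "H h \<noteq> 0" by blast
      obtain DH TH bH where TH: "top_form n H DH TH" "TH bH \<noteq> 0"
        using mpol_top_form[OF H(2,3)] .
      obtain F1 a1 where F1: "F1 = pev n G" "F1 a1 \<noteq> 0"
        using F(2) fun_cong[OF G(3), of "unshear n y v a"] shear_inverse(1)[of v n y a, OF v(2)] by metis
      have F1m: "F1 \<in> mpol (Suc n)" "F1 \<in> ?P1" using pev_mpol[OF G(1)] GP F1 by auto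
      obtain D' T' b' where T': "top_form (Suc n) F1 D' T'" "T' b' \<noteq> 0"
        using mpol_top_form[OF F1m(1) F1(2)] .
      have "TH \<in> mpol (Suc n)" by (rule mpol_mono[OF top_formD(1)[OF TH(1)]]) simp
      from mpol_domain[OF this top_formD(1)[OF T'(1)] TH(2) T'(2)]
      obtain v0 where v0: "TH v0 \<noteq> 0" "T' v0 \<noteq> 0" by blast
      obtain p where p: "p\<in>pfam n (Suc DH)" "\<And>x. coeff (p x) DH = TH v0"
        "\<And>x t. H (\<lambda>i. x i + t * v0 i) = poly (p x) t"
        using top_formD(2)[OF TH(1), of v0] by blast
      let ?h = "p (\<lambda>i. 0)"
      have "?h \<noteq> 0" using p(2)[of "\<lambda>i. 0"] v0 by auto
      have Hh: "H (\<lambda>i. t * v0 i) = poly ?h t" for t using p(3)[of "\<lambda>i. 0" t] by simp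
      obtain q where q: "\<And>t. T' (\<lambda>i. (v0(n := 0)) i + t * ((\<lambda>i. 0)(n := 1)) i) = poly q t"
        using mpol_line[OF top_formD(1)[OF T'(1)], of "v0(n := 0)" "(\<lambda>i. 0)(n := 1)"] by auto
      have q': "T' (v0(n := t)) = poly q t" for t
      proof -
        have "(\<lambda>i. (v0(n := 0)) i + t * ((\<lambda>i. 0)(n := 1)) i) = v0(n := t)" by auto
        then show ?thesis using q[of t] by simp
      qed
      have "q \<noteq> 0" using q'[of "v0 n"] v0(2) by auto
      \<comment> \<open>The line through the origin in direction \<open>v0(n := s)\<close> meets the
        variety only at parameters \<open>\<rho>\<close> where \<open>H\<close> vanishes. These are
        the roots of \<open>?h\<close>, the same for all \<open>s\<close>, as \<open>H\<close>
        ignores the last variable. For each nonzero \<open>\<rho>\<close> among them, those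
        \<open>s\<close> are excluded for which \<open>G\<close> vanishes too; they are finitely
        many, since \<open>G\<close> is monic up to a constant. Roots of \<open>q\<close> would make
        the top form of \<open>F1\<close> vanish, and 0 would make the shear singular.\<close>
      let ?bad = "insert 0 ({t. poly q t = 0} \<union>
          (\<Union>\<rho>\<in>{\<rho>. poly ?h \<rho> = 0} - {0}. {s. poly (G (\<lambda>i. \<rho> * v0 i)) (\<rho> * s) = 0}))"
      have "finite ?bad"
        using poly_roots_finite[OF \<open>q \<noteq> 0\<close>] poly_roots_finite[OF \<open>?h \<noteq> 0\<close>]
      proof (intro finite.insertI finite_UnI finite_UN_I finite_Diff finite_roots_vimage)
        show "G (\<lambda>i. \<rho> * v0 i) \<noteq> 0" for \<rho> using G(2)[of "\<lambda>i. \<rho> * v0 i"] v(1) by auto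
      qed auto
      then obtain s where s: "s \<notin> ?bad" using ex_new_if_finite[OF infinite_UNIV_char_0] by blast
      let ?v = "v0(n := s)"
      have v': "T' ?v \<noteq> 0" "?v n \<noteq> 0" using s q' by auto
      obtain G' where G': "G' \<in> pfam n (Suc D')" "\<And>x. coeff (G' x) D' = T' ?v"
          "(\<lambda>x. F1 (shear n (\<lambda>i. 0) ?v x)) = pev n G'"
        using shear_monic[OF T'(1)] by metis
      let ?\<phi>' = "shear n (\<lambda>i. 0) ?v"
      let ?P2 = "pullback ?\<phi>' ?P1"
      let ?c2 = "\<lambda>x. ?c1 (?\<phi>' x)"
      note tr2 = mprime_transport[of "Suc n" ?P1 ?\<phi>' "unshear n (\<lambda>i. 0) ?v",
          OF P1 shear_mpol unshear_mpol shear_inverse(1)[of ?v n "\<lambda>i. 0", OF v'(2)]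
            shear_inverse(2)[of ?v n "\<lambda>i. 0", OF v'(2)]]
      have P2: "mprime (Suc n) ?P2" by (rule tr2(1))
      have c2: "?c2 \<in> mpol (Suc n)" "?c2 \<notin> ?P2"
        using mpol_subst[OF c1(1) shear_mpol] tr2(2)[OF _ _ c1(2)] by auto
      have GP': "pev n G' \<in> ?P2" unfolding G'(3)[symmetric] using F1m(2)
        by (rule transportI)
      have zero2: "(\<lambda>i. 0) \<in> mzeros ?P2"
      proof -
        have "f (?\<phi>' (\<lambda>i. 0)) = 0" if "f \<in> ?P1" for f
          unfolding shear_0 by (rule mzerosD[OF zero1 that])
        then show ?thesis unfolding mzeros_def by blast
      qed
      have axis: "a n = 0" if a: "a \<in> mzeros ?P2" "\<And>i. i < n \<Longrightarrow> a i = 0" for a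
      proof (rule ccontr)
        assume "a n \<noteq> 0"
        let ?t = "a n"
        have z: "f (?\<phi>' a) = 0" if "f \<in> ?P1" for f
          by (rule mzerosD[OF a(1) transportI[OF that]])
        have eq: "?\<phi>' a i = ?v i * ?t" if "i < Suc n" for i
          using a(2) that by (auto simp: shear_def less_Suc_eq)
        have "H (?\<phi>' a) = H (\<lambda>i. ?t * v0 i)"
          by (rule mpol_cong[OF H(2)]) (simp add: eq mult.commute)
        then have "poly ?h ?t = 0" using z[OF H(1)] Hh by simp
        then have "poly (G (\<lambda>i. ?t * v0 i)) (?t * s) \<noteq> 0"
          using s \<open>a n \<noteq> 0\<close> by auto
        moreover have "pev n G (?\<phi>' a) = poly (G (\<lambda>i. ?t * v0 i)) (?t * s)"
        proof -
          have "G (?\<phi>' a) = G (\<lambda>i. ?t * v0 i)" by (rule pfam_cong[OF G(1)]) (simp add: eq mult.commute)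
          then show ?thesis unfolding pev_def using eq[of n] by (simp add: mult.commute)
        qed
        ultimately show False using z[OF GP] by simp
      qed
      have IH: "accessible n {x \<in> mzeros (?P2 \<inter> mpol n). c x \<noteq> 0} (\<lambda>i. 0)"
        if "c \<in> mpol n" "c \<notin> ?P2" for c
      proof (rule Suc.IH[OF mprime_restrict[OF P2] that(1)])
        show "(\<lambda>i. 0) \<in> mzeros (?P2 \<inter> mpol n)" by (rule mzeros_antimono[OF Int_lower1 zero2])
        show "c \<notin> ?P2 \<inter> mpol n" by (rule contra_subsetD[OF Int_lower1 that(2)])
      qed simp
      have "accessible (Suc n) {x \<in> mzeros ?P2. ?c2 x \<noteq> 0} (\<lambda>i. 0)"
      proof (rule accessible_project[where G = G' and d = D' and \<kappa> = "T' ?v"])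
        show "a n = 0" if "a \<in> mzeros ?P2" "\<And>i. i < n \<Longrightarrow> a i = 0" for a by (rule axis[OF that])
        show "accessible n {x \<in> mzeros (?P2 \<inter> mpol n). c x \<noteq> 0} (\<lambda>i. 0)"
          if "c \<in> mpol n" "c \<notin> ?P2" for c by (rule IH[OF that])
      qed (rule P2 c2 zero2 G'(1) GP' G'(2) v'(1))+
      from accessible_transport[OF this shear_mpol]
      show ?thesis unfolding shear_0 .
    qed
    from accessible_transport[OF this shear_mpol]
    show ?thesis unfolding shear_0 .
  qed
qed

text \<open>Krull's argument: an ideal maximal among those containing \<open>J\<close> and disjoint
  from the multiplicative set \<open>S\<close> is prime. Enlarging it by \<open>f\<close> or by
  \<open>g\<close> meets \<open>S\<close>, and the product of the two elements found would lie in
  the ideal if the product of \<open>f\<close> and \<open>g\<close> did.\<close>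

lemma exists_mprime_avoiding:
  assumes J: "mideal n J" and S: "S \<subseteq> mpol n" "(\<lambda>x. 1) \<in> S" "\<And>f g. f \<in> S \<Longrightarrow> g \<in> S \<Longrightarrow> (\<lambda>x. f x * g x) \<in> S"
    and disj: "J \<inter> S = {}"
  obtains P where "mprime n P" "J \<subseteq> P" "P \<inter> S = {}"
proof -
  define A where "A = {I. mideal n I \<and> J \<subseteq> I \<and> I \<inter> S = {}}"
  have "\<exists>M\<in>A. \<forall>X\<in>A. M \<subseteq> X \<longrightarrow> X = M"
  proof (rule subset_Zorn_nonempty)
    show "A \<noteq> {}" using J disj unfolding A_def by blast
    fix C assume C: "C \<noteq> {}" "subset.chain A C"
    have CA: "C \<subseteq> A" using C(2) by (simp add: subset.chain_def)
    have lin: "X \<subseteq> Y \<or> Y \<subseteq> X" if "X \<in> C" "Y \<in> C" for X Y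
      using C(2) that unfolding subset_chain_def by blast
    have id: "mideal n X" if "X \<in> C" for X using that CA unfolding A_def by blast
    have "mideal n (\<Union>C)"
      unfolding mideal_def
    proof (intro conjI ballI subsetI)
      fix g assume "g \<in> \<Union>C" then show "g \<in> mpol n" using mideal_sub[OF id] by blast
    next
      show "(\<lambda>x. 0) \<in> \<Union>C" using C(1) mideal_0[OF id] by blast
    next
      fix g h assume "g \<in> \<Union>C" "h \<in> \<Union>C"
      then obtain X Y where XY: "X \<in> C" "g \<in> X" "Y \<in> C" "h \<in> Y" by blast
      then have "\<exists>Z\<in>C. g \<in> Z \<and> h \<in> Z" using lin[of X Y] by blast
      then show "(\<lambda>x. g x + h x) \<in> \<Union>C" using mideal_add[OF id] by blast
    next
      fix g h assume "g \<in> mpol n" "h \<in> \<Union>C"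
      then show "(\<lambda>x. g x * h x) \<in> \<Union>C" using mideal_mult[OF id] by blast
    qed
    then show "\<Union>C \<in> A" using CA C(1) unfolding A_def by blast
  qed
  then obtain P where PA: "P \<in> A" and max: "\<forall>X\<in>A. P \<subseteq> X \<longrightarrow> X = P"
    by blast
  then have P: "mideal n P" "J \<subseteq> P" "P \<inter> S = {}" unfolding A_def by auto
  have meet: "\<exists>\<pi> s. \<pi> \<in> P \<and> s \<in> mpol n \<and> (\<lambda>x. \<pi> x + f x * s x) \<in> S" if f: "f \<in> mpol n" "f \<notin> P" for f
  proof -
    let ?Q = "{\<lambda>x. \<pi> x + f x * s x | \<pi> s. \<pi> \<in> P \<and> s \<in> mpol n}"
    note Q = mideal_extend[OF P(1) f(1)]
    have "?Q \<noteq> P" using Q(3) f(2) by auto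
    then have "?Q \<notin> A" using max Q(2) by auto
    then have "?Q \<inter> S \<noteq> {}" using Q(1,2) P(2) unfolding A_def by auto
    then show ?thesis by auto
  qed
  have "mprime n P"
    unfolding mprime_def
  proof (intro conjI ballI impI P(1))
    show "(\<lambda>x. 1) \<notin> P" using P(3) S(2) by blast
    fix f g assume fg: "f \<in> mpol n" "g \<in> mpol n" "(\<lambda>x. f x * g x) \<in> P"
    show "f \<in> P \<or> g \<in> P"
    proof (rule ccontr)
      assume "\<not> (f \<in> P \<or> g \<in> P)"
      then have "f \<notin> P" "g \<notin> P" by auto
      obtain \<pi> s where "\<pi> \<in> P" "s \<in> mpol n" "(\<lambda>x. \<pi> x + f x * s x) \<in> S"
        using meet[OF fg(1) \<open>f \<notin> P\<close>] by (elim exE conjE)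
      moreover obtain \<pi>' s' where "\<pi>' \<in> P" "s' \<in> mpol n" "(\<lambda>x. \<pi>' x + g x * s' x) \<in> S"
        using meet[OF fg(2) \<open>g \<notin> P\<close>] by (elim exE conjE)
      ultimately have *: "\<pi> \<in> P" "s \<in> mpol n" "(\<lambda>x. \<pi> x + f x * s x) \<in> S"
          "\<pi>' \<in> P" "s' \<in> mpol n" "(\<lambda>x. \<pi>' x + g x * s' x) \<in> S" by this+
      have "(\<lambda>x. (\<pi> x + f x * s x) * (\<pi>' x + g x * s' x)) \<in> S" by (rule S(3)[OF *(3,6)])
      moreover have "(\<lambda>x. (\<pi> x + f x * s x) * \<pi>' x + (\<pi> x * (g x * s' x) + (s x * s' x) * (f x * g x))) \<in> P"
        by (intro mideal_add[OF P(1)] mideal_mult[OF P(1)] mideal_mult'[OF P(1)] mpol_mult mpol_add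
            * fg mideal_sub[OF P(1) *(1)])
      moreover have "(\<lambda>x. (\<pi> x + f x * s x) * \<pi>' x + (\<pi> x * (g x * s' x) + (s x * s' x) * (f x * g x))) =
         (\<lambda>x. (\<pi> x + f x * s x) * (\<pi>' x + g x * s' x))" by (simp add: algebra_simps)
      ultimately show False using P(3) by auto
    qed
  qed
  then show ?thesis using that P by blast
qed

text \<open>The last hypothesis says that \<open>y\<close> is in the Zariski closure of the projection of the variety
  to its first \<open>M\<close> coordinates.\<close>

theorem accessible_projection:
  assumes E: "E \<subseteq> mpol N" and "M \<le> N"
    and y: "\<And>f. f \<in> mpol M \<Longrightarrow> (\<And>w. w \<in> mzeros E \<Longrightarrow> f w = 0) \<Longrightarrow> f y = 0"
  shows "accessible M (mzeros E) y"
proof -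
  define J where "J = {f \<in> mpol N. \<forall>w\<in>mzeros E. f w = 0}"
  have J: "mideal N J"
    unfolding mideal_def J_def by (auto intro: mpol.intros)
  \<comment> \<open>A prime disjoint from this set has \<open>y\<close> among the zeros of its part
    in the first \<open>M\<close> variables; the hypothesis on \<open>y\<close> says that the
    vanishing ideal \<open>J\<close> is disjoint from it.\<close>
  define S where "S = {f \<in> mpol M. f y \<noteq> 0}"
  have "J \<inter> S = {}" using y unfolding J_def S_def by blast
  moreover have "S \<subseteq> mpol N" unfolding S_def using mpol_mono'[OF \<open>M \<le> N\<close>] by blast
  moreover have "(\<lambda>x. 1) \<in> S" unfolding S_def by (simp add: mpol_const)
  moreover have "(\<lambda>x. f x * g x) \<in> S" if "f \<in> S" "g \<in> S" for f g
    using that unfolding S_def by (simp add: mpol_mult)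
  ultimately obtain P where P: "mprime N P" "J \<subseteq> P" "P \<inter> S = {}"
    using exists_mprime_avoiding[OF J, of S] by metis
  have y': "y \<in> mzeros (P \<inter> mpol M)" using P(3) unfolding S_def mzeros_def by blast
  \<comment> \<open>Elimination with the constant condition 1: away from the zeros of
    \<open>c\<close> every point of the closure of the projection lifts, and by
    \<open>accessible_mprime\<close> such points come arbitrarily close to \<open>y\<close>.\<close>
  obtain c where c: "c \<in> mpol M" "c \<notin> P" and lift:
    "\<And>a. a \<in> mzeros (P \<inter> mpol M) \<Longrightarrow> c a \<noteq> 0 \<Longrightarrow> \<exists>w\<in>mzeros P. \<forall>i<M. w i = a i"
    using elim_iterated[OF P(1) mpol_const mprime_1[OF P(1)] \<open>M \<le> N\<close>] by blast
  have acc: "accessible M {x \<in> mzeros (P \<inter> mpol M). c x \<noteq> 0} y"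
    by (rule accessible_mprime[OF mprime_restrict[OF P(1) \<open>M \<le> N\<close>] c(1) _ y']) (use c in blast)
  have sub: "mzeros P \<subseteq> mzeros E"
    using P(2) E unfolding J_def mzeros_def by blast
  show ?thesis
  proof (rule accessibleI)
    fix \<epsilon> :: real assume "\<epsilon> > 0"
    then obtain a where a: "a \<in> mzeros (P \<inter> mpol M)" "c a \<noteq> 0" "\<forall>i<M. cmod (a i - y i) < \<epsilon>"
      using accessibleD[OF acc] by blast
    then obtain w where "w \<in> mzeros P" "\<forall>i<M. w i = a i" using lift by blast
    then show "\<exists>x\<in>mzeros E. \<forall>i<M. cmod (x i - y i) < \<epsilon>"
      using sub a(3) by (intro bexI[of _ w]) auto
  qed
qed


section \<open>Irreducible components\<close>

definition lead_coeffs :: "nat \<Rightarrow> pfun set \<Rightarrow> nat \<Rightarrow> pfun set" where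
  "lead_coeffs n I d = {\<lambda>x. coeff (F x) d | F. F \<in> pfam n (Suc d) \<and> pev n F \<in> I}"

lemma lead_coeffs_ideal:
  assumes I: "mideal (Suc n) I"
  shows "mideal n (lead_coeffs n I d)"
  unfolding mideal_def
proof (intro conjI ballI subsetI)
  fix f assume "f \<in> lead_coeffs n I d"
  then show "f \<in> mpol n" unfolding lead_coeffs_def by (auto intro: pfam_coeff)
next
  have "pev n (\<lambda>x. 0) \<in> I" using mideal_0[OF I] by (simp add: pev_def)
  then show "(\<lambda>x. 0) \<in> lead_coeffs n I d"
    unfolding lead_coeffs_def by (intro CollectI exI[of _ "\<lambda>x. 0"] conjI pfam_0) simp_all
next
  fix f g assume "f \<in> lead_coeffs n I d" "g \<in> lead_coeffs n I d"
  then obtain F G where FG: "F \<in> pfam n (Suc d)" "pev n F \<in> I" "f = (\<lambda>x. coeff (F x) d)"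
    "G \<in> pfam n (Suc d)" "pev n G \<in> I" "g = (\<lambda>x. coeff (G x) d)" unfolding lead_coeffs_def by auto
  have "pev n (\<lambda>x. F x + G x) \<in> I" using mideal_add[OF I FG(2,5)] by (simp add: pev_def)
  then show "(\<lambda>x. f x + g x) \<in> lead_coeffs n I d"
    unfolding lead_coeffs_def using pfam_add[OF FG(1,4)] FG(3,6)
    by (intro CollectI exI[of _ "\<lambda>x. F x + G x"]) simp
next
  fix f g assume f: "f \<in> mpol n" and "g \<in> lead_coeffs n I d"
  then obtain G where G: "G \<in> pfam n (Suc d)" "pev n G \<in> I" "g = (\<lambda>x. coeff (G x) d)"
    unfolding lead_coeffs_def by auto
  have "f \<in> mpol (Suc n)" by (rule mpol_mono[OF f]) simp
  then have "pev n (\<lambda>x. smult (f x) (G x)) \<in> I" using mideal_mult[OF I _ G(2)] by (simp add: pev_def)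
  then show "(\<lambda>x. f x * g x) \<in> lead_coeffs n I d"
    unfolding lead_coeffs_def using pfam_smult[OF f G(1)] G(3)
    by (intro CollectI exI[of _ "\<lambda>x. smult (f x) (G x)"]) simp
qed

lemma lead_coeffs_Suc:
  assumes I: "mideal (Suc n) I"
  shows "lead_coeffs n I d \<subseteq> lead_coeffs n I (Suc d)"
proof
  fix g assume "g \<in> lead_coeffs n I d"
  then obtain G where G: "G \<in> pfam n (Suc d)" "pev n G \<in> I" "g = (\<lambda>x. coeff (G x) d)"
    unfolding lead_coeffs_def by auto
  let ?H = "\<lambda>x. pCons 0 (G x)"
  have "?H \<in> pfam n (Suc (Suc d))"
    unfolding pfam_def
  proof (intro CollectI conjI allI impI)
    show "(\<lambda>x. coeff (pCons 0 (G x)) k) \<in> mpol n" for k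
      by (cases k) (auto intro: mpol_const pfam_coeff[OF G(1)])
    show "coeff (pCons 0 (G x)) k = 0" if "Suc (Suc d) \<le> k" for x k
      using that pfam_high[OF G(1)] by (cases k) auto
  qed
  moreover have "(\<lambda>x. x n * pev n G x) \<in> I" by (rule mideal_mult[OF I mpol_var G(2)]) simp
  then have "pev n ?H \<in> I" by (simp add: pev_def)
  ultimately show "g \<in> lead_coeffs n I (Suc d)"
    unfolding lead_coeffs_def using G(3) by (intro CollectI exI[of _ ?H]) simp
qed

lemma lead_coeffs_mono:
  assumes "mideal (Suc n) I" "d \<le> e"
  shows "lead_coeffs n I d \<subseteq> lead_coeffs n I e"
  using lift_Suc_mono_le[of "lead_coeffs n I", OF lead_coeffs_Suc[OF assms(1)] assms(2)] .

text \<open>Generation is expressed through the ideals that contain \<open>B\<close>, so that linear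
  combinations need not be written down.\<close>

definition finitely_generated :: "nat \<Rightarrow> pfun set \<Rightarrow> bool" where
  "finitely_generated n I \<longleftrightarrow> (\<exists>B\<subseteq>I. finite B \<and> (\<forall>J. mideal n J \<and> B \<subseteq> J \<longrightarrow> I \<subseteq> J))"

lemma mideal_chain_Union:
  assumes "\<And>d. mideal n (K d)" "\<And>d. K d \<subseteq> K (Suc d)"
  shows "mideal n (\<Union>d::nat. K d)"
proof -
  have mono: "K d \<subseteq> K e" if "d \<le> e" for d e
    using lift_Suc_mono_le[of K, OF assms(2) that] .
  show ?thesis
    unfolding mideal_def
  proof (intro conjI ballI subsetI)
    fix f assume "f \<in> (\<Union>d. K d)" then show "f \<in> mpol n" using mideal_sub[OF assms(1)] by blast
  next
    show "(\<lambda>x. 0) \<in> (\<Union>d. K d)" using mideal_0[OF assms(1)] by blast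
  next
    fix f g assume "f \<in> (\<Union>d. K d)" "g \<in> (\<Union>d. K d)"
    then obtain d e where "f \<in> K d" "g \<in> K e" by blast
    then have "f \<in> K (max d e)" "g \<in> K (max d e)" using mono[of d "max d e"] mono[of e "max d e"] by auto
    then have "(\<lambda>x. f x + g x) \<in> K (max d e)" by (rule mideal_add[OF assms(1)])
    then show "(\<lambda>x. f x + g x) \<in> (\<Union>d. K d)" by (rule UN_I[OF UNIV_I])
  next
    fix f g assume "f \<in> mpol n" "g \<in> (\<Union>d. K d)"
    then obtain d where "g \<in> K d" by blast
    then have "(\<lambda>x. f x * g x) \<in> K d" using \<open>f \<in> mpol n\<close> by (intro mideal_mult[OF assms(1)])
    then show "(\<lambda>x. f x * g x) \<in> (\<Union>d. K d)" by (rule UN_I[OF UNIV_I])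
  qed
qed

text \<open>The finitely many generators of the union already lie in one member of the increasing
  sequence.\<close>

lemma finitely_generated_chain:
  assumes "finitely_generated n L" "L = (\<Union>d::nat. K d)" "\<And>d. mideal n (K d)" "\<And>d. K d \<subseteq> K (Suc d)"
  obtains e where "L \<subseteq> K e"
proof -
  have mono: "K d \<subseteq> K e" if "d \<le> e" for d e
    using lift_Suc_mono_le[of K, OF assms(4) that] .
  obtain B where B: "B \<subseteq> L" "finite B" "\<And>J. mideal n J \<Longrightarrow> B \<subseteq> J \<Longrightarrow> L \<subseteq> J"
    using assms(1) unfolding finitely_generated_def by blast
  have "\<exists>e. B \<subseteq> K e"
    using B(2,1) unfolding assms(2)
  proof induction
    case empty
    then show ?case by blast
  next
    case (insert b B)
    then obtain e d where "B \<subseteq> K e" "b \<in> K d" by blast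
    then have "insert b B \<subseteq> K (max d e)" using mono[of d "max d e"] mono[of e "max d e"] by auto
    then show ?case by blast
  qed
  then show ?thesis using that B(3)[OF assms(3)] by blast
qed

text \<open>The ideals of leading coefficients in the last variable increase with the degree and are
  constant from some \<open>e\<close> on, so lifts of their generators for degrees up to
  \<open>e\<close> suffice: the degree of an element of \<open>I\<close> drops on subtracting one
  with the same top coefficient.\<close>

theorem hilbert_basis: "mideal n I \<Longrightarrow> finitely_generated n I"
proof (induction n arbitrary: I)
  case 0
  show ?case
  proof (cases "\<exists>f\<in>I. \<exists>x. f x \<noteq> 0")
    case False
    have "I \<subseteq> J" if "mideal 0 J" for J
    proof
      fix f assume "f \<in> I"
      then have "f = (\<lambda>x. 0)" using False by auto
      then show "f \<in> J" using mideal_0[OF that] by simp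
    qed
    then show ?thesis unfolding finitely_generated_def by (intro exI[of _ "{}"]) auto
  next
    case True
    then obtain f x0 where f: "f \<in> I" "f x0 \<noteq> 0" by blast
    have "I \<subseteq> J" if J: "mideal 0 J" "f \<in> J" for J
    proof
      fix g assume "g \<in> I"
      then have g: "g \<in> mpol 0" using mideal_sub[OF 0] by blast
      have "f x = f x0" for x by (rule mpol_cong[OF mideal_sub[OF 0 f(1)]]) simp
      then have "g x = inverse (f x0) * g x * f x" for x
        using f(2) by (metis divide_inverse_commute mult.assoc mult.commute nonzero_mult_div_cancel_left)
      then have "g = (\<lambda>x. inverse (f x0) * g x * f x)" by (rule ext)
      then show "g \<in> J" using mideal_mult[OF J(1) mpol_cmult[OF g] J(2), of "inverse (f x0)"] by simp
    qed
    then show ?thesis unfolding finitely_generated_def using f(1) by (intro exI[of _ "{f}"]) auto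
  qed
next
  case (Suc n)
  note I = Suc.prems
  let ?L = "lead_coeffs n I"
  obtain e where e: "(\<Union>d. ?L d) \<subseteq> ?L e"
    by (rule finitely_generated_chain[OF Suc.IH[OF mideal_chain_Union[of n ?L]] refl])
      (rule lead_coeffs_ideal[OF I] lead_coeffs_Suc[OF I] | assumption)+
  have "\<exists>C\<subseteq>I. finite C \<and> (\<forall>J. mideal (Suc n) J \<and> C \<subseteq> J \<longrightarrow> ?L d \<subseteq> lead_coeffs n J d)" for d
  proof -
    obtain B where B: "B \<subseteq> ?L d" "finite B" "\<And>J. mideal n J \<Longrightarrow> B \<subseteq> J \<Longrightarrow> ?L d \<subseteq> J"
      using Suc.IH[OF lead_coeffs_ideal[OF I, where d = d]] unfolding finitely_generated_def by blast
    have "\<forall>b\<in>B. \<exists>F. F \<in> pfam n (Suc d) \<and> pev n F \<in> I \<and> b = (\<lambda>x. coeff (F x) d)"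
      using B(1) unfolding lead_coeffs_def by blast
    then obtain F where F: "\<And>b. b \<in> B \<Longrightarrow> F b \<in> pfam n (Suc d) \<and> pev n (F b) \<in> I \<and> b = (\<lambda>x. coeff (F b x) d)"
      by (metis (lifting) bchoice)
    have "?L d \<subseteq> lead_coeffs n J d" if J: "mideal (Suc n) J" "(\<lambda>b. pev n (F b)) ` B \<subseteq> J" for J
    proof (rule B(3)[OF lead_coeffs_ideal[OF J(1)]], rule subsetI)
      fix b assume "b \<in> B"
      then show "b \<in> lead_coeffs n J d" using F[of b] J(2) unfolding lead_coeffs_def by blast
    qed
    then show ?thesis using F B(2) by (intro exI[of _ "(\<lambda>b. pev n (F b)) ` B"]) auto
  qed
  then obtain C where C: "\<And>d. C d \<subseteq> I" "\<And>d. finite (C d)"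
    "\<And>d J. mideal (Suc n) J \<Longrightarrow> C d \<subseteq> J \<Longrightarrow> ?L d \<subseteq> lead_coeffs n J d"
    by metis
  let ?C = "\<Union>d\<le>e. C d"
  have "I \<subseteq> J" if J: "mideal (Suc n) J" "?C \<subseteq> J" for J
  proof -
    \<comment> \<open>Subtracting an element of \<open>I \<inter> J\<close>, not just of
      \<open>J\<close>, keeps the difference in \<open>I\<close>, where the induction on the degree
      applies again.\<close>
    have J': "mideal (Suc n) (I \<inter> J)"
      using I J(1) unfolding mideal_def by blast
    have L: "?L d \<subseteq> lead_coeffs n (I \<inter> J) d" for d
    proof (cases "d \<le> e")
      case True
      then show ?thesis using C(1)[of d] C(3)[OF J', of d] J(2) by blast
    next
      case False
      have "?L d \<subseteq> ?L e" using e by blast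
      also have "\<dots> \<subseteq> lead_coeffs n (I \<inter> J) e" using C(1)[of e] C(3)[OF J', of e] J(2) by blast
      also have "\<dots> \<subseteq> lead_coeffs n (I \<inter> J) d" using False by (intro lead_coeffs_mono[OF J']) simp
      finally show ?thesis .
    qed
    have main: "F \<in> pfam n D \<Longrightarrow> pev n F \<in> I \<Longrightarrow> pev n F \<in> J" for F D
    proof (induction D arbitrary: F)
      case 0
      then have "F x = 0" for x using pfam_high[OF 0(1)] by (simp add: poly_eq_iff)
      then show ?case using mideal_0[OF J(1)] by (simp add: pev_def)
    next
      case (Suc D)
      have "(\<lambda>x. coeff (F x) D) \<in> ?L D" using Suc.prems unfolding lead_coeffs_def by blast
      then have "(\<lambda>x. coeff (F x) D) \<in> lead_coeffs n (I \<inter> J) D" using L by blast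
      then obtain G where G: "G \<in> pfam n (Suc D)" "pev n G \<in> I \<inter> J"
        "(\<lambda>x. coeff (F x) D) = (\<lambda>x. coeff (G x) D)" unfolding lead_coeffs_def by blast
      have "coeff (F x - G x) k = 0" if "D \<le> k" for x k
        using that fun_cong[OF G(3), of x] pfam_high[OF G(1)] pfam_high[OF Suc.prems(1)]
        by (cases "k = D") auto
      then have H: "(\<lambda>x. F x - G x) \<in> pfam n D"
        using pfam_diff[OF Suc.prems(1) G(1)] unfolding pfam_def by blast
      have "(\<lambda>x. pev n F x - pev n G x) \<in> I" using mideal_diff[OF I Suc.prems(2)] G(2) by blast
      then have "pev n (\<lambda>x. F x - G x) \<in> J" using Suc.IH[OF H] by (simp add: pev_def)
      then have "(\<lambda>x. pev n (\<lambda>x. F x - G x) x + pev n G x) \<in> J" using G(2) mideal_add[OF J(1)] by blast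
      then show ?case by (simp add: pev_def)
    qed
    show ?thesis
    proof
      fix f assume f: "f \<in> I"
      then obtain D F where "F \<in> pfam n D" "f = pev n F" using mpol_Suc_pfam[OF mideal_sub[OF I]] by blast
      then show "f \<in> J" using main f by blast
    qed
  qed
  then show ?case unfolding finitely_generated_def using C(1,2)
    by (intro exI[of _ ?C]) auto
qed

section \<open>Vectors, their coordinates and polynomial functions\<close>

definition coord_index :: "'n::finite \<Rightarrow> nat" where
  "coord_index = (SOME f. bij_betw f UNIV {..<CARD('n)})"

lemma coord_index_bij: "bij_betw (coord_index :: 'n::finite \<Rightarrow> nat) UNIV {..<CARD('n)}"
proof -
  have "\<exists>f::'n \<Rightarrow> nat. bij_betw f UNIV {..<CARD('n)}"
    using ex_bij_betw_finite_nat[of "UNIV :: 'n set"] by (simp add: atLeast0LessThan)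
  then show ?thesis unfolding coord_index_def by (rule someI_ex)
qed

lemma coord_index_less: "coord_index (i :: 'n::finite) < CARD('n)"
  using bij_betwE[OF coord_index_bij] by auto

definition coord_of :: "nat \<Rightarrow> 'n::finite" where
  "coord_of = inv_into UNIV coord_index"

lemma coord_of_index [simp]: "coord_of (coord_index i) = i"
  unfolding coord_of_def using bij_betw_inv_into_left[OF coord_index_bij] by simp

lemma cpoly_eval_mpol:
  assumes "\<And>i. \<phi> i < m"
  shows "(\<lambda>w. cpoly_eval p (\<chi> i. w (\<phi> i))) \<in> mpol m"
proof -
  have "(\<lambda>w. \<Prod>i\<in>A. w (\<phi> i) ^ k i) \<in> mpol m" for A and k :: "'a \<Rightarrow> nat"
  proof (induction A rule: infinite_finite_induct)
    case (insert x F)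
    then show ?case by (simp add: mpol_mult[OF mpol_power[OF mpol_var[OF assms]]])
  qed (auto intro: mpol_const)
  then show ?thesis
    unfolding cpoly_eval_def monom_eval_def by (auto intro!: mpol_sum mpol_cmult)
qed

lemma cpoly_eval_const: "cpoly_eval (Poly_Mapping.single 0 c) x = c"
  by (simp add: monom_eval_def)

lemma cpoly_eval_var: "cpoly_eval (Poly_Mapping.single (Poly_Mapping.single i 1) 1) x = x $ i"
proof -
  have "monom_eval (Poly_Mapping.single i 1) x = (\<Prod>j\<in>UNIV. if j = i then x $ i else 1)"
    unfolding monom_eval_def by (intro prod.cong) (auto simp: lookup_single when_def)
  then show ?thesis by (simp add: prod.delta)
qed

lemma mpol_cpoly_eval:
  assumes "f \<in> mpol m" "\<And>i. i < m \<Longrightarrow> \<exists>p. \<forall>x. g i x = cpoly_eval p x"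
  shows "\<exists>p. \<forall>x. f (\<lambda>i. g i x) = cpoly_eval p x"
  using assms(1)
proof induction
  case (mpol_const c)
  show ?case by (rule exI[of _ "Poly_Mapping.single 0 c"]) (intro allI cpoly_eval_const[symmetric])
next
  case (mpol_var i)
  then show ?case by (rule assms(2))
next
  case (mpol_add f g)
  then show ?case by (metis cpoly_eval_add)
next
  case (mpol_mult f g)
  then show ?case by (metis cpoly_eval_mult)
qed

text \<open>From index \<open>CARD('n)\<close> on it is unspecified which coordinate is taken;
  polynomials in \<open>CARD('n)\<close> variables do not see this.\<close>

definition coords :: "complex ^ 'n::finite \<Rightarrow> nat \<Rightarrow> complex" where
  "coords x k = x $ coord_of k"

lemma mpol_coords:
  fixes f :: "point \<Rightarrow> complex"
  assumes "f \<in> mpol m"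
  shows "\<exists>p. \<forall>x :: complex ^ 'n::finite. f (coords x) = cpoly_eval p x"
proof -
  have "\<exists>p. \<forall>x :: complex ^ 'n. f (\<lambda>i. coords x i) = cpoly_eval p x"
    by (rule mpol_cpoly_eval[OF assms]) (metis coords_def cpoly_eval_var)
  then show ?thesis by simp
qed

lemma cpoly_eval_coords:
  fixes p :: "'n::finite cpoly"
  obtains f where "f \<in> mpol (CARD('n))" "\<And>x. cpoly_eval p x = f (coords x)"
proof (rule that)
  show "(\<lambda>w. cpoly_eval p (\<chi> i. w (coord_index i))) \<in> mpol (CARD('n))"
    by (rule cpoly_eval_mpol[OF coord_index_less])
  show "cpoly_eval p x = cpoly_eval p (\<chi> i. coords x (coord_index i))" for x
    by (simp add: coords_def)
qed

text \<open>The vanishing ideals form an increasing chain, which becomes stationary, and a variety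
  is determined by its vanishing ideal.\<close>

lemma affine_variety_chain:
  fixes X :: "nat \<Rightarrow> (complex ^ 'n::finite) set"
  assumes X: "\<And>k. affine_variety (X k)" and "\<And>k. X (Suc k) \<subseteq> X k"
  shows "\<exists>k. X (Suc k) = X k"
proof -
  define K where "K k = {f \<in> mpol (CARD('n)). \<forall>x\<in>X k. f (coords x) = 0}" for k
  have K: "mideal (CARD('n)) (K k)" for k
    unfolding K_def mideal_def by (auto intro: mpol.intros)
  have mono: "K k \<subseteq> K (Suc k)" for k unfolding K_def using assms(2)[of k] by blast
  obtain e where e: "(\<Union>d. K d) \<subseteq> K e"
    by (rule finitely_generated_chain[OF hilbert_basis[OF mideal_chain_Union[of "CARD('n)" K]] refl])
      (rule K mono | assumption)+
  have "X e \<subseteq> X (Suc e)"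
  proof
    fix x assume x: "x \<in> X e"
    obtain P where P: "X (Suc e) = {x. \<forall>p\<in>P. cpoly_eval p x = 0}"
      using X[of "Suc e"] unfolding affine_variety_def by blast
    have "cpoly_eval p x = 0" if "p \<in> P" for p
    proof -
      obtain f where f: "f \<in> mpol (CARD('n))" "\<And>x. cpoly_eval p x = f (coords x)"
        using cpoly_eval_coords by blast
      have "f \<in> K (Suc e)" unfolding K_def P using f(1) that by (auto simp: f(2)[symmetric])
      then have "f \<in> K e" using e by blast
      then show ?thesis unfolding K_def using f x by simp
    qed
    then show "x \<in> X (Suc e)" unfolding P by blast
  qed
  then show ?thesis using assms(2) by blast
qed

lemma affine_variety_wf: "wf {(Y, X :: (complex ^ 'n::finite) set). affine_variety Y \<and> affine_variety X \<and> Y \<subset> X}"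
  unfolding wf_iff_no_infinite_down_chain
proof
  assume "\<exists>f :: nat \<Rightarrow> (complex ^ 'n) set. \<forall>i. (f (Suc i), f i) \<in>
     {(Y, X). affine_variety Y \<and> affine_variety X \<and> Y \<subset> X}"
  then obtain f :: "nat \<Rightarrow> (complex ^ 'n) set" where "\<forall>i. (f (Suc i), f i) \<in>
     {(Y, X). affine_variety Y \<and> affine_variety X \<and> Y \<subset> X}" ..
  then have f: "affine_variety (f i)" "f (Suc i) \<subset> f i" for i by auto
  then show False using affine_variety_chain[of f] by blast
qed

section \<open>Decomposition into irreducible varieties\<close>

lemma affine_variety_Int: "affine_variety X \<Longrightarrow> affine_variety Y \<Longrightarrow> affine_variety (X \<inter> Y)"
  using affine_variety_Inter[of "{X, Y}"] by auto

lemma affine_variety_empty: "affine_variety {}"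
  using closedin_zariski closedin_empty by blast

lemma affine_variety_Union: "finite \<C> \<Longrightarrow> (\<And>C. C \<in> \<C> \<Longrightarrow> affine_variety C) \<Longrightarrow> affine_variety (\<Union>\<C>)"
  by (induction rule: finite_induct) (auto intro: affine_variety_empty affine_variety_Un)

lemma irreducible_zariski:
  "irreducible_in zariski S \<longleftrightarrow> S \<noteq> {} \<and>
     (\<forall>A B. affine_variety A \<longrightarrow> affine_variety B \<longrightarrow> S \<subseteq> A \<union> B \<longrightarrow> S \<subseteq> A \<or> S \<subseteq> B)"
  unfolding irreducible_in_def closedin_zariski by auto

lemma irreducible_decomposition:
  assumes "affine_variety (X :: (complex ^ 'n::finite) set)"
  shows "\<exists>\<C>. finite \<C> \<and> X = \<Union>\<C> \<and> (\<forall>C\<in>\<C>. affine_variety C \<and> irreducible_in zariski C)"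
  using assms
proof (induction X rule: wf_induct_rule[OF affine_variety_wf])
  case (1 X)
  show ?case
  proof (cases "X = {} \<or> irreducible_in zariski X")
    case True
    then show ?thesis
    proof
      assume "X = {}"
      then show ?thesis by (intro exI[of _ "{}"]) auto
    next
      assume "irreducible_in zariski X"
      then show ?thesis using 1(2) by (intro exI[of _ "{X}"]) auto
    qed
  next
    case False
    then obtain A B where AB: "affine_variety A" "affine_variety B" "X \<subseteq> A \<union> B" "\<not> X \<subseteq> A" "\<not> X \<subseteq> B"
      unfolding irreducible_zariski by blast
    have 2: "affine_variety (X \<inter> A)" "affine_variety (X \<inter> B)"
      using AB 1(2) by (auto intro: affine_variety_Int)
    obtain \<C> where \<C>: "finite \<C>" "X \<inter> A = \<Union>\<C>" "\<forall>C\<in>\<C>. affine_variety C \<and> irreducible_in zariski C"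
      using 1(1)[of "X \<inter> A"] 2 1(2) AB by blast
    obtain \<D> where \<D>: "finite \<D>" "X \<inter> B = \<Union>\<D>" "\<forall>C\<in>\<D>. affine_variety C \<and> irreducible_in zariski C"
      using 1(1)[of "X \<inter> B"] 2 1(2) AB by blast
    have "X = (X \<inter> A) \<union> (X \<inter> B)" using AB(3) by blast
    then have "X = \<Union>(\<C> \<union> \<D>)" using \<C>(2) \<D>(2) by simp
    then show ?thesis using \<C> \<D> by (intro exI[of _ "\<C> \<union> \<D>"]) blast
  qed
qed

lemma irreducible_subset_Union:
  assumes "irreducible_in zariski S" "finite \<C>" "\<And>C. C \<in> \<C> \<Longrightarrow> affine_variety C" "S \<subseteq> \<Union>\<C>"
  shows "\<exists>C\<in>\<C>. S \<subseteq> C"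
  using assms(2-4)
proof (induction rule: finite_induct)
  case empty
  then show ?case using assms(1) unfolding irreducible_zariski by auto
next
  case (insert C \<C>)
  have "S \<subseteq> C \<or> S \<subseteq> \<Union>\<C>"
    using assms(1) insert.prems affine_variety_Union[OF insert.hyps(1)] unfolding irreducible_zariski by auto
  then show ?case using insert by auto
qed

lemma irreducible_in_subtopology:
  "irreducible_in (subtopology zariski X) S \<longleftrightarrow> S \<subseteq> X \<and> irreducible_in zariski S"
proof
  assume L: "irreducible_in (subtopology zariski X) S"
  then have S: "S \<subseteq> X" "S \<noteq> {}" unfolding irreducible_in_def by auto
  have "S \<subseteq> A \<or> S \<subseteq> B" if AB: "affine_variety A" "affine_variety B" "S \<subseteq> A \<union> B" for A B
  proof -
    have "closedin (subtopology zariski X) (A \<inter> X)" "closedin (subtopology zariski X) (B \<inter> X)"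
      using AB unfolding closedin_subtopology closedin_zariski by auto
    then have "S \<subseteq> A \<inter> X \<or> S \<subseteq> B \<inter> X"
      using L AB(3) S unfolding irreducible_in_def by blast
    then show ?thesis by blast
  qed
  then show "S \<subseteq> X \<and> irreducible_in zariski S" using S unfolding irreducible_zariski by blast
next
  assume R: "S \<subseteq> X \<and> irreducible_in zariski S"
  have "S \<subseteq> A \<or> S \<subseteq> B" if AB: "closedin (subtopology zariski X) A" "closedin (subtopology zariski X) B"
    "S \<subseteq> A \<union> B" for A B
  proof -
    obtain A' B' where "affine_variety A'" "A = A' \<inter> X" "affine_variety B'" "B = B' \<inter> X"
      using AB(1,2) unfolding closedin_subtopology closedin_zariski by blast
    then show ?thesis using R AB(3) unfolding irreducible_zariski by blast
  qed
  then show "irreducible_in (subtopology zariski X) S"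
    using R unfolding irreducible_in_def irreducible_zariski by auto
qed

lemma component_zariski:
  "irreducible_component (subtopology zariski X) S \<longleftrightarrow> S \<subseteq> X \<and> irreducible_in zariski S \<and>
     (\<forall>S'. S' \<subseteq> X \<longrightarrow> irreducible_in zariski S' \<longrightarrow> S \<subseteq> S' \<longrightarrow> S' = S)"
  unfolding irreducible_component_def irreducible_in_subtopology by blast

text \<open>A component must occur in any finite irreducible decomposition, and \<open>Z\<close> is
  the union of the other members. Points of \<open>S - Z\<close> lie on no other component; they are
  the generic points used later.\<close>

lemma component_complement:
  assumes X: "affine_variety X" and S: "irreducible_component (subtopology zariski X) S"
  obtains Z where "affine_variety S" "affine_variety Z" "X = S \<union> Z" "\<not> S \<subseteq> Z"
proof -
  obtain \<C> where \<C>: "finite \<C>" "X = \<Union>\<C>" "\<And>C. C \<in> \<C> \<Longrightarrow> affine_variety C \<and> irreducible_in zariski C"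
    using irreducible_decomposition[OF X] by blast
  have S': "S \<subseteq> X" "irreducible_in zariski S" "\<And>C. C \<in> \<C> \<Longrightarrow> S \<subseteq> C \<Longrightarrow> C = S"
    using S \<C>(2,3) unfolding component_zariski by blast+
  have "\<exists>C\<in>\<C>. S \<subseteq> C"
    by (rule irreducible_subset_Union[OF S'(2) \<C>(1)]) (use \<C> S' in auto)
  then have "S \<in> \<C>" using S'(3) by blast
  let ?Z = "\<Union>(\<C> - {S})"
  have "\<not> S \<subseteq> ?Z"
  proof
    assume "S \<subseteq> ?Z"
    then have "\<exists>C\<in>\<C> - {S}. S \<subseteq> C"
      by (intro irreducible_subset_Union[OF S'(2)]) (use \<C> in auto)
    then show False using S'(3) by blast
  qed
  moreover have "affine_variety ?Z" by (rule affine_variety_Union) (use \<C> in auto)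
  moreover have "X = S \<union> ?Z" using \<C>(2) \<open>S \<in> \<C>\<close> by blast
  ultimately show ?thesis using that \<C>(3)[OF \<open>S \<in> \<C>\<close>] by blast
qed

lemma component_exists:
  assumes X: "affine_variety X" and "x \<in> X"
  obtains S where "irreducible_component (subtopology zariski X) S" "x \<in> S"
proof -
  obtain \<C> where \<C>: "finite \<C>" "X = \<Union>\<C>" "\<And>C. C \<in> \<C> \<Longrightarrow> affine_variety C \<and> irreducible_in zariski C"
    using irreducible_decomposition[OF X] by blast
  have "finite {C \<in> \<C>. x \<in> C}" "{C \<in> \<C>. x \<in> C} \<noteq> {}" using \<C> \<open>x \<in> X\<close> by auto
  from finite_has_maximal[OF this] obtain S where S: "S \<in> \<C>" "x \<in> S"
    and max: "\<And>C. C \<in> \<C> \<Longrightarrow> x \<in> C \<Longrightarrow> S \<subseteq> C \<Longrightarrow> S = C" by blast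
  have "S' = S" if S': "S' \<subseteq> X" "irreducible_in zariski S'" "S \<subseteq> S'" for S'
  proof -
    obtain C where "C \<in> \<C>" "S' \<subseteq> C"
      using irreducible_subset_Union[OF S'(2) \<C>(1)] \<C>(2,3) S'(1) by blast
    then show ?thesis using max[of C] S S' by blast
  qed
  then have "irreducible_component (subtopology zariski X) S"
    unfolding component_zariski using S \<C> by blast
  then show ?thesis using that S by blast
qed

text \<open>The graph of \<open>g\<close> over the points with \<open>h \<noteq> 0\<close> becomes
  closed through an extra coordinate for \<open>1 / h\<close>, and
  \<open>accessible_projection\<close> applies to its first \<open>M\<close> coordinates. The
  hypothesis on \<open>y\<close> places it in the Zariski closure of the image. The form of
  \<open>g\<close> covers polynomial maps as well as \<open>1 / x\<^sub>i\<close>.\<close>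

theorem zariski_closure_limit:
  fixes X :: "(complex ^ 'n::finite) set" and g :: "nat \<Rightarrow> complex ^ 'n \<Rightarrow> complex"
  assumes X: "affine_variety X"
    and g: "\<And>i. i < M \<Longrightarrow> \<exists>p q. \<forall>x. cpoly_eval h x \<noteq> 0 \<longrightarrow> g i x = cpoly_eval p x + cpoly_eval q x / cpoly_eval h x"
    and y: "\<And>f. f \<in> mpol M \<Longrightarrow> (\<And>x. x \<in> X \<Longrightarrow> cpoly_eval h x \<noteq> 0 \<Longrightarrow> f (\<lambda>i. g i x) = 0) \<Longrightarrow> f y = 0"
  shows "\<exists>u. (\<forall>k :: nat. u k \<in> X \<and> cpoly_eval h (u k) \<noteq> 0) \<and> (\<forall>i<M. (\<lambda>k. g i (u k)) \<longlonglongrightarrow> y i)"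
proof -
  obtain P where P: "X = {x. \<forall>p\<in>P. cpoly_eval p x = 0}"
    using X unfolding affine_variety_def by blast
  obtain p q where pq: "\<And>i x. i < M \<Longrightarrow> cpoly_eval h x \<noteq> 0 \<Longrightarrow>
      g i x = cpoly_eval (p i) x + cpoly_eval (q i) x / cpoly_eval h x"
    using g by metis
  \<comment> \<open>Coordinates below \<open>M\<close> hold the values of \<open>g\<close>, the next
    \<open>CARD('n)\<close> hold the point \<open>x\<close>, and the one with index
    \<open>?s\<close> holds \<open>1 / h\<close>.\<close>
  let ?s = "M + CARD('n)"
  define X' :: "point \<Rightarrow> complex ^ 'n" where "X' w = (\<chi> i. w (M + coord_index i))" for w
  define E where "E = (\<lambda>r w. cpoly_eval r (X' w)) ` P \<union> {\<lambda>w. w ?s * cpoly_eval h (X' w) - 1} \<union>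
    (\<lambda>i w. w i - (cpoly_eval (p i) (X' w) + cpoly_eval (q i) (X' w) * w ?s)) ` {..<M}"
  have mem: "w \<in> mzeros E \<longleftrightarrow> X' w \<in> X \<and> cpoly_eval h (X' w) \<noteq> 0 \<and> w ?s = 1 / cpoly_eval h (X' w) \<and>
      (\<forall>i<M. w i = g i (X' w))" for w
  proof -
    have "w \<in> mzeros E \<longleftrightarrow> X' w \<in> X \<and> w ?s * cpoly_eval h (X' w) = 1 \<and>
      (\<forall>i<M. w i = cpoly_eval (p i) (X' w) + cpoly_eval (q i) (X' w) * w ?s)"
      unfolding E_def mzeros_def P by (auto simp: ball_Un)
    also have "\<dots> \<longleftrightarrow> X' w \<in> X \<and> cpoly_eval h (X' w) \<noteq> 0 \<and> w ?s = 1 / cpoly_eval h (X' w) \<and>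
      (\<forall>i<M. w i = g i (X' w))"
    proof (cases "cpoly_eval h (X' w) = 0")
      case False
      then have "w ?s * cpoly_eval h (X' w) = 1 \<longleftrightarrow> w ?s = 1 / cpoly_eval h (X' w)"
        by (simp add: field_simps)
      then show ?thesis using False pq[OF _ False] by auto
    qed auto
    finally show ?thesis .
  qed
  have X'm: "(\<lambda>w. cpoly_eval r (X' w)) \<in> mpol (Suc ?s)" for r
    unfolding X'_def by (rule cpoly_eval_mpol) (simp add: coord_index_less less_SucI)
  have "E \<subseteq> mpol (Suc ?s)"
    unfolding E_def by (auto intro!: X'm mpol_diff mpol_mult mpol_add mpol_const mpol_var)
  moreover have "f y = 0" if f: "f \<in> mpol M" "\<And>w. w \<in> mzeros E \<Longrightarrow> f w = 0" for f
  proof (rule y[OF f(1)])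
    fix x assume x: "x \<in> X" "cpoly_eval h x \<noteq> 0"
    let ?w = "\<lambda>k. if k < M then g k x else if k < ?s then x $ coord_of (k - M) else 1 / cpoly_eval h x"
    have "X' ?w = x" unfolding X'_def by (simp add: vec_eq_iff coord_index_less)
    then have "?w \<in> mzeros E" unfolding mem using x by simp
    then have "f ?w = 0" by (rule f(2))
    moreover have "f ?w = f (\<lambda>i. g i x)" by (rule mpol_cong[OF f(1)]) simp
    ultimately show "f (\<lambda>i. g i x) = 0" by simp
  qed
  ultimately have "accessible M (mzeros E) y"
    by (intro accessible_projection[of E "Suc ?s"]) auto
  then obtain w where w: "\<And>k. w k \<in> mzeros E" "\<And>i. i < M \<Longrightarrow> (\<lambda>k. w k i) \<longlonglongrightarrow> y i"
    unfolding accessible_def by blast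
  have "g i (X' (w k)) = w k i" if "i < M" for i k using w(1)[of k] that unfolding mem by simp
  then show ?thesis using w unfolding mem by (intro exI[of _ "\<lambda>k. X' (w k)"]) simp
qed

lemma coords_tendsto:
  fixes u :: "nat \<Rightarrow> complex ^ 'n::finite"
  assumes "\<And>i. i < CARD('n) \<Longrightarrow> (\<lambda>k. coords (u k) i) \<longlonglongrightarrow> coords x i"
  shows "u \<longlonglongrightarrow> x"
proof (rule vec_tendstoI)
  fix i show "(\<lambda>k. u k $ i) \<longlonglongrightarrow> x $ i"
    using assms[OF coord_index_less[of i]] by (simp add: coords_def)
qed

text \<open>One polynomial \<open>h\<close> that vanishes on \<open>Z\<close> but not on all of
  \<open>V\<close> suffices. By irreducibility a polynomial that vanishes wherever
  \<open>h \<noteq> 0\<close> on \<open>V\<close> vanishes on \<open>V\<close>, so \<open>x\<close>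
  is in the Zariski closure of that part.\<close>

lemma irreducible_open_dense:
  fixes V :: "(complex ^ 'n::finite) set"
  assumes V: "affine_variety V" "irreducible_in zariski V" and Z: "affine_variety Z" "\<not> V \<subseteq> Z" and x: "x \<in> V"
  shows "\<exists>u. (\<forall>k :: nat. u k \<in> V - Z) \<and> u \<longlonglongrightarrow> x"
proof -
  obtain P where P: "Z = {x. \<forall>p\<in>P. cpoly_eval p x = 0}"
    using Z(1) unfolding affine_variety_def by blast
  obtain h v where h: "h \<in> P" "v \<in> V" "cpoly_eval h v \<noteq> 0" using Z(2) P by blast
  have single: "affine_variety {x. cpoly_eval r x = 0}" for r :: "'n cpoly"
    unfolding affine_variety_def by (rule exI[of _ "{r}"]) auto
  have "\<exists>u. (\<forall>k :: nat. u k \<in> V \<and> cpoly_eval h (u k) \<noteq> 0) \<and>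
      (\<forall>i<CARD('n). (\<lambda>k. coords (u k) i) \<longlonglongrightarrow> coords x i)"
  proof (rule zariski_closure_limit[OF V(1)])
    fix i
    have "coords x i = cpoly_eval (Poly_Mapping.single (Poly_Mapping.single (coord_of i) 1) 1) x +
        cpoly_eval 0 x / cpoly_eval h x" for x :: "complex ^ 'n"
      unfolding cpoly_eval_var by (simp add: coords_def)
    then show "\<exists>p q. \<forall>x. cpoly_eval h x \<noteq> 0 \<longrightarrow> coords x i = cpoly_eval p x + cpoly_eval q x / cpoly_eval h x"
      by blast
  next
    fix f :: "point \<Rightarrow> complex"
    assume f: "f \<in> mpol (CARD('n))" "\<And>x. x \<in> V \<Longrightarrow> cpoly_eval h x \<noteq> 0 \<Longrightarrow> f (\<lambda>i. coords x i) = 0"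
    obtain r where r: "\<And>x :: complex ^ 'n. f (coords x) = cpoly_eval r x" using mpol_coords[OF f(1)] by blast
    have "V \<subseteq> {x. cpoly_eval r x = 0} \<union> {x. cpoly_eval h x = 0}" using f(2) r by auto
    then have "V \<subseteq> {x. cpoly_eval r x = 0} \<or> V \<subseteq> {x. cpoly_eval h x = 0}"
      using V(2) single unfolding irreducible_zariski by blast
    then have "V \<subseteq> {x. cpoly_eval r x = 0}" using h by blast
    then show "f (coords x) = 0" using x r by auto
  qed
  then obtain u where u: "\<And>k. u k \<in> V" "\<And>k. cpoly_eval h (u k) \<noteq> 0"
    "\<And>i. i < CARD('n) \<Longrightarrow> (\<lambda>k. coords (u k) i) \<longlonglongrightarrow> coords x i" by blast
  then show ?thesis using h(1) P by (intro exI[of _ u] conjI coords_tendsto) auto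
qed


section \<open>The non-properness set is Zariski closed\<close>

lemma cpoly_eval_tendsto:
  assumes "(u \<longlongrightarrow> x) F"
  shows "((\<lambda>k. cpoly_eval p (u k)) \<longlongrightarrow> cpoly_eval p x) F"
  unfolding cpoly_eval_def monom_eval_def by (intro tendsto_intros assms)

lemma polymap_tendsto:
  assumes "(u \<longlongrightarrow> x) F"
  shows "((\<lambda>k. polymap f (u k)) \<longlongrightarrow> polymap f x) F"
  by (rule vec_tendstoI) (simp add: polymap_def cpoly_eval_tendsto[OF assms])

lemma polymap_continuous: "continuous_on S (polymap f)"
  unfolding continuous_on_def by (intro ballI polymap_tendsto tendsto_ident_at)

lemma affine_variety_closed:
  assumes "affine_variety X"
  shows "closed X"
  unfolding closed_sequential_limits
proof (intro allI impI)
  fix u x assume u: "(\<forall>n. u n \<in> X) \<and> u \<longlonglongrightarrow> x"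
  obtain P where P: "X = {x. \<forall>p\<in>P. cpoly_eval p x = 0}"
    using assms unfolding affine_variety_def by blast
  have "cpoly_eval p x = 0" if "p \<in> P" for p
  proof -
    have "(\<lambda>n. cpoly_eval p (u n)) \<longlonglongrightarrow> cpoly_eval p x" using u by (intro cpoly_eval_tendsto) simp
    moreover have "cpoly_eval p (u n) = 0" for n using u that unfolding P by simp
    ultimately show ?thesis by (simp add: LIMSEQ_const_iff)
  qed
  then show "x \<in> X" unfolding P by simp
qed

lemma affine_variety_singleton: "affine_variety {c :: complex ^ 'n::finite}"
proof -
  have "monom_eval (Poly_Mapping.single i (Suc 0)) x = x $ i" for i and x :: "complex ^ 'n"
    using cpoly_eval_var[of i x] by simp
  then have "{c} = {x. \<forall>p\<in>range (\<lambda>i. Poly_Mapping.single (Poly_Mapping.single i 1) 1 + Poly_Mapping.single 0 (- (c $ i))).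
      cpoly_eval p x = 0}"
    by (auto simp: cpoly_eval_const[unfolded cpoly_eval_single] vec_eq_iff)
  then show ?thesis unfolding affine_variety_def by blast
qed

lemma affine_variety_finite: "finite A \<Longrightarrow> affine_variety (A :: (complex ^ 'n::finite) set)"
  using affine_variety_Union[of "(\<lambda>c. {c}) ` A"] affine_variety_singleton by auto

text \<open>Closed bounded sets being compact, properness near \<open>y\<close> amounts to
  boundedness of the part of \<open>X\<close> that is mapped into some ball around
  \<open>y\<close>.\<close>

lemma nonproper_set_iff:
  fixes f :: "'a::heine_borel \<Rightarrow> 'b::heine_borel" and a :: 'a
  assumes X: "closed X" and f: "continuous_on UNIV f"
  shows "y \<in> nonproper_set X f \<longleftrightarrow> (\<forall>\<epsilon>>0. \<forall>R. \<exists>x\<in>X. dist a x > R \<and> dist y (f x) < \<epsilon>)"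
proof -
  have "proper_at X f y \<longleftrightarrow> (\<exists>\<epsilon>>0. \<exists>R. \<forall>x\<in>X. dist y (f x) < \<epsilon> \<longrightarrow> dist a x \<le> R)"
  proof
    assume "proper_at X f y"
    then obtain U where U: "open U" "y \<in> U" "proper_map (top_of_set (X \<inter> f -` U)) (top_of_set U) f"
      unfolding proper_at_def by blast
    obtain \<epsilon> where \<epsilon>: "\<epsilon> > 0" "cball y \<epsilon> \<subseteq> U" using U(1,2) open_contains_cball by blast
    have "compactin (top_of_set U) (cball y \<epsilon>)" using \<epsilon>(2) by (simp add: compactin_subtopology)
    from compactin_proper_map_preimage[OF U(3) this]
    have "compact {x \<in> X \<inter> f -` U. f x \<in> cball y \<epsilon>}" by (simp add: compactin_subtopology)
    also have "{x \<in> X \<inter> f -` U. f x \<in> cball y \<epsilon>} = X \<inter> f -` cball y \<epsilon>" using \<epsilon>(2) by auto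
    finally have "bounded (X \<inter> f -` cball y \<epsilon>)" by (rule compact_imp_bounded)
    then obtain R where "\<forall>x\<in>X \<inter> f -` cball y \<epsilon>. dist a x \<le> R" using bounded_any_center by blast
    then have "\<forall>x\<in>X. dist y (f x) < \<epsilon> \<longrightarrow> dist a x \<le> R" by auto
    then show "\<exists>\<epsilon>>0. \<exists>R. \<forall>x\<in>X. dist y (f x) < \<epsilon> \<longrightarrow> dist a x \<le> R" using \<epsilon>(1) by blast
  next
    assume "\<exists>\<epsilon>>0. \<exists>R. \<forall>x\<in>X. dist y (f x) < \<epsilon> \<longrightarrow> dist a x \<le> R"
    then obtain \<epsilon> R where R: "\<epsilon> > 0" "\<forall>x\<in>X. dist y (f x) < \<epsilon> \<longrightarrow> dist a x \<le> R" by blast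
    let ?U = "ball y \<epsilon>" and ?S = "X \<inter> f -` ball y \<epsilon>"
    have cpt: "compact (?S \<inter> f -` K)" if K: "K \<subseteq> ?U" "compact K" for K
    proof -
      have eq: "?S \<inter> f -` K = X \<inter> f -` K" using K(1) by auto
      have "closed (f -` K)" using f K(2) by (simp add: closed_vimage compact_imp_closed)
      then have "closed (X \<inter> f -` K)" using X by blast
      moreover have "bounded (X \<inter> f -` K)"
        unfolding bounded_def using R(2) K(1) by (intro exI[of _ a] exI[of _ R]) auto
      ultimately show ?thesis unfolding eq by (simp add: compact_eq_bounded_closed)
    qed
    have im: "f ` ?S \<subseteq> ?U" by auto
    have "proper_map (top_of_set ?S) (top_of_set ?U) f"
      unfolding proper_map_alt
    proof (intro conjI allI impI)
      show "closed_map (top_of_set ?S) (top_of_set ?U) f"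
        unfolding closed_map_def using Starlike.proper_map[OF _ cpt im] by blast
      fix K assume "compactin (top_of_set ?U) K"
      then have "K \<subseteq> ?U" "compact K" by (auto simp: compactin_subtopology)
      then have "compact (?S \<inter> f -` K)" by (rule cpt)
      moreover have eq: "{x. x \<in> topspace (top_of_set ?S) \<and> f x \<in> K} = ?S \<inter> f -` K" by auto
      ultimately show "compactin (top_of_set ?S) {x. x \<in> topspace (top_of_set ?S) \<and> f x \<in> K}"
        unfolding eq compactin_subtopology by auto
    qed
    then show "proper_at X f y" unfolding proper_at_def using R(1) by (intro exI[of _ ?U]) auto
  qed
  then show ?thesis unfolding nonproper_set_def mem_Collect_eq
    by (simp add: not_le conj_commute)
qed

lemma nonproper_set_polymap_iff:
  assumes "affine_variety X"
  shows "y \<in> nonproper_set X (polymap F) \<longleftrightarrow>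
    (\<forall>\<epsilon>>0. \<forall>R. \<exists>x\<in>X. norm x > R \<and> dist (polymap F x) y < \<epsilon>)"
  using nonproper_set_iff[OF affine_variety_closed[OF assms] polymap_continuous, of y F 0]
  by (simp add: dist_commute)

text \<open>A point is in the non-properness set iff, for some coordinate \<open>x\<^sub>i\<close>, its extension by \<open>0\<close> is in
  the closure of the image of \<open>x \<mapsto> (f x, 1 / x\<^sub>i)\<close>.\<close>

lemma affine_variety_nonproper_set:
  fixes X :: "(complex ^ 'n::finite) set" and F :: "'m::finite \<Rightarrow> 'n cpoly"
  assumes X: "affine_variety X"
  shows "affine_variety (nonproper_set X (polymap F))"
proof -
  let ?M = "CARD('m)" and ?S = "nonproper_set X (polymap F)"
  define G where "G i x k = (if k < ?M then polymap F x $ coord_of k else 1 / x $ i)" for i :: 'n and x k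
  define Y where "Y y k = (if k < ?M then y $ coord_of k else 0)" for y :: "complex ^ 'm" and k
  \<comment> \<open>The polynomials that vanish on the image of
    \<open>x \<mapsto> (f x, 1 / x\<^sub>i)\<close> cut out its Zariski closure; \<open>S i\<close>
    is the slice of this closure where the last coordinate is 0.\<close>
  define S where "S i = {y. \<forall>f\<in>{f \<in> mpol (Suc ?M). \<forall>x\<in>X. x $ i \<noteq> 0 \<longrightarrow> f (G i x) = 0}. f (Y y) = 0}" for i
  have var: "affine_variety (S i)" for i
  proof -
    let ?A = "{f \<in> mpol (Suc ?M). \<forall>x\<in>X. x $ i \<noteq> 0 \<longrightarrow> f (G i x) = 0}"
    have "\<exists>p. \<forall>y. f (\<lambda>k. Y y k) = cpoly_eval p y" if f: "f \<in> ?A" for f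
    proof (rule mpol_cpoly_eval[of f "Suc ?M" "\<lambda>k y. Y y k"])
      show "f \<in> mpol (Suc ?M)" using f by simp
      fix k
      show "\<exists>p. \<forall>y. Y y k = cpoly_eval p y"
      proof (cases "k < ?M")
        case True
        then show ?thesis unfolding Y_def
          by (intro exI[of _ "Poly_Mapping.single (Poly_Mapping.single (coord_of k) 1) 1"])
            (simp only: cpoly_eval_var if_True simp_thms)
      next
        case False
        then show ?thesis unfolding Y_def by (intro exI[of _ 0]) simp
      qed
    qed
    then have "\<forall>f\<in>?A. \<exists>p. \<forall>y. f (Y y) = cpoly_eval p y" by blast
    from bchoice[OF this] obtain p where p: "\<forall>f\<in>?A. \<forall>y. f (Y y) = cpoly_eval (p f) y" ..
    have "y \<in> S i \<longleftrightarrow> (\<forall>f\<in>?A. cpoly_eval (p f) y = 0)" for y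
    proof -
      have "y \<in> S i \<longleftrightarrow> (\<forall>f\<in>?A. f (Y y) = 0)" unfolding S_def by (rule mem_Collect_eq)
      also have "\<dots> \<longleftrightarrow> (\<forall>f\<in>?A. cpoly_eval (p f) y = 0)"
        by (rule ball_cong[OF refl]) (simp only: p[rule_format])
      finally show ?thesis .
    qed
    then have "S i = {y. \<forall>q\<in>p ` ?A. cpoly_eval q y = 0}" by (intro set_eqI) (simp only: mem_Collect_eq ball_simps)
    then show ?thesis unfolding affine_variety_def by blast
  qed
  have sub: "y \<in> ?S" if y: "y \<in> S i" for y i
  proof -
    let ?h = "Poly_Mapping.single (Poly_Mapping.single i 1) (1 :: complex)"
    have h: "cpoly_eval ?h x = x $ i" for x by (rule cpoly_eval_var)
    have "\<exists>u. (\<forall>k :: nat. u k \<in> X \<and> cpoly_eval ?h (u k) \<noteq> 0) \<and>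
      (\<forall>j<Suc ?M. (\<lambda>k. G i (u k) j) \<longlonglongrightarrow> Y y j)"
    proof (rule zariski_closure_limit[OF X])
      fix j
      show "\<exists>p q. \<forall>x. cpoly_eval ?h x \<noteq> 0 \<longrightarrow> G i x j = cpoly_eval p x + cpoly_eval q x / cpoly_eval ?h x"
      proof (cases "j < ?M")
        case True
        then show ?thesis
          by (intro exI[of _ "F (coord_of j)"] exI[of _ 0]) (simp add: G_def polymap_def)
      next
        case False
        then show ?thesis
          unfolding h by (intro exI[of _ 0] exI[of _ "Poly_Mapping.single 0 1"])
            (simp add: G_def cpoly_eval_const del: cpoly_eval_single single_one)
      qed
    next
      fix f assume "f \<in> mpol (Suc ?M)" "\<And>x. x \<in> X \<Longrightarrow> cpoly_eval ?h x \<noteq> 0 \<Longrightarrow> f (\<lambda>j. G i x j) = 0"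
      then show "f (Y y) = 0" using y unfolding S_def h by simp
    qed
    then obtain u where u: "\<And>k. u k \<in> X" "\<And>k. u k $ i \<noteq> 0"
      "\<And>j. j < Suc ?M \<Longrightarrow> (\<lambda>k. G i (u k) j) \<longlonglongrightarrow> Y y j"
      unfolding h by blast
    have lim: "(\<lambda>k. polymap F (u k)) \<longlonglongrightarrow> y"
    proof (rule coords_tendsto)
      fix j assume "j < CARD('m)"
      then show "(\<lambda>k. coords (polymap F (u k)) j) \<longlonglongrightarrow> coords y j"
        using u(3)[of j] by (simp add: G_def Y_def coords_def)
    qed
    have inv: "(\<lambda>k. 1 / u k $ i) \<longlonglongrightarrow> 0" using u(3)[of ?M] by (simp add: G_def Y_def)
    show ?thesis
      unfolding nonproper_set_polymap_iff[OF X]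
    proof (intro allI impI)
      fix \<epsilon> R :: real assume "\<epsilon> > 0"
      \<comment> \<open>Keeps the radius positive, \<open>R\<close> being an arbitrary real
        number.\<close>
      let ?R = "max R 1"
      have "\<forall>\<^sub>F k in sequentially. dist (polymap F (u k)) y < \<epsilon>" using lim \<open>\<epsilon> > 0\<close> by (simp add: tendsto_iff)
      moreover have "\<forall>\<^sub>F k in sequentially. dist (1 / u k $ i) 0 < 1 / ?R"
        using inv unfolding tendsto_iff by (elim allE impE) auto
      ultimately have "\<forall>\<^sub>F k in sequentially. norm (u k) > R \<and> dist (polymap F (u k)) y < \<epsilon>"
      proof eventually_elim
        case (elim k)
        then have "1 / norm (u k $ i) < 1 / ?R" by (simp add: norm_divide)
        then have "?R < norm (u k $ i)" using u(2)[of k] by (simp add: field_simps)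
        then show ?case using elim Finite_Cartesian_Product.norm_nth_le[of "u k" i] by simp
      qed
      then show "\<exists>x\<in>X. R < norm x \<and> dist (polymap F x) y < \<epsilon>"
        using u(1) eventually_happens'[OF sequentially_bot] by blast
    qed
  qed
  have sup: "\<exists>i. y \<in> S i" if y: "y \<in> ?S" for y
  proof -
    have "\<exists>x\<in>X. real k < norm x \<and> dist (polymap F x) y < 1 / Suc k" for k
      using y unfolding nonproper_set_polymap_iff[OF X] by simp
    then obtain u where u: "\<And>k. u k \<in> X" "\<And>k. real k < norm (u k)" "\<And>k. dist (polymap F (u k)) y < 1 / Suc k"
      by metis
    \<comment> \<open>Some coordinate has at least the share \<open>1 / CARD('n)\<close> of the
      norm. Along a subsequence it is always the same one, and its index is the \<open>i\<close>
      sought.\<close>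
    have "\<exists>i. norm (u k) \<le> CARD('n) * norm (u k $ i)" for k
    proof (rule ccontr)
      assume "\<nexists>i. norm (u k) \<le> CARD('n) * norm (u k $ i)"
      then have "norm (u k $ i) < norm (u k) / CARD('n)" for i
        by (simp add: not_le field_simps)
      then have "(\<Sum>i\<in>UNIV. norm (u k $ i)) < (\<Sum>i\<in>(UNIV :: 'n set). norm (u k) / CARD('n))"
        by (intro sum_strict_mono) auto
      then show False using L2_set_le_sum[of UNIV "\<lambda>i. norm (u k $ i)"] by (simp add: norm_vec_def)
    qed
    then obtain c where c: "\<And>k. norm (u k) \<le> CARD('n) * norm (u k $ c k)" by metis
    obtain i where "infinite {k. c k = i}"
      using pigeonhole_infinite[of UNIV c] by auto
    then obtain r :: "nat \<Rightarrow> nat" where r: "strict_mono r" "\<And>k. c (r k) = i"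
      using infinite_enumerate by blast
    let ?u = "\<lambda>k. u (r k)"
    have big: "real k < CARD('n) * norm (?u k $ i)" for k
      using u(2)[of "r k"] c[of "r k"] r(2)[of k] strict_mono_imp_increasing[OF r(1), of k] by simp
    have nz: "?u k $ i \<noteq> 0" for k using big[of k] by auto
    have inv: "(\<lambda>k. 1 / ?u k $ i) \<longlonglongrightarrow> 0"
    proof (rule Lim_null_comparison)
      show "(\<lambda>k. CARD('n) * inverse (real k)) \<longlonglongrightarrow> 0"
        using tendsto_mult[OF tendsto_const lim_inverse_n, of "real CARD('n)"] by simp
      show "\<forall>\<^sub>F k in sequentially. norm (1 / ?u k $ i) \<le> CARD('n) * inverse (real k)"
        using eventually_gt_at_top[of 0]
      proof eventually_elim
        case (elim k)
        then show ?case using big[of k] nz[of k] by (simp add: norm_divide field_simps)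
      qed
    qed
    have "(\<lambda>k. polymap F (?u k)) \<longlonglongrightarrow> y"
    proof -
      have "(\<lambda>k. polymap F (u k) - y) \<longlonglongrightarrow> 0"
        by (rule Lim_null_comparison[OF always_eventually LIMSEQ_inverse_real_of_nat])
          (use u(3) in \<open>auto simp: dist_norm inverse_eq_divide intro: less_imp_le\<close>)
      then have "(\<lambda>k. polymap F (u k)) \<longlonglongrightarrow> y" by (simp add: LIM_zero_iff)
      then show ?thesis using LIMSEQ_subseq_LIMSEQ[OF _ r(1)] by (simp add: o_def)
    qed
    then have "(\<lambda>k. polymap F (?u k) $ j) \<longlonglongrightarrow> y $ j" for j by (rule tendsto_vec_nth)
    then have lim: "(\<lambda>k. G i (?u k) j) \<longlonglongrightarrow> Y y j" for j
      unfolding G_def Y_def using inv by (cases "j < ?M") simp_all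
    have "f (Y y) = 0" if f: "f \<in> mpol (Suc ?M)" "\<forall>x\<in>X. x $ i \<noteq> 0 \<longrightarrow> f (G i x) = 0" for f
    proof -
      have "(\<lambda>k. f (G i (?u k))) \<longlonglongrightarrow> f (Y y)" by (rule mpol_tendsto[OF f(1) lim])
      moreover have "f (G i (?u k)) = 0" for k using f(2) u(1) nz by blast
      ultimately show ?thesis by (simp add: LIMSEQ_const_iff)
    qed
    then show ?thesis unfolding S_def by blast
  qed
  have "?S = \<Union>(range S)" using sub sup by blast
  then show ?thesis using affine_variety_Union[of "range S"] var by auto
qed

section \<open>Parametric curves\<close>

lemma param_degree_le: "degree (\<gamma> i) \<le> param_degree \<gamma>"
  unfolding param_degree_def by (intro Max_ge) auto

lemma param_degree_leI: "(\<And>i. degree (\<gamma> i) \<le> d) \<Longrightarrow> param_degree \<gamma> \<le> d"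
  unfolding param_degree_def by (intro Max.boundedI) auto

lemma param_map_tendsto: "(s \<longlongrightarrow> t) F \<Longrightarrow> ((\<lambda>k. param_map \<gamma> (s k)) \<longlongrightarrow> param_map \<gamma> t) F"
  by (rule vec_tendstoI) (simp add: param_map_def tendsto_poly)

lemma cpoly_eval_param:
  fixes \<gamma> :: "'n::finite \<Rightarrow> complex poly"
  shows "\<exists>r. degree r \<le> total_degree q * param_degree \<gamma> \<and> (\<forall>t. cpoly_eval q (param_map \<gamma> t) = poly r t)"
proof -
  let ?r = "\<Sum>e\<in>Poly_Mapping.keys q. smult (Poly_Mapping.lookup q e) (\<Prod>i\<in>UNIV. \<gamma> i ^ Poly_Mapping.lookup e i)"
  have "degree ?r \<le> total_degree q * param_degree \<gamma>"
  proof (rule degree_sum_le)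
    fix e assume e: "e \<in> Poly_Mapping.keys q"
    have "degree (\<Prod>i\<in>UNIV. \<gamma> i ^ Poly_Mapping.lookup e i) \<le>
        (\<Sum>i\<in>UNIV. degree (\<gamma> i ^ Poly_Mapping.lookup e i))"
      using degree_prod_sum_le[of UNIV "\<lambda>i. \<gamma> i ^ Poly_Mapping.lookup e i"] by (simp add: o_def)
    also have "\<dots> \<le> (\<Sum>i\<in>UNIV. Poly_Mapping.lookup e i * param_degree \<gamma>)"
    proof (rule sum_mono)
      fix i
      have "degree (\<gamma> i ^ Poly_Mapping.lookup e i) \<le> degree (\<gamma> i) * Poly_Mapping.lookup e i" by (rule degree_power_le)
      also have "\<dots> \<le> param_degree \<gamma> * Poly_Mapping.lookup e i" by (rule mult_right_mono[OF param_degree_le]) simp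
      finally show "degree (\<gamma> i ^ Poly_Mapping.lookup e i) \<le> Poly_Mapping.lookup e i * param_degree \<gamma>"
        by (simp add: mult.commute)
    qed
    also have "\<dots> = (\<Sum>i\<in>UNIV. Poly_Mapping.lookup e i) * param_degree \<gamma>" by (simp add: sum_distrib_right)
    also have "\<dots> \<le> total_degree q * param_degree \<gamma>"
      unfolding total_degree_def using e by (intro mult_right_mono Max_ge) auto
    finally show "degree (smult (Poly_Mapping.lookup q e) (\<Prod>i\<in>UNIV. \<gamma> i ^ Poly_Mapping.lookup e i))
        \<le> total_degree q * param_degree \<gamma>"
      using degree_smult_le order_trans by blast
  qed simp
  moreover have "cpoly_eval q (param_map \<gamma> t) = poly ?r t" for t
    by (simp add: cpoly_eval_def monom_eval_def param_map_def poly_sum poly_prod)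
  ultimately show ?thesis by blast
qed

lemma polymap_param:
  fixes \<gamma> :: "'n::finite \<Rightarrow> complex poly" and F :: "'m::finite \<Rightarrow> 'n cpoly"
  obtains \<delta> where "param_degree \<delta> \<le> polymap_degree F * param_degree \<gamma>"
    "\<And>t. polymap F (param_map \<gamma> t) = param_map \<delta> t"
proof -
  have "\<forall>i. \<exists>r. degree r \<le> total_degree (F i) * param_degree \<gamma> \<and>
      (\<forall>t. cpoly_eval (F i) (param_map \<gamma> t) = poly r t)"
    using cpoly_eval_param by blast
  from choice[OF this] obtain r where r: "\<And>i. degree (r i) \<le> total_degree (F i) * param_degree \<gamma>"
    "\<And>i t. cpoly_eval (F i) (param_map \<gamma> t) = poly (r i) t"
    by blast
  have "total_degree (F i) \<le> polymap_degree F" for i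
    unfolding polymap_degree_def by (intro Max_ge) auto
  then have "degree (r i) \<le> polymap_degree F * param_degree \<gamma>" for i
    using r(1)[of i] by (meson mult_right_mono order_trans zero_le)
  then show ?thesis using r(2)
    by (intro that[of r] param_degree_leI) (simp_all add: polymap_def param_map_def)
qed

text \<open>An equation of \<open>W\<close> that fails somewhere on the curve pulls back to a
  nonzero univariate polynomial.\<close>

lemma param_preimage:
  assumes "affine_variety W"
  shows "range (param_map \<gamma>) \<subseteq> W \<or> finite {t. param_map \<gamma> t \<in> W}"
proof -
  obtain P where P: "W = {x. \<forall>p\<in>P. cpoly_eval p x = 0}"
    using assms unfolding affine_variety_def by blast
  show ?thesis
  proof (cases "range (param_map \<gamma>) \<subseteq> W")
    case False
    then obtain p t0 where p: "p \<in> P" "cpoly_eval p (param_map \<gamma> t0) \<noteq> 0" unfolding P by auto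
    obtain r where r: "\<And>t. cpoly_eval p (param_map \<gamma> t) = poly r t" using cpoly_eval_param by blast
    have "r \<noteq> 0" using p r[of t0] by auto
    moreover have "{t. param_map \<gamma> t \<in> W} \<subseteq> {t. poly r t = 0}" unfolding P using p(1) r by auto
    ultimately show ?thesis using poly_roots_finite finite_subset by blast
  qed simp
qed

lemma param_range_Un:
  assumes "affine_variety A" "affine_variety B" "range (param_map \<gamma>) \<subseteq> A \<union> B"
  shows "range (param_map \<gamma>) \<subseteq> A \<or> range (param_map \<gamma>) \<subseteq> B"
proof (rule ccontr)
  assume "\<not> ?thesis"
  then have "finite ({t. param_map \<gamma> t \<in> A} \<union> {t. param_map \<gamma> t \<in> B})"
    using param_preimage[OF assms(1), of \<gamma>] param_preimage[OF assms(2), of \<gamma>] by auto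
  moreover have "{t. param_map \<gamma> t \<in> A} \<union> {t. param_map \<gamma> t \<in> B} = UNIV" using assms(3) by auto
  ultimately show False using infinite_UNIV_char_0[where 'a = complex] by simp
qed

lemma nonconstant_not_constant_on:
  "\<not> param_map \<gamma> constant_on UNIV \<longleftrightarrow> (\<exists>t. param_map \<gamma> t \<noteq> param_map \<gamma> 0)"
proof
  assume *: "\<not> param_map \<gamma> constant_on UNIV"
  show "\<exists>t. param_map \<gamma> t \<noteq> param_map \<gamma> 0"
  proof (rule ccontr)
    assume "\<nexists>t. param_map \<gamma> t \<noteq> param_map \<gamma> 0"
    then have "param_map \<gamma> constant_on UNIV"
      unfolding constant_on_def by (intro exI[of _ "param_map \<gamma> 0"]) blast
    then show False using * by blast
  qed
next
  assume "\<exists>t. param_map \<gamma> t \<noteq> param_map \<gamma> 0"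
  then show "\<not> param_map \<gamma> constant_on UNIV" unfolding constant_on_def by (metis UNIV_I)
qed

lemma param_fibre_finite:
  assumes "\<not> param_map \<gamma> constant_on UNIV"
  shows "finite {t. param_map \<gamma> t = c}"
  using param_preimage[OF affine_variety_singleton, of \<gamma> c] assms unfolding constant_on_def by auto

lemma param_preimage_finite:
  assumes "\<not> param_map \<gamma> constant_on UNIV" "finite A"
  shows "finite {t. param_map \<gamma> t \<in> A}"
proof -
  have "{t. param_map \<gamma> t \<in> A} = (\<Union>c\<in>A. {t. param_map \<gamma> t = c})" by auto
  then show ?thesis using param_fibre_finite[OF assms(1)] assms(2) by simp
qed

lemma param_range_infinite:
  assumes "\<not> param_map \<gamma> constant_on UNIV"
  shows "infinite (range (param_map \<gamma>))"
  using param_preimage_finite[OF assms, of "range (param_map \<gamma>)"] infinite_UNIV_char_0[where 'a = complex]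
  by auto

lemma poly_cpoly: "\<exists>p. \<forall>x :: complex ^ 1. poly q (x $ 1) = cpoly_eval p x"
proof -
  have "(\<lambda>w. poly q (w 0)) \<in> mpol 1"
    unfolding poly_altdef by (intro mpol_sum mpol_cmult mpol_power mpol_var) simp
  from mpol_coords[OF this] obtain p where p: "\<And>x :: complex ^ 1. poly q (coords x 0) = cpoly_eval p x" by blast
  have "coords x 0 = x $ 1" for x :: "complex ^ 1"
    unfolding coords_def by (rule arg_cong[of _ _ "\<lambda>i. x $ i"]) (rule num1_eq1)
  then show ?thesis using p by (intro exI[of _ p]) simp
qed

text \<open>A point of the Zariski closure is a limit of values of the curve at parameters
  \<open>t\<^sub>k\<close>. A non-constant coordinate tends to infinity with the parameter, so the
  \<open>t\<^sub>k\<close> are bounded, and at the limit of a convergent subsequence the curve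
  passes through the point.\<close>

lemma affine_variety_param_range:
  fixes \<gamma> :: "'n::finite \<Rightarrow> complex poly"
  assumes \<gamma>: "\<not> param_map \<gamma> constant_on UNIV"
  shows "affine_variety (range (param_map \<gamma>))"
proof -
  let ?R = "range (param_map \<gamma>)"
  let ?C = "\<Inter>{W. affine_variety W \<and> ?R \<subseteq> W}"
  have C: "affine_variety ?C" by (rule affine_variety_Inter) simp
  have "?C \<subseteq> ?R"
  proof
    fix x assume x: "x \<in> ?C"
    let ?h = "Poly_Mapping.single 0 (1 :: complex) :: 1 cpoly"
    have h: "cpoly_eval ?h y = 1" for y by (rule cpoly_eval_const)
    have "affine_variety (UNIV :: (complex ^ 1) set)" unfolding affine_variety_def by (intro exI[of _ "{}"]) auto
    then have "\<exists>u :: nat \<Rightarrow> complex ^ 1. (\<forall>k. u k \<in> UNIV \<and> cpoly_eval ?h (u k) \<noteq> 0) \<and>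
      (\<forall>j<CARD('n). (\<lambda>k. coords (param_map \<gamma> (u k $ 1)) j) \<longlonglongrightarrow> coords x j)"
    proof (rule zariski_closure_limit)
      fix j
      obtain p where "\<And>y :: complex ^ 1. poly (\<gamma> (coord_of j)) (y $ 1) = cpoly_eval p y" using poly_cpoly by blast
      then show "\<exists>p q. \<forall>y. cpoly_eval ?h y \<noteq> 0 \<longrightarrow>
          coords (param_map \<gamma> (y $ 1)) j = cpoly_eval p y + cpoly_eval q y / cpoly_eval ?h y"
        by (intro exI[of _ p] exI[of _ 0]) (simp add: coords_def param_map_def)
    next
      fix f :: "point \<Rightarrow> complex"
      assume f: "f \<in> mpol (CARD('n))"
        "\<And>y :: complex ^ 1. y \<in> UNIV \<Longrightarrow> cpoly_eval ?h y \<noteq> 0 \<Longrightarrow> f (\<lambda>j. coords (param_map \<gamma> (y $ 1)) j) = 0"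
      obtain r where r: "\<And>y :: complex ^ 'n. f (coords y) = cpoly_eval r y" using mpol_coords[OF f(1)] by blast
      have "cpoly_eval r (param_map \<gamma> t) = 0" for t
        using f(2)[of "vec t"] h r by simp
      then have "?R \<subseteq> {y. \<forall>p\<in>{r}. cpoly_eval p y = 0}" by auto
      moreover have "affine_variety {y. \<forall>p\<in>{r}. cpoly_eval p y = 0}" unfolding affine_variety_def by blast
      ultimately have "x \<in> {y. \<forall>p\<in>{r}. cpoly_eval p y = 0}" using x by blast
      then show "f (coords x) = 0" using r by simp
    qed
    then obtain u :: "nat \<Rightarrow> complex ^ 1" where
      "\<And>j. j < CARD('n) \<Longrightarrow> (\<lambda>k. coords (param_map \<gamma> (u k $ 1)) j) \<longlonglongrightarrow> coords x j" by blast
    then have lim: "(\<lambda>k. param_map \<gamma> (u k $ 1)) \<longlonglongrightarrow> x" by (rule coords_tendsto)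
    let ?t = "\<lambda>k. u k $ 1"
    obtain t0 where "param_map \<gamma> t0 \<noteq> param_map \<gamma> 0" using \<gamma> unfolding nonconstant_not_constant_on by blast
    then obtain i where i: "poly (\<gamma> i) t0 \<noteq> poly (\<gamma> i) 0" unfolding param_map_def vec_eq_iff by auto
    obtain a q where q: "\<gamma> i = pCons a q" by (cases "\<gamma> i")
    then have "q \<noteq> 0" using i by auto
    have "Bseq (\<lambda>k. param_map \<gamma> (?t k) $ i)"
      using tendsto_vec_nth[OF lim, of i] by (intro convergent_imp_Bseq convergentI)
    then obtain K where K: "\<And>k. norm (poly (\<gamma> i) (?t k)) \<le> K" unfolding Bseq_def param_map_def by auto
    obtain r where r: "\<And>z. r \<le> norm z \<Longrightarrow> K + 1 \<le> norm (poly (\<gamma> i) z)"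
      using poly_infinity[OF \<open>q \<noteq> 0\<close>, of "K + 1" a] unfolding q by blast
    have "norm (?t k) \<le> r" for k using K[of k] r[of "?t k"] by linarith
    then have "bounded (range ?t)" unfolding bounded_iff by blast
    then obtain l s where s: "strict_mono s" "(?t \<circ> s) \<longlonglongrightarrow> l"
      using bounded_imp_convergent_subsequence by blast
    have "(\<lambda>k. param_map \<gamma> ((?t \<circ> s) k)) \<longlonglongrightarrow> param_map \<gamma> l" by (rule param_map_tendsto[OF s(2)])
    moreover have "(\<lambda>k. param_map \<gamma> ((?t \<circ> s) k)) \<longlonglongrightarrow> x"
      using LIMSEQ_subseq_LIMSEQ[OF lim s(1)] by (simp add: o_def)
    ultimately show "x \<in> ?R" using LIMSEQ_unique by blast
  qed
  then have "?R = ?C" by blast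
  then show ?thesis using C by simp
qed

lemma irreducible_param_range: "irreducible_in zariski (range (param_map \<gamma>))"
  unfolding irreducible_zariski using param_range_Un by blast

lemma irreducible_singleton: "irreducible_in zariski {c}"
  unfolding irreducible_zariski by blast

lemma irreducible_finite:
  assumes "irreducible_in zariski Z" "finite (Z :: (complex ^ 'n::finite) set)"
  shows "\<exists>a. Z = {a}"
proof -
  obtain a where a: "a \<in> Z" using assms(1) unfolding irreducible_zariski by blast
  have "affine_variety {a}" "affine_variety (Z - {a})" "Z \<subseteq> {a} \<union> (Z - {a})"
    using assms(2) affine_variety_finite by auto
  then have "Z \<subseteq> {a} \<or> Z \<subseteq> Z - {a}" using assms(1) unfolding irreducible_zariski by blast
  then show ?thesis using a by blast
qed

lemma closedin_subtopology_variety: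
  "affine_variety X \<Longrightarrow> closedin (subtopology zariski X) A \<longleftrightarrow> affine_variety A \<and> A \<subseteq> X"
  using closedin_closed_subtopology[of zariski X A] by (simp add: closedin_zariski)

text \<open>A closed proper subset of the range has finite preimage, hence is finite, and if
  irreducible it is a point. So chains of irreducible closed sets have length at most 1, which a
  point in the curve attains.\<close>

lemma polynomially_parametric_curve_range:
  fixes \<gamma> :: "'n::finite \<Rightarrow> complex poly"
  assumes \<gamma>: "\<not> param_map \<gamma> constant_on UNIV" and d: "param_degree \<gamma> \<le> d"
  shows "polynomially_parametric_curve d (range (param_map \<gamma>))"
proof -
  let ?\<Gamma> = "range (param_map \<gamma>)"
  let ?T = "subtopology zariski ?\<Gamma>"
  note var = affine_variety_param_range[OF \<gamma>]
  note closed = closedin_subtopology_variety[OF var]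
  define chain where "chain n Z \<longleftrightarrow> (\<forall>i\<le>n. closedin ?T (Z i) \<and> irreducible_in ?T (Z i)) \<and>
    (\<forall>i<n. Z i \<subset> Z (Suc i))" for n :: nat and Z :: "nat \<Rightarrow> (complex ^ 'n) set"
  have dim: "krull_dim ?T = Sup {enat n | n. \<exists>Z. chain n Z}"
    unfolding krull_dim_def chain_def ..
  have "n \<le> 1" if Z: "chain n Z" for n Z
  proof (rule ccontr)
    assume "\<not> n \<le> 1"
    then have n: "2 \<le> n" by simp
    have Zi: "affine_variety (Z i)" "Z i \<subseteq> ?\<Gamma>" "irreducible_in zariski (Z i)" if "i \<le> n" for i
      using Z that unfolding chain_def closed irreducible_in_subtopology by auto
    have "Z 0 \<subset> Z (Suc 0)" "Z (Suc 0) \<subset> Z (Suc (Suc 0))" using Z n unfolding chain_def by auto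
    then have lt: "Z 0 \<subset> Z 1" "Z 1 \<subset> ?\<Gamma>" using Zi(2)[of "Suc (Suc 0)"] n by auto
    then have "finite {t. param_map \<gamma> t \<in> Z 1}"
      using param_preimage[OF Zi(1)[of 1], of \<gamma>] n by auto
    then have "finite (param_map \<gamma> ` {t. param_map \<gamma> t \<in> Z 1})" by simp
    moreover have "Z 1 \<subseteq> param_map \<gamma> ` {t. param_map \<gamma> t \<in> Z 1}" using lt(2) by auto
    ultimately have "finite (Z 1)" by (rule rev_finite_subset)
    then obtain a where "Z 1 = {a}" using irreducible_finite[OF Zi(3)[of 1]] n by auto
    then have "Z 0 = {}" using lt(1) by auto
    then show False using Zi(3)[of 0] n unfolding irreducible_zariski by simp
  qed
  then have "krull_dim ?T \<le> 1"
    unfolding dim one_enat_def by (intro Sup_least) (elim CollectE exE conjE, simp)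
  moreover have "1 \<le> krull_dim ?T"
  proof -
    let ?Z = "\<lambda>i::nat. if i = 0 then {param_map \<gamma> 0} else ?\<Gamma>"
    have "{param_map \<gamma> 0} \<noteq> ?\<Gamma>" using param_range_infinite[OF \<gamma>] by (metis finite.emptyI finite.insertI)
    then have "chain 1 ?Z"
      unfolding chain_def closed irreducible_in_subtopology
      using var affine_variety_singleton irreducible_singleton irreducible_param_range
      by auto
    then have "enat 1 \<in> {enat n | n. \<exists>Z. chain n Z}" by blast
    then show ?thesis unfolding dim one_enat_def by (rule Sup_upper)
  qed
  ultimately have "krull_dim ?T = 1" by (rule antisym)
  then show ?thesis
    unfolding polynomially_parametric_curve_def irreducible_affine_curve_def
    using var irreducible_param_range \<gamma> d by blast
qed

text \<open>The parametrization covers \<open>\<Gamma>\<close>: otherwise a point, the range and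
  \<open>\<Gamma>\<close> would form a chain of length 2, against Krull dimension one. So
  \<open>x\<close> is attained at some \<open>t0\<close>, and a translation of the parameter moves
  it to 0 without raising the degree.\<close>

lemma polynomially_parametric_curve_through:
  assumes \<Gamma>: "polynomially_parametric_curve d \<Gamma>" and x: "x \<in> \<Gamma>"
  obtains \<gamma> where "param_degree \<gamma> \<le> d" "range (param_map \<gamma>) \<subseteq> \<Gamma>" "\<not> param_map \<gamma> constant_on UNIV"
    "param_map \<gamma> 0 = x"
proof -
  obtain \<gamma> where \<gamma>: "param_degree \<gamma> \<le> d" "range (param_map \<gamma>) \<subseteq> \<Gamma>" "\<not> param_map \<gamma> constant_on UNIV"
    and G: "affine_variety \<Gamma>" "irreducible_in zariski \<Gamma>" "krull_dim (subtopology zariski \<Gamma>) = 1"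
    using \<Gamma> unfolding polynomially_parametric_curve_def irreducible_affine_curve_def by blast
  let ?R = "range (param_map \<gamma>)"
  have "?R = \<Gamma>"
  proof (rule ccontr)
    assume ne: "?R \<noteq> \<Gamma>"
    let ?Z = "\<lambda>i::nat. if i = 0 then {param_map \<gamma> 0} else if i = 1 then ?R else \<Gamma>"
    let ?T = "subtopology zariski \<Gamma>"
    note closed = closedin_subtopology_variety[OF G(1)]
    have R: "?R \<noteq> {param_map \<gamma> 0}" using param_range_infinite[OF \<gamma>(3)] by auto
    have "(\<forall>i\<le>2. closedin ?T (?Z i) \<and> irreducible_in ?T (?Z i)) \<and> (\<forall>i<2. ?Z i \<subset> ?Z (Suc i))"
    proof (intro conjI allI impI)
      fix i :: nat
      show "closedin ?T (?Z i)" unfolding closed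
        using affine_variety_param_range[OF \<gamma>(3)] affine_variety_singleton G(1) \<gamma>(2) by auto
      show "irreducible_in ?T (?Z i)" unfolding irreducible_in_subtopology
        using irreducible_singleton irreducible_param_range G(2) \<gamma>(2) by auto
    next
      fix i :: nat assume "i < 2"
      then have "i = 0 \<or> i = 1" by auto
      then show "?Z i \<subset> ?Z (Suc i)" using ne R \<gamma>(2) by auto
    qed
    then have "\<exists>Z. (\<forall>i\<le>2. closedin ?T (Z i) \<and> irreducible_in ?T (Z i)) \<and> (\<forall>i<2. Z i \<subset> Z (Suc i))"
      by (rule exI[of _ ?Z])
    then have "enat 2 \<le> krull_dim ?T"
      unfolding krull_dim_def by (intro Sup_upper CollectI exI[of _ "2 :: nat"] conjI refl)
    then show False using G(3) by (simp add: one_enat_def)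
  qed
  then obtain t0 where t0: "x = param_map \<gamma> t0" using x by blast
  let ?\<gamma> = "\<lambda>i. \<gamma> i \<circ>\<^sub>p [:t0, 1:]"
  have shift: "param_map ?\<gamma> t = param_map \<gamma> (t0 + t)" for t
    by (simp add: param_map_def poly_pcompose)
  show ?thesis
  proof (rule that[of ?\<gamma>])
    have "degree (?\<gamma> i) \<le> d" for i
      using order_trans[OF param_degree_le \<gamma>(1)] by (simp add: degree_pcompose)
    then show "param_degree ?\<gamma> \<le> d" by (rule param_degree_leI)
    show "range (param_map ?\<gamma>) \<subseteq> \<Gamma>" using \<gamma>(2) by (auto simp: shift)
    show "param_map ?\<gamma> 0 = x" by (simp add: shift t0)
    show "\<not> param_map ?\<gamma> constant_on UNIV"
    proof
      assume "param_map ?\<gamma> constant_on UNIV"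
      then obtain c where c: "\<And>t. param_map \<gamma> (t0 + t) = c" unfolding constant_on_def shift by blast
      have "param_map \<gamma> t = c" for t using c[of "t - t0"] by simp
      then show False using \<gamma>(3) unfolding constant_on_def by blast
    qed
  qed
qed


section \<open>Limits of rescaled curves\<close>

text \<open>Lagrange interpolation with nodes \<open>T\<close>. The weights depend on
  \<open>T\<close> alone, so that one bound serves a whole sequence of polynomials.\<close>

lemma poly_interpolation_at_0:
  assumes "finite T" "card T = Suc d"
  shows "\<exists>w. \<forall>p :: complex poly. degree p \<le> d \<longrightarrow> poly p 0 = (\<Sum>t\<in>T. w t * poly p t)"
proof -
  define L where "L t = (\<Prod>s\<in>T - {t}. smult (1 / (t - s)) [:- s, 1:])" for t :: complex
  have degL: "degree (L t) \<le> d" if "t \<in> T" for t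
  proof -
    have "degree (L t) \<le> (\<Sum>s\<in>T - {t}. degree (smult (1 / (t - s)) [:- s, 1:]))"
      unfolding L_def using degree_prod_sum_le[of "T - {t}" "\<lambda>s. smult (1 / (t - s)) [:- s, 1:]"] assms(1)
      by (simp add: o_def)
    also have "\<dots> \<le> (\<Sum>s\<in>T - {t}. 1)"
      by (intro sum_mono order_trans[OF degree_smult_le]) simp
    also have "\<dots> = d" using assms that by simp
    finally show ?thesis .
  qed
  have L: "poly (L t) s = (if s = t then 1 else 0)" if "t \<in> T" "s \<in> T" for s t
  proof (cases "s = t")
    case True
    then show ?thesis unfolding L_def poly_prod
      by (auto simp flip: diff_divide_distrib intro!: prod.neutral split: if_splits)
  next
    case False
    then have "s \<in> T - {t}" using that by simp
    moreover have "poly (smult (1 / (t - s)) [:- s, 1:]) s = 0" by simp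
    ultimately have "\<exists>r\<in>T - {t}. poly (smult (1 / (t - r)) [:- r, 1:]) s = 0" by blast
    then show ?thesis using False assms(1) unfolding L_def poly_prod by (simp add: prod_zero)
  qed
  have "poly p 0 = (\<Sum>t\<in>T. poly (L t) 0 * poly p t)" if p: "degree p \<le> d" for p :: "complex poly"
  proof -
    let ?q = "\<Sum>t\<in>T. smult (poly p t) (L t)"
    have "p = ?q"
    proof (rule poly_eqI_degree)
      show "degree p < card T" using p assms(2) by simp
      have "degree ?q \<le> d"
        by (rule degree_sum_le[OF assms(1)]) (rule order_trans[OF degree_smult_le degL])
      then show "degree ?q < card T" using assms(2) by simp
      fix s assume s: "s \<in> T"
      have "poly ?q s = (\<Sum>t\<in>T. if s = t then poly p t else 0)"
        unfolding poly_sum by (intro sum.cong) (auto simp: L s)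
      then show "poly p s = poly ?q s" using s assms(1) by simp
    qed
    then have "poly p 0 = poly ?q 0" by (rule arg_cong)
    then show ?thesis by (simp add: poly_sum mult.commute)
  qed
  then show ?thesis by (intro exI[of _ "\<lambda>t. poly (L t) 0"] allI impI)
qed

lemma bounded_family_convergent_subsequence:
  assumes "finite I" "\<And>i k. i \<in> I \<Longrightarrow> cmod (b k i) \<le> K"
  shows "\<exists>r l. strict_mono (r :: nat \<Rightarrow> nat) \<and> (\<forall>i\<in>I. (\<lambda>k. b (r k) i) \<longlonglongrightarrow> l i)"
  using assms
proof (induction rule: finite_induct)
  case empty
  show ?case by (rule exI[of _ id]) (auto simp: strict_mono_def)
next
  case (insert i I)
  have "\<exists>r l. strict_mono (r :: nat \<Rightarrow> nat) \<and> (\<forall>j\<in>I. (\<lambda>k. b (r k) j) \<longlonglongrightarrow> l j)"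
    by (rule insert.IH) (use insert.prems in auto)
  then obtain r l where r': "strict_mono (r :: nat \<Rightarrow> nat) \<and> (\<forall>j\<in>I. (\<lambda>k. b (r k) j) \<longlonglongrightarrow> l j)"
    by (elim exE)
  then have r: "strict_mono r" "\<And>j. j \<in> I \<Longrightarrow> (\<lambda>k. b (r k) j) \<longlonglongrightarrow> l j" by auto
  have "bounded (range (\<lambda>k. b (r k) i))" unfolding bounded_iff using insert.prems by blast
  then obtain l' s where s: "strict_mono s" "((\<lambda>k. b (r k) i) \<circ> s) \<longlonglongrightarrow> l'"
    using bounded_imp_convergent_subsequence by blast
  have "(\<lambda>k. b ((r \<circ> s) k) j) \<longlonglongrightarrow> (l(i := l')) j" if "j \<in> insert i I" for j
    using that s(2) LIMSEQ_subseq_LIMSEQ[OF r(2) s(1), of j] insert.hyps by (auto simp: o_def)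
  then show ?case using strict_mono_o[OF r(1) s(1)] by blast
qed

text \<open>The curves are rescaled so that the coefficients other than the constant one have total
  size 1; this keeps the limit from being constant.\<close>

lemma param_rescaled_limit:
  fixes \<delta> :: "nat \<Rightarrow> 'm::finite \<Rightarrow> complex poly"
  assumes deg: "\<And>k. param_degree (\<delta> k) \<le> D" and nc: "\<And>k. \<not> param_map (\<delta> k) constant_on UNIV"
    and lim: "(\<lambda>k. param_map (\<delta> k) 0) \<longlonglongrightarrow> y"
  shows "\<exists>\<sigma> r \<gamma>. strict_mono (r :: nat \<Rightarrow> nat) \<and> param_degree \<gamma> \<le> D \<and> \<not> param_map \<gamma> constant_on UNIV \<and>
    param_map \<gamma> 0 = y \<and> (\<forall>t. (\<lambda>k. param_map (\<delta> (r k)) (\<sigma> k * t)) \<longlonglongrightarrow> param_map \<gamma> t)"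
proof -
  let ?I = "(UNIV :: 'm set) \<times> {1..D}"
  have "\<exists>\<sigma>::real. 0 \<le> \<sigma> \<and> (\<Sum>(i, j)\<in>?I. cmod (coeff (\<delta> k i) j) * \<sigma> ^ j) = 1" for k
  proof -
    let ?\<phi> = "\<lambda>\<sigma>::real. \<Sum>(i, j)\<in>?I. cmod (coeff (\<delta> k i) j) * \<sigma> ^ j"
    obtain t where "param_map (\<delta> k) t \<noteq> param_map (\<delta> k) 0"
      using nc[of k] unfolding nonconstant_not_constant_on by blast
    then obtain i where i: "poly (\<delta> k i) t \<noteq> poly (\<delta> k i) 0" unfolding param_map_def vec_eq_iff by auto
    let ?j = "degree (\<delta> k i)"
    have j: "?j \<noteq> 0"
    proof
      assume "?j = 0"
      then obtain c where "\<delta> k i = [:c:]" by (rule degree_eq_zeroE)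
      then show False using i by simp
    qed
    have jD: "?j \<le> D" using order_trans[OF param_degree_le deg] .
    let ?c = "cmod (lead_coeff (\<delta> k i))"
    have c: "?c > 0" using j by auto
    \<comment> \<open>At this scale the top term of the non-constant coordinate alone contributes at
      least 1, as \<open>?\<Lambda> ^ ?j \<ge> ?\<Lambda> \<ge> 1 / ?c\<close>. The sum is 0 at
      scale 0, so the intermediate value theorem gives \<open>\<sigma>\<close>.\<close>
    let ?\<Lambda> = "max 1 (1 / ?c)"
    have "1 \<le> ?c * ?\<Lambda>" using c by (simp add: max_def field_simps)
    also have "\<dots> \<le> ?c * ?\<Lambda> ^ ?j" using j by (intro mult_left_mono self_le_power) auto
    also have "\<dots> = (\<Sum>(i, j)\<in>{(i, ?j)}. cmod (coeff (\<delta> k i) j) * ?\<Lambda> ^ j)" by simp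
    also have "\<dots> \<le> ?\<phi> ?\<Lambda>"
      by (rule sum_mono2) (use j jD in auto)
    finally have "1 \<le> ?\<phi> ?\<Lambda>" .
    moreover have "?\<phi> 0 \<le> 1"
    proof -
      have "?\<phi> 0 = 0" by (intro sum.neutral) auto
      then show ?thesis by simp
    qed
    moreover have "continuous_on {0..?\<Lambda>} ?\<phi>"
      unfolding case_prod_unfold by (intro continuous_intros)
    moreover have "(0::real) \<le> ?\<Lambda>" by simp
    ultimately have "\<exists>\<sigma>\<ge>0. \<sigma> \<le> ?\<Lambda> \<and> ?\<phi> \<sigma> = 1"
      by (intro IVT'[of ?\<phi> 0 1 ?\<Lambda>])
    then show ?thesis by (elim exE conjE) (rule exI, rule conjI)
  qed
  then have "\<forall>k. \<exists>\<sigma>::real. 0 \<le> \<sigma> \<and> (\<Sum>(i, j)\<in>?I. cmod (coeff (\<delta> k i) j) * \<sigma> ^ j) = 1" ..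
  from choice[OF this] obtain \<sigma> :: "nat \<Rightarrow> real" where
    *: "\<forall>k. 0 \<le> \<sigma> k \<and> (\<Sum>(i, j)\<in>?I. cmod (coeff (\<delta> k i) j) * \<sigma> k ^ j) = 1" ..
  then have \<sigma>: "0 \<le> \<sigma> k" "(\<Sum>(i, j)\<in>?I. cmod (coeff (\<delta> k i) j) * \<sigma> k ^ j) = 1" for k
    by simp_all
  \<comment> \<open>The coefficients of positive degree of the rescaled curve, each of modulus at
    most 1. The constant ones are not changed by rescaling and converge by
    \<open>lim\<close>.\<close>
  define b where "b k = (\<lambda>(i, j). coeff (\<delta> k i) j * complex_of_real (\<sigma> k) ^ j)" for k
  have nb: "cmod (b k (i, j)) = cmod (coeff (\<delta> k i) j) * \<sigma> k ^ j" for k i j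
    unfolding b_def using \<sigma>(1)[of k] by (simp add: norm_mult norm_power)
  have sum1: "(\<Sum>p\<in>?I. cmod (b k p)) = 1" for k
    using \<sigma>(2)[of k] by (simp add: case_prod_unfold nb[symmetric])
  have "cmod (b k p) \<le> 1" if "p \<in> ?I" for p k
    unfolding sum1[of k, symmetric] by (rule member_le_sum) (use that in auto)
  then have "\<exists>r l. strict_mono (r :: nat \<Rightarrow> nat) \<and> (\<forall>p\<in>?I. (\<lambda>k. b (r k) p) \<longlonglongrightarrow> l p)"
    by (intro bounded_family_convergent_subsequence[of ?I b 1]) auto
  then obtain r l where r': "strict_mono (r :: nat \<Rightarrow> nat) \<and> (\<forall>p\<in>?I. (\<lambda>k. b (r k) p) \<longlonglongrightarrow> l p)"
    by (elim exE)
  then have r: "strict_mono r" "\<And>p. p \<in> ?I \<Longrightarrow> (\<lambda>k. b (r k) p) \<longlonglongrightarrow> l p" by auto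
  have "(\<lambda>k. \<Sum>p\<in>?I. cmod (b (r k) p)) \<longlonglongrightarrow> (\<Sum>p\<in>?I. cmod (l p))"
    by (intro tendsto_sum tendsto_norm r(2))
  then have "(\<Sum>p\<in>?I. cmod (l p)) = 1" using sum1 by (simp add: LIMSEQ_const_iff)
  then obtain i0 j0 where ij: "1 \<le> j0" "j0 \<le> D" "l (i0, j0) \<noteq> 0"
  proof -
    assume "(\<Sum>p\<in>?I. cmod (l p)) = 1"
    then have "\<exists>p\<in>?I. cmod (l p) \<noteq> 0" by (metis sum.neutral zero_neq_one)
    then show thesis using that by auto
  qed
  define \<gamma> where "\<gamma> i = [:y $ i:] + (\<Sum>j\<in>{1..D}. monom (l (i, j)) j)" for i
  have "degree (\<gamma> i) \<le> D" for i
    unfolding \<gamma>_def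
    by (intro degree_add_le degree_sum_le) (auto intro: order_trans[OF degree_monom_le])
  then have "param_degree \<gamma> \<le> D" by (rule param_degree_leI)
  moreover have poly_\<gamma>: "poly (\<gamma> i) t = y $ i + (\<Sum>j\<in>{1..D}. l (i, j) * t ^ j)" for i t
    unfolding \<gamma>_def by (simp add: poly_sum poly_monom)
  have "param_map \<gamma> 0 = y" unfolding param_map_def poly_\<gamma> by (simp add: vec_eq_iff)
  moreover have "\<not> param_map \<gamma> constant_on UNIV"
  proof
    assume "param_map \<gamma> constant_on UNIV"
    then obtain c where c: "\<And>t. param_map \<gamma> t = c" unfolding constant_on_def by blast
    have "poly (\<gamma> i0) t = poly [:c $ i0:] t" for t using c[of t] unfolding param_map_def by auto
    then have "\<gamma> i0 = [:c $ i0:]" using poly_eq_poly_eq_iff by blast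
    then have "coeff (\<gamma> i0) j0 = 0" using ij(1) by (simp add: coeff_eq_0)
    moreover have "coeff (\<gamma> i0) j0 = l (i0, j0)"
      unfolding \<gamma>_def using ij(1,2) by (simp add: coeff_sum coeff_eq_0 sum.delta)
    ultimately show False using ij(3) by simp
  qed
  moreover have "(\<lambda>k. param_map (\<delta> (r k)) (complex_of_real (\<sigma> (r k)) * t)) \<longlonglongrightarrow> param_map \<gamma> t" for t
  proof (rule vec_tendstoI)
    fix i
    have eq: "param_map (\<delta> (r k)) (complex_of_real (\<sigma> (r k)) * t) $ i =
        param_map (\<delta> (r k)) 0 $ i + (\<Sum>j\<in>{1..D}. b (r k) (i, j) * t ^ j)" for k
    proof -
      let ?p = "\<delta> (r k) i" and ?s = "complex_of_real (\<sigma> (r k)) * t"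
      have "poly ?p ?s = (\<Sum>j\<le>degree ?p. coeff ?p j * ?s ^ j)" by (rule poly_altdef)
      also have "\<dots> = (\<Sum>j\<in>{0..D}. coeff ?p j * ?s ^ j)"
        using order_trans[OF param_degree_le[of "\<delta> (r k)" i] deg[of "r k"]]
        by (intro sum.mono_neutral_left) (auto simp: coeff_eq_0)
      also have "\<dots> = coeff ?p 0 + (\<Sum>j\<in>{1..D}. coeff ?p j * ?s ^ j)"
        by (simp add: sum.atLeast_Suc_atMost)
      finally show ?thesis
        unfolding param_map_def b_def by (simp add: poly_0_coeff_0 power_mult_distrib mult.assoc)
    qed
    have "(\<lambda>k. param_map (\<delta> (r k)) 0) \<longlonglongrightarrow> y"
      using LIMSEQ_subseq_LIMSEQ[OF lim r(1)] by (simp add: o_def)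
    then have "(\<lambda>k. param_map (\<delta> (r k)) 0 $ i + (\<Sum>j\<in>{1..D}. b (r k) (i, j) * t ^ j)) \<longlonglongrightarrow>
        y $ i + (\<Sum>j\<in>{1..D}. l (i, j) * t ^ j)"
      by (intro tendsto_intros r(2)) auto
    then show "(\<lambda>k. param_map (\<delta> (r k)) (complex_of_real (\<sigma> (r k)) * t) $ i) \<longlonglongrightarrow> param_map \<gamma> t $ i"
      unfolding eq by (simp add: param_map_def poly_\<gamma>)
  qed
  ultimately show ?thesis using r(1)
    by (intro exI[of _ "\<lambda>k. complex_of_real (\<sigma> (r k))"] exI[of _ r] exI[of _ \<gamma>]) blast
qed

text \<open>Let \<open>A\<close> cut out the closure of the points on infinite fibres. If a
  component \<open>S\<close> through \<open>x\<close> lay in \<open>A\<close>, the nonempty open set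
  \<open>X - Z\<close> would lie in that closure, against generic finiteness. So \<open>S\<close>
  minus \<open>Z\<close> and \<open>A\<close> is nonempty and, by irreducibility of
  \<open>S\<close>, Euclidean dense in \<open>S\<close>.\<close>

lemma generic_finite_fibre_dense:
  fixes X :: "(complex ^ 'n::finite) set"
  assumes X: "affine_variety X" and gf: "generically_finite_on X f" and x: "x \<in> X"
  shows "\<exists>u. (\<forall>k :: nat. u k \<in> X \<and> finite {x' \<in> X. f x' = f (u k)}) \<and> u \<longlonglongrightarrow> x"
proof -
  let ?T = "subtopology zariski X" and ?B = "{x \<in> X. infinite {x' \<in> X. f x' = f x}}"
  let ?C = "?T closure_of ?B"
  have "closedin ?T ?C" by simp
  then obtain A where A: "affine_variety A" "?C = A \<inter> X"
    unfolding closedin_subtopology closedin_zariski by blast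
  obtain S where S: "irreducible_component ?T S" "x \<in> S" using component_exists[OF X x] .
  obtain Z where Z: "affine_variety S" "affine_variety Z" "X = S \<union> Z" "\<not> S \<subseteq> Z"
    using component_complement[OF X S(1)] .
  have irr: "irreducible_in zariski S" using S(1) unfolding component_zariski by blast
  have "\<not> S \<subseteq> A"
  proof
    assume "S \<subseteq> A"
    have "openin ?T (X \<inter> - Z)"
      using Z(2) by (auto simp: openin_subtopology openin_zariski intro!: exI[of _ "- Z"])
    moreover have "X \<inter> - Z \<subseteq> ?C" using \<open>S \<subseteq> A\<close> Z(3) unfolding A(2) by blast
    ultimately have "X \<inter> - Z \<subseteq> ?T interior_of ?C" by (simp add: interior_of_maximal)
    then show False using gf Z(3,4) unfolding generically_finite_on_def by blast
  qed
  then have "\<not> S \<subseteq> Z \<union> A"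
    using irr A(1) Z(2,4) unfolding irreducible_zariski by blast
  from irreducible_open_dense[OF Z(1) irr affine_variety_Un[OF Z(2) A(1)] this S(2)]
  obtain u where u: "\<And>k :: nat. u k \<in> S - (Z \<union> A)" "u \<longlonglongrightarrow> x" by blast
  have "?B \<subseteq> A" using closure_of_subset[of ?B ?T] unfolding A(2) by auto
  then have "u k \<in> X \<and> finite {x' \<in> X. f x' = f (u k)}" for k using u(1)[of k] Z(3) by blast
  then show ?thesis using u(2) by blast
qed

lemma param_curve_in_nonproper_set:
  fixes X :: "(complex ^ 'n::finite) set" and F :: "'m::finite \<Rightarrow> 'n cpoly"
  assumes X: "affine_variety X" and uni: "uniruledness_degree_le X d1"
    and gf: "generically_finite_on X (polymap F)" and y: "y \<in> nonproper_set X (polymap F)"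
  shows "\<exists>\<gamma>. param_degree \<gamma> \<le> d1 * polymap_degree F \<and> \<not> param_map \<gamma> constant_on UNIV \<and>
    param_map \<gamma> 0 = y \<and> range (param_map \<gamma>) \<subseteq> nonproper_set X (polymap F)"
proof -
  let ?f = "polymap F" and ?S = "nonproper_set X (polymap F)"
  \<comment> \<open>Large norm and closeness of the value to \<open>y\<close> are open conditions,
    so they survive the passage to a nearby point on a finite fibre.\<close>
  have "\<exists>x. x \<in> X \<and> finite {x' \<in> X. ?f x' = ?f x} \<and> real k < norm x \<and> dist (?f x) y < 1 / Suc k" for k
  proof -
    obtain x0 where x0: "x0 \<in> X" "norm x0 > real k" "dist (?f x0) y < 1 / Suc k"
      using y[unfolded nonproper_set_polymap_iff[OF X], rule_format, of "1 / Suc k" "real k"] by auto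
    obtain u where u: "\<And>k :: nat. u k \<in> X" "\<And>k. finite {x' \<in> X. ?f x' = ?f (u k)}" "u \<longlonglongrightarrow> x0"
      using generic_finite_fibre_dense[OF X gf x0(1)] by blast
    have "\<forall>\<^sub>F j in sequentially. real k < norm (u j)"
      using order_tendstoD(1)[OF tendsto_norm[OF u(3)] x0(2)] .
    moreover have "\<forall>\<^sub>F j in sequentially. dist (?f (u j)) y < 1 / Suc k"
      using order_tendstoD(2)[OF tendsto_dist[OF polymap_tendsto[OF u(3)] tendsto_const] x0(3)] .
    ultimately have "\<forall>\<^sub>F j in sequentially. real k < norm (u j) \<and> dist (?f (u j)) y < 1 / Suc k"
      by (rule eventually_conj)
    then obtain j where "real k < norm (u j)" "dist (?f (u j)) y < 1 / Suc k"
      using eventually_happens'[OF sequentially_bot] by blast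
    then show ?thesis using u(1,2) by blast
  qed
  then have "\<forall>k. \<exists>x. x \<in> X \<and> finite {x' \<in> X. ?f x' = ?f x} \<and> real k < norm x \<and> dist (?f x) y < 1 / Suc k" ..
  from choice[OF this] obtain x where
    "\<forall>k. x k \<in> X \<and> finite {x' \<in> X. ?f x' = ?f (x k)} \<and> real k < norm (x k) \<and> dist (?f (x k)) y < 1 / Suc k" ..
  then have x: "x k \<in> X" "finite {x' \<in> X. ?f x' = ?f (x k)}" "real k < norm (x k)"
      "dist (?f (x k)) y < 1 / Suc k" for k by blast+
  have "\<exists>\<gamma>. param_degree \<gamma> \<le> d1 \<and> range (param_map \<gamma>) \<subseteq> X \<and> \<not> param_map \<gamma> constant_on UNIV \<and> param_map \<gamma> 0 = x k"
    for k
  proof -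
    obtain S where S: "irreducible_component (subtopology zariski X) S" "x k \<in> S"
      using component_exists[OF X x(1)] .
    then obtain \<Gamma> where \<Gamma>: "polynomially_parametric_curve d1 \<Gamma>" "\<Gamma> \<subseteq> S" "x k \<in> \<Gamma>"
      using uni unfolding uniruledness_degree_le_def by blast
    obtain \<gamma> where "param_degree \<gamma> \<le> d1" "range (param_map \<gamma>) \<subseteq> \<Gamma>" "\<not> param_map \<gamma> constant_on UNIV"
      "param_map \<gamma> 0 = x k" using polynomially_parametric_curve_through[OF \<Gamma>(1,3)] .
    moreover have "S \<subseteq> X" using S(1) unfolding component_zariski by blast
    ultimately show ?thesis using \<Gamma>(2) by blast
  qed
  then obtain \<gamma> where \<gamma>: "\<And>k. param_degree (\<gamma> k) \<le> d1" "\<And>k. range (param_map (\<gamma> k)) \<subseteq> X"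
    "\<And>k. \<not> param_map (\<gamma> k) constant_on UNIV" "\<And>k. param_map (\<gamma> k) 0 = x k" by metis
  have "\<exists>\<delta>. param_degree \<delta> \<le> polymap_degree F * param_degree (\<gamma> k) \<and> (\<forall>t. ?f (param_map (\<gamma> k) t) = param_map \<delta> t)" for k
    using polymap_param[of F "\<gamma> k"] by metis
  then obtain \<delta> where \<delta>: "\<And>k. param_degree (\<delta> k) \<le> polymap_degree F * param_degree (\<gamma> k)"
    "\<And>k t. ?f (param_map (\<gamma> k) t) = param_map (\<delta> k) t" by metis
  have deg: "param_degree (\<delta> k) \<le> d1 * polymap_degree F" for k
    using order_trans[OF \<delta>(1)[of k] mult_left_mono[OF \<gamma>(1)]] by (simp add: mult.commute)
  \<comment> \<open>Otherwise the infinite range of the curve would lie in the finite fibre through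
    \<open>x k\<close>.\<close>
  have nc: "\<not> param_map (\<delta> k) constant_on UNIV" for k
  proof
    assume "param_map (\<delta> k) constant_on UNIV"
    then obtain c where c: "\<And>t. param_map (\<delta> k) t = c" unfolding constant_on_def by blast
    have "range (param_map (\<gamma> k)) \<subseteq> {x' \<in> X. ?f x' = ?f (x k)}"
      using \<gamma>(2)[of k] c \<delta>(2)[of k] \<gamma>(4)[of k] by (auto simp flip: \<gamma>(4))
    then show False using param_range_infinite[OF \<gamma>(3)] x(2) finite_subset by blast
  qed
  have lim: "(\<lambda>k. param_map (\<delta> k) 0) \<longlonglongrightarrow> y"
  proof (rule LIM_zero_cancel, rule Lim_null_comparison[OF always_eventually LIMSEQ_inverse_real_of_nat], rule allI)
    show "norm (param_map (\<delta> k) 0 - y) \<le> inverse (real (Suc k))" for k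
      using x(4)[of k] by (simp add: \<delta>(2)[symmetric] \<gamma>(4) dist_norm inverse_eq_divide)
  qed
  obtain \<sigma> r \<beta> where \<beta>: "strict_mono (r :: nat \<Rightarrow> nat)" "param_degree \<beta> \<le> d1 * polymap_degree F"
    "\<not> param_map \<beta> constant_on UNIV" "param_map \<beta> 0 = y"
    "\<And>t. (\<lambda>k. param_map (\<delta> (r k)) (\<sigma> k * t)) \<longlonglongrightarrow> param_map \<beta> t"
    using param_rescaled_limit[OF deg nc lim] by blast
  define p where "p k t = param_map (\<gamma> (r k)) (\<sigma> k * t)" for k t
  have pX: "p k t \<in> X" for k t unfolding p_def using \<gamma>(2)[of "r k"] by blast
  have plim: "(\<lambda>k. ?f (p k t)) \<longlonglongrightarrow> param_map \<beta> t" for t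
    unfolding p_def \<delta>(2) by (rule \<beta>(5))
  text \<open>Where the limit curve leaves the non-properness set, the rescaled curves stay bounded; their
    degree being at most \<open>d1\<close>, this cannot happen at more than \<open>d1\<close> parameters.\<close>
  have bdd: "Bseq (\<lambda>k. p k t)" if t: "param_map \<beta> t \<notin> ?S" for t
  proof -
    obtain \<epsilon> R where R: "\<epsilon> > 0" "\<And>x. x \<in> X \<Longrightarrow> dist (?f x) (param_map \<beta> t) < \<epsilon> \<Longrightarrow> norm x \<le> R"
      using t unfolding nonproper_set_polymap_iff[OF X] by (metis not_le)
    have "\<forall>\<^sub>F k in sequentially. dist (?f (p k t)) (param_map \<beta> t) < \<epsilon>"
      using plim R(1) by (simp add: tendsto_iff)
    then have "\<forall>\<^sub>F k in sequentially. norm (p k t) \<le> R"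
      by eventually_elim (rule R(2)[OF pX])
    then show ?thesis by (rule BfunI)
  qed
  let ?T = "{t. param_map \<beta> t \<notin> ?S}"
  have finT: "finite ?T"
  proof (rule ccontr)
    assume "infinite ?T"
    then obtain T where T: "T \<subseteq> ?T" "finite T" "card T = Suc d1"
      using infinite_arbitrarily_large by blast
    obtain w where w: "\<And>q :: complex poly. degree q \<le> d1 \<Longrightarrow> poly q 0 = (\<Sum>t\<in>T. w t * poly q t)"
      using poly_interpolation_at_0[OF T(2,3)] by blast
    have "\<forall>t\<in>T. \<exists>K. \<forall>k. norm (p k t) \<le> K"
      using bdd T(1) unfolding Bseq_def by blast
    from bchoice[OF this] obtain K where K: "\<And>t k. t \<in> T \<Longrightarrow> norm (p k t) \<le> K t" by blast
    have comp: "norm (p k 0 $ i) \<le> (\<Sum>t\<in>T. cmod (w t) * K t)" for k i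
    proof -
      \<comment> \<open>Rescaling does not raise the degree, so the same \<open>d1 + 1\<close> nodes
        and weights serve all \<open>k\<close>.\<close>
      let ?q = "\<gamma> (r k) i \<circ>\<^sub>p [:0, \<sigma> k:]"
      have q: "poly ?q t = p k t $ i" for t unfolding p_def param_map_def by (simp add: poly_pcompose mult.commute)
      have "degree ?q \<le> degree (\<gamma> (r k) i) * 1"
        unfolding degree_pcompose by (intro mult_left_mono) simp_all
      then have "degree ?q \<le> d1" using order_trans[OF param_degree_le \<gamma>(1), of "r k" i] by simp
      from w[OF this] have "p k 0 $ i = (\<Sum>t\<in>T. w t * p k t $ i)" unfolding q .
      also have "norm \<dots> \<le> (\<Sum>t\<in>T. cmod (w t) * K t)"
      proof (rule sum_norm_le)
        fix t assume "t \<in> T"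
        then show "norm (w t * p k t $ i) \<le> cmod (w t) * K t"
          unfolding norm_mult
          by (intro mult_left_mono order_trans[OF Finite_Cartesian_Product.norm_nth_le K]) auto
      qed
      finally show ?thesis .
    qed
    \<comment> \<open>This bound does not depend on \<open>k\<close>, whereas
      \<open>p k 0 = x (r k)\<close> has norm above \<open>r k \<ge> k\<close>.\<close>
    let ?K = "\<Sum>i\<in>(UNIV :: 'n set). \<Sum>t\<in>T. cmod (w t) * K t"
    have "norm (x (r k)) \<le> ?K" for k
    proof -
      have "norm (p k 0) \<le> (\<Sum>i\<in>UNIV. norm (p k 0 $ i))"
        unfolding norm_vec_def by (rule L2_set_le_sum) simp
      also have "\<dots> \<le> ?K" by (intro sum_mono comp)
      finally show ?thesis by (simp add: p_def \<gamma>(4))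
    qed
    moreover obtain k where "?K \<le> real k" using real_arch_simple by blast
    ultimately show False using x(3)[of "r k"] strict_mono_imp_increasing[OF \<beta>(1), of k]
      by (smt (verit) of_nat_le_iff)
  qed
  \<comment> \<open>Each exceptional parameter is a limit of parameters that are not exceptional,
    and the non-properness set is Euclidean closed.\<close>
  have "param_map \<beta> t \<in> ?S" for t
  proof (rule Lim_in_closed_set)
    show "closed ?S" by (rule affine_variety_closed[OF affine_variety_nonproper_set[OF X]])
    show "(param_map \<beta> \<longlongrightarrow> param_map \<beta> t) (at t)" by (rule param_map_tendsto) (rule tendsto_ident_at)
    have "\<not> t islimpt ?T" by (rule islimpt_finite[OF finT])
    then show "\<forall>\<^sub>F s in at t. param_map \<beta> s \<in> ?S" by (simp add: islimpt_iff_eventually)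
  qed simp
  then show ?thesis using \<beta> by blast
qed

theorem theorem3p6:
  fixes X :: "(complex ^ 'n::finite) set"
    and F :: "'m::finite \<Rightarrow> 'n cpoly"
    and d1 d2 :: nat
  assumes "affine_variety X"
    and "uniruledness_degree_le X d1"
    and "generically_finite_on X (polymap F)"
    and "polymap_degree F = d2"
  shows "uniruledness_degree_le (nonproper_set X (polymap F)) (d1 * d2)"
  unfolding uniruledness_degree_le_def
proof (intro conjI allI impI ballI)
  let ?S = "nonproper_set X (polymap F)"
  show S: "affine_variety ?S"
    by (rule affine_variety_nonproper_set[OF assms(1)])
  fix S' y assume S': "irreducible_component (subtopology zariski ?S) S'" and y: "y \<in> S'"
  obtain Z where Z: "affine_variety S'" "affine_variety Z" "?S = S' \<union> Z" "\<not> S' \<subseteq> Z"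
    using component_complement[OF S S'] .
  have "irreducible_in zariski S'" using S' unfolding component_zariski by blast
  from irreducible_open_dense[OF Z(1) this Z(2,4) y]
  obtain u where u: "\<And>k :: nat. u k \<in> S' - Z" "u \<longlonglongrightarrow> y" by blast
  have "\<exists>\<gamma>. param_degree \<gamma> \<le> d1 * d2 \<and> \<not> param_map \<gamma> constant_on UNIV \<and>
      param_map \<gamma> 0 = u k \<and> range (param_map \<gamma>) \<subseteq> S'" for k
  proof -
    have "u k \<in> ?S" using u(1)[of k] Z(3) by blast
    from param_curve_in_nonproper_set[OF assms(1-3) this] obtain \<gamma> where
      \<gamma>: "param_degree \<gamma> \<le> d1 * polymap_degree F" "\<not> param_map \<gamma> constant_on UNIV"
        "param_map \<gamma> 0 = u k" "range (param_map \<gamma>) \<subseteq> ?S" by blast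
    \<comment> \<open>The curve passes through \<open>u k\<close>, which lies on no other component;
      being irreducible, it stays in \<open>S'\<close>.\<close>
    have "\<not> range (param_map \<gamma>) \<subseteq> Z" using u(1)[of k] \<gamma>(3) by (metis DiffD2 rangeI subsetD)
    then have "range (param_map \<gamma>) \<subseteq> S'" using param_range_Un[OF Z(1,2)] \<gamma>(4) Z(3) by blast
    then show ?thesis using \<gamma> assms(4) by blast
  qed
  then have "\<forall>k. \<exists>\<gamma>. param_degree \<gamma> \<le> d1 * d2 \<and> \<not> param_map \<gamma> constant_on UNIV \<and>
      param_map \<gamma> 0 = u k \<and> range (param_map \<gamma>) \<subseteq> S'" ..
  from choice[OF this] obtain \<delta> where "\<forall>k. param_degree (\<delta> k) \<le> d1 * d2 \<and>
      \<not> param_map (\<delta> k) constant_on UNIV \<and> param_map (\<delta> k) 0 = u k \<and> range (param_map (\<delta> k)) \<subseteq> S'" ..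
  then have \<delta>: "param_degree (\<delta> k) \<le> d1 * d2" "\<not> param_map (\<delta> k) constant_on UNIV"
    "param_map (\<delta> k) 0 = u k" "range (param_map (\<delta> k)) \<subseteq> S'" for k by blast+
  have "(\<lambda>k. param_map (\<delta> k) 0) \<longlonglongrightarrow> y" using u(2) by (simp add: \<delta>(3))
  \<comment> \<open>All these curves lie in the closed set \<open>S'\<close>, so the limit curve
    does too, and it passes through \<open>y\<close> because \<open>u k\<close> tends to
    \<open>y\<close>.\<close>
  from param_rescaled_limit[OF \<delta>(1,2) this] obtain \<sigma> r \<gamma> where
    \<gamma>: "param_degree \<gamma> \<le> d1 * d2" "\<not> param_map \<gamma> constant_on UNIV" "param_map \<gamma> 0 = y"
      "\<And>t. (\<lambda>k. param_map (\<delta> (r k)) (\<sigma> k * t)) \<longlonglongrightarrow> param_map \<gamma> t" by blast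
  have "param_map \<gamma> t \<in> S'" for t
    using closed_sequentially[OF affine_variety_closed[OF Z(1)] _ \<gamma>(4)] \<delta>(4) by blast
  then have "range (param_map \<gamma>) \<subseteq> S'" by blast
  moreover have "y \<in> range (param_map \<gamma>)" using \<gamma>(3) by (metis rangeI)
  ultimately show "\<exists>\<Gamma>. polynomially_parametric_curve (d1 * d2) \<Gamma> \<and> \<Gamma> \<subseteq> S' \<and> y \<in> \<Gamma>"
    using polynomially_parametric_curve_range[OF \<gamma>(2,1)] by blast
qed

end
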